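(* Let $(\mathcal{A},E,\mathcal{B})$ be an operator-valued $C^*$-probability space and $Y=Y^*\in\mathcal{A}$ monotone infinitely divisible over $\mathcal{B}$ with $E[Y]=0$ and $E[YbY]=\eta(b)$. Let $A\in\mathcal{A}$ be a $\mathcal{B}$-valued arcsine element with $E[A]=0$ and $E[AbA]=\eta(b)$. Then for every $k\in\mathbb{N}$ and $\mathfrak b\in\mathbb{H}^+(M_k(\mathcal{B}))$, $$\big\|\mathcal G^{M_k(\mathcal{B})}_{1_k\otimes Y}(\mathfrak b)-\mathcal G^{M_k(\mathcal{B})}_{1_k\otimes A}(\mathfrak b)\big\|\le k\|(\operatorname{Im}\mathfrak b)^{-1}\|^4\sqrt{\|\eta(1)\|}\sqrt{\sup_{b,b'\in\mathcal{B},\|b\|=\|b'\|=1}\|h_4^{\mathcal{B}}(Yb,Y,Yb',Y)\|}.$$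
   Context: $(\mathcal{A},E,\mathcal{B})$: unital $C^*$-algebra, unital $C^*$-subalgebra $\mathcal{B}$, completely positive conditional expectation $E$. $Y$ is monotone infinitely divisible over $\mathcal{B}$ if for each $n$ there are identically distributed self-adjoint $y_1,\dots,y_n\in\mathcal{A}$ with $Y=y_1+\dots+y_n$ and $\mathcal{A}_{y_1}\prec\cdots\prec\mathcal{A}_{y_n}$ over $\mathcal{B}$, where $\mathcal{A}_y$ is the $\mathcal{B}$-bimodule algebra generated by $y$ and $\prec$ means $E[a_1\cdots a_m]=E[a_1\cdots a_{j-1}E[a_j]a_{j+1}\cdots a_m]$ whenever $a_k$ lies in the algebra of index $i_k$ and $i_{j-1}<i_j>i_{j+1}$ (one inequality dropped at ends). For centered $Y$, the fourth monotone cumulant used here is $h_4^{\mathcal{B}}(Yb,Y,Yb',Y)=E[YbY^2b'Y]-E[YbY]E[Yb'Y]-\tfrac12E[YbE[Y^2]b'Y]$. A $\mathcal{B}$-valued arcsine element with variance $\eta$: $s=s^*$, $E[s]=0$, $E[b_0sb_1\cdots sb_k]=\sum_{\pi\in NC_2(k)}\frac1{\tau(\pi)!}b_0\eta_\pi(b_1,\dots,b_{k-1})b_k$ ($k$ even), $0$ ($k$ odd), with $\eta_\pi$ evaluating nested pairs as $E[sbs]=\eta(b)$ along $\pi$ and $\tau(\pi)!=\prod_{V\in\pi}|\{W\in\pi:W\subseteq[\min V,\max V]\}|$. $\mathcal G^{M_k(\mathcal{B})}_{1_k\otimes s}(\mathfrak b)=(\mathrm{id}_k\otimes E)[(\mathfrak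 b-1_k\otimes s)^{-1}]$ for $\mathfrak b\in M_k(\mathcal{B})$ with $\frac1{2i}(\mathfrak b-\mathfrak b^* )$ positive invertible. *)

theory Defs
  imports Complex_Main "Jordan_Normal_Form.Matrix"
begin

text \<open>A unital complex C*-algebra, encoded as a real unital Banach algebra with
an involution cstar and a central element iu with iu*iu = -1 and cstar iu = -iu
(so complex scalars c act as Re c *R x + Im c *R (iu * x)), satisfying the
C*-identity.\<close>

class cstar_algebra = real_normed_algebra_1 + banach +
  fixes cstar :: "'a \<Rightarrow> 'a"
    and iu :: 'a
  assumes cstar_add: "cstar (x + y) = cstar x + cstar y"
    and cstar_scaleR: "cstar (r *\<^sub>R x) = r *\<^sub>R cstar x"
    and cstar_mult: "cstar (x * y) = cstar y * cstar x"
    and cstar_cstar: "cstar (cstar x) = x"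
    and iu_sq: "iu * iu = - 1"
    and iu_central: "iu * x = x * iu"
    and cstar_iu: "cstar iu = - iu"
    and cstar_identity: "norm (cstar x * x) = (norm x)\<^sup>2"

definition unital_cstar_subalg :: "'a::cstar_algebra set \<Rightarrow> bool" where
  "unital_cstar_subalg B \<longleftrightarrow>
     1 \<in> B \<and> iu \<in> B \<and> closed B \<and>
     (\<forall>x\<in>B. \<forall>y\<in>B. x + y \<in> B \<and> x * y \<in> B) \<and>
     (\<forall>x\<in>B. \<forall>r. r *\<^sub>R x \<in> B) \<and> (\<forall>x\<in>B. cstar x \<in> B)"

definition madj :: "'a::cstar_algebra mat \<Rightarrow> 'a mat" where
  "madj X = transpose_mat (map_mat cstar X)"

definition mpos :: "nat \<Rightarrow> 'a::cstar_algebra mat \<Rightarrow> bool" where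
  "mpos k X \<longleftrightarrow> X \<in> carrier_mat k k \<and> (\<exists>Z\<in>carrier_mat k k. X = madj Z * Z)"

definition minvertible :: "nat \<Rightarrow> 'a::cstar_algebra mat \<Rightarrow> bool" where
  "minvertible k X \<longleftrightarrow> X \<in> carrier_mat k k \<and>
     (\<exists>Y\<in>carrier_mat k k. X * Y = 1\<^sub>m k \<and> Y * X = 1\<^sub>m k)"

definition minv :: "nat \<Rightarrow> 'a::cstar_algebra mat \<Rightarrow> 'a mat" where
  "minv k X = (THE Y. Y \<in> carrier_mat k k \<and> X * Y = 1\<^sub>m k \<and> Y * X = 1\<^sub>m k)"

text \<open>C*-norm of M_k(A), realized as adjointable operators on the Hilbert module A^k:
  norm X = sup of norm of the inner product of zeta with X xi, over unit vectors.\<close>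

definition mnorm :: "nat \<Rightarrow> 'a::cstar_algebra mat \<Rightarrow> real" where
  "mnorm k X = Sup {norm (\<Sum>i<k. \<Sum>j<k. cstar (z i) * X $$ (i, j) * x j) | z x.
       norm (\<Sum>i<k. cstar (z i) * z i) \<le> 1 \<and> norm (\<Sum>i<k. cstar (x i) * x i) \<le> 1}"

definition mIm :: "'a::cstar_algebra mat \<Rightarrow> 'a mat" where
  "mIm X = map_mat (\<lambda>a. (- 1 / 2) *\<^sub>R (iu * a)) (X - madj X)"

definition upper_half :: "'a::cstar_algebra set \<Rightarrow> nat \<Rightarrow> 'a mat set" where
  "upper_half B k = {X. X \<in> carrier_mat k k \<and>
      (\<forall>i<k. \<forall>j<k. X $$ (i, j) \<in> B) \<and> mpos k (mIm X) \<and> minvertible k (mIm X)}"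

definition cauchy :: "nat \<Rightarrow> ('a::cstar_algebra \<Rightarrow> 'a) \<Rightarrow> 'a \<Rightarrow> 'a mat \<Rightarrow> 'a mat" where
  "cauchy k E X b = map_mat E (minv k (b - X \<cdot>\<^sub>m 1\<^sub>m k))"

definition completely_positive :: "('a::cstar_algebra \<Rightarrow> 'a) \<Rightarrow> bool" where
  "completely_positive E \<longleftrightarrow> (\<forall>k X. mpos k X \<longrightarrow> mpos k (map_mat E X))"

definition cond_exp :: "'a::cstar_algebra set \<Rightarrow> ('a \<Rightarrow> 'a) \<Rightarrow> bool" where
  "cond_exp B E \<longleftrightarrow>
     (\<forall>a. E a \<in> B) \<and> (\<forall>b\<in>B. E b = b) \<and>
     (\<forall>a c. E (a + c) = E a + E c) \<and> (\<forall>r a. E (r *\<^sub>R a) = r *\<^sub>R E a) \<and>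
     (\<forall>b1\<in>B. \<forall>b2\<in>B. \<forall>a. E (b1 * a * b2) = b1 * E a * b2) \<and>
     completely_positive E"

definition opval_cstar_prob_space :: "'a::cstar_algebra set \<Rightarrow> ('a \<Rightarrow> 'a) \<Rightarrow> bool" where
  "opval_cstar_prob_space B E \<longleftrightarrow> unital_cstar_subalg B \<and> cond_exp B E"

fun word :: "'a::cstar_algebra \<Rightarrow> 'a list \<Rightarrow> 'a" where
  "word x [] = 1"
| "word x [b] = b"
| "word x (b # bs) = b * x * word x bs"

inductive_set balg :: "'a::cstar_algebra set \<Rightarrow> 'a \<Rightarrow> 'a set" for B y where
  gen: "y \<in> balg B y"
| lmult: "b \<in> B \<Longrightarrow> a \<in> balg B y \<Longrightarrow> b * a \<in> balg B y"
| rmult: "b \<in> B \<Longrightarrow> a \<in> balg B y \<Longrightarrow> a * b \<in> balg B y"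
| add: "a \<in> balg B y \<Longrightarrow> c \<in> balg B y \<Longrightarrow> a + c \<in> balg B y"
| mult: "a \<in> balg B y \<Longrightarrow> c \<in> balg B y \<Longrightarrow> a * c \<in> balg B y"
| scale: "a \<in> balg B y \<Longrightarrow> r *\<^sub>R a \<in> balg B y"

definition mono_indep :: "'a::cstar_algebra set \<Rightarrow> ('a \<Rightarrow> 'a) \<Rightarrow> nat \<Rightarrow> (nat \<Rightarrow> 'a) \<Rightarrow> bool" where
  "mono_indep B E n y \<longleftrightarrow>
     (\<forall>m (idx :: nat \<Rightarrow> nat) (a :: nat \<Rightarrow> 'a) j.
        (\<forall>l<m. idx l < n \<and> a l \<in> balg B (y (idx l))) \<and> j < m \<and>
        (0 < j \<longrightarrow> idx (j - 1) < idx j) \<and> (j + 1 < m \<longrightarrow> idx (j + 1) < idx j) \<longrightarrow>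
        E (prod_list (map a [0..<m])) = E (prod_list (map (a(j := E (a j))) [0..<m])))"

definition monotone_inf_div :: "'a::cstar_algebra set \<Rightarrow> ('a \<Rightarrow> 'a) \<Rightarrow> 'a \<Rightarrow> bool" where
  "monotone_inf_div B E Y \<longleftrightarrow>
     (\<forall>n\<ge>1. \<exists>y :: nat \<Rightarrow> 'a.
        (\<forall>i<n. cstar (y i) = y i) \<and>
        (\<forall>i<n. \<forall>bs. set bs \<subseteq> B \<longrightarrow> E (word (y i) bs) = E (word (y 0) bs)) \<and>
        Y = (\<Sum>i<n. y i) \<and> mono_indep B E n y)"

text \<open>Non-crossing pair partitions as forests of arcs: Arc F is an outer pair
with the non-crossing pairing F nested inside.\<close>

datatype ncp = Arc "ncp list"

primrec npairs :: "ncp \<Rightarrow> nat" where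
  "npairs (Arc F) = Suc (sum_list (map npairs F))"

definition npairsF :: "ncp list \<Rightarrow> nat" where
  "npairsF F = sum_list (map npairs F)"

text \<open>tau(pi)! = product over blocks V of the number of blocks nested in [min V, max V]
(V included).\<close>

primrec tau :: "ncp \<Rightarrow> nat" where
  "tau (Arc F) = Suc (sum_list (map npairs F)) * prod_list (map tau F)"

definition tauF :: "ncp list \<Rightarrow> nat" where
  "tauF F = prod_list (map tau F)"

definition NC2 :: "nat \<Rightarrow> ncp list set" where
  "NC2 k = {F. 2 * npairsF F = k}"

text \<open>evalW eta F [c0,...,c_{2n}] = c0 * eta_pi(c1,...,c_{2n-1}) * c_{2n}.\<close>

fun evalW :: "('a::cstar_algebra \<Rightarrow> 'a) \<Rightarrow> ncp list \<Rightarrow> 'a list \<Rightarrow> 'a" where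
  "evalW eta [] gs = hd gs"
| "evalW eta (Arc G # F) gs =
     hd gs * eta (evalW eta G (take (2 * npairs (Arc G) - 1) (tl gs)))
       * evalW eta F (drop (2 * npairs (Arc G)) gs)"

definition arcsine :: "'a::cstar_algebra set \<Rightarrow> ('a \<Rightarrow> 'a) \<Rightarrow> ('a \<Rightarrow> 'a) \<Rightarrow> 'a \<Rightarrow> bool" where
  "arcsine B E eta s \<longleftrightarrow> cstar s = s \<and> E s = 0 \<and>
     (\<forall>bs. set bs \<subseteq> B \<longrightarrow> length bs \<ge> 2 \<longrightarrow>
        E (word s bs) =
          (if even (length bs - 1)
           then (\<Sum>F\<in>NC2 (length bs - 1). (1 / real (tauF F)) *\<^sub>R evalW eta F bs)
           else 0))"

definition h4 :: "('a::cstar_algebra \<Rightarrow> 'a) \<Rightarrow> 'a \<Rightarrow> 'a \<Rightarrow> 'a \<Rightarrow> 'a" where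
  "h4 E Y b b' = E (Y * b * Y * Y * b' * Y) - E (Y * b * Y) * E (Y * b' * Y)
                 - (1 / 2) *\<^sub>R E (Y * b * E (Y * Y) * b' * Y)"

end

theory Submission
  imports Defs "HOL-Analysis.Derivative" "HOL-Computational_Algebra.Formal_Power_Series"
begin

text \<open>Write \<open>G\<^sub>x(w) = E[(w - x)\<^sup>-\<^sup>1]\<close> and \<open>F\<^sub>x = G\<^sub>x\<^sup>-\<^sup>1\<close>. If \<open>x\<close>, \<open>y\<close> are monotone independent then
  \<open>G\<^bsub>x+y\<^esub> = G\<^sub>x \<circ> F\<^sub>y\<close>, and \<open>F\<^sub>y\<close> does not decrease imaginary parts. For an arcsine element \<open>A\<close> the
  sum over forests gives \<open>d/dt F = - \<eta>(G)\<close> along \<open>t \<mapsto> sqrt t A\<close>. Decompose \<open>Y = y\<^sub>1 + \<dots> + y\<^sub>n\<close> and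
  exchange, one after the other, each map \<open>F\<^sub>y\<close> for a time step \<open>1/n\<close> of the arcsine flow. Both agree
  with \<open>w \<mapsto> w - \<eta>(w\<^sup>-\<^sup>1)/n\<close> up to \<open>o(1/n)\<close>, except for the third-order term \<open>E[y w\<^sup>-\<^sup>1 y (w - y)\<^sup>-\<^sup>1 y]\<close>,
  which Cauchy--Schwarz bounds by the variance and the fourth moment of \<open>y\<close>. Since \<open>n\<close> times that
  fourth moment tends to the cumulant \<open>h\<^sub>4\<close>, the accumulated error tends to the stated bound.

  Identities between power series at infinity extend to the half plane because a resolvent there is
  a norm limit of polynomials in its inverse, and for the arcsine flow by real-analytic continuation
  in the scalar \<open>r\<close> of \<open>r A\<close>.\<close>

section \<open>Positivity in a C*-algebra\<close>

text \<open>No space carrying \<open>Y\<close> together with independent arcsine increments is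
  built. Monotone independence writes the transform of \<open>Y\<close> as \<open>G\<close> of the
  first summand composed with the maps \<open>F\<close> of the later ones, the last one innermost.
  Each of these maps is compared with a short piece of the flow of \<open>F\<close> at
  \<open>b\<close>, which involves \<open>A\<close> alone. All intermediate points must admit one
  common resolvent bound; hence the fixed half plane given by \<open>Im b\<close>, on which
  \<open>D\<close>, the norm of the inverse of \<open>Im b\<close>, serves throughout. The constant:
  variance and fourth moment of one summand are both of order \<open>1/n\<close>, so the third-order
  term is of order \<open>1/n\<close> as well, and \<open>n\<close> of them add up to a quantity
  that does not vanish. Its two resolvents give \<open>D^2\<close>, the Lipschitz constant of
  \<open>G\<close> gives another \<open>D^2\<close>. The matrix of fourth moments has norm at most
  the sum of its \<open>k\<close> diagonal entries, each a sum of \<open>k\<close> values of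
  \<open>mom4\<close>; the square root turns \<open>k^2\<close> into \<open>k\<close>. The remaining
  errors are of order \<open>n^(-2)\<close> for the summands and \<open>n^(-3/2)\<close> for the
  flow, whose speed is estimated as a Lipschitz function of the square root of time.\<close>

lemma norm_mult3_le: "norm (x * y * z) \<le> norm x * norm y * norm (z :: 'a::real_normed_algebra)"
  by (meson norm_mult_ineq mult_right_mono norm_ge_zero order_trans)

lemma norm_mult3_mono:
  fixes x :: "'a::real_normed_algebra"
  assumes "norm x \<le> a" "norm y \<le> b" "norm z \<le> c" shows "norm (x * y * z) \<le> a * b * c"
proof -
  have "0 \<le> a" "0 \<le> b" using assms norm_ge_zero order_trans by blast+
  then have "norm x * norm y * norm z \<le> a * b * c" using assms by (intro mult_mono) auto
  then show ?thesis using norm_mult3_le order_trans by blast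
qed

lemma cstar_zero [simp]: "cstar (0::'a::cstar_algebra) = 0"
  using cstar_scaleR[of 0 "0::'a"] by simp

lemma cstar_one [simp]: "cstar (1::'a::cstar_algebra) = 1"
  by (metis cstar_cstar cstar_mult mult.left_neutral mult.right_neutral)

lemma cstar_uminus [simp]: "cstar (- x :: 'a::cstar_algebra) = - cstar x"
  using cstar_scaleR[of "-1" x] by simp

lemma cstar_diff: "cstar (x - y :: 'a::cstar_algebra) = cstar x - cstar y"
  using cstar_add[of x "- y"] by simp

lemma cstar_sum: "cstar (sum f A :: 'a::cstar_algebra) = (\<Sum>i\<in>A. cstar (f i))"
  by (induction A rule: infinite_finite_induct) (auto simp: cstar_add)

lemmas cstar_simps = cstar_add cstar_diff cstar_mult cstar_scaleR cstar_sum cstar_cstar cstar_iu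

lemma norm_cstar [simp]: "norm (cstar x :: 'a::cstar_algebra) = norm x"
proof -
  have le: "norm y \<le> norm (cstar y)" for y :: 'a
  proof (cases "y = 0")
    case False
    have "(norm y)\<^sup>2 \<le> norm (cstar y) * norm y"
      using cstar_identity[of y] norm_mult_ineq[of "cstar y" y] by simp
    then show ?thesis using False by (simp add: power2_eq_square)
  qed simp
  show ?thesis using le[of x] le[of "cstar x"] by (simp add: cstar_cstar)
qed

lemma norm_selfadj_sq: "cstar x = x \<Longrightarrow> norm (x * x :: 'a::cstar_algebra) = (norm x)\<^sup>2"
  using cstar_identity[of x] by simp

lemma norm_unitary: "cstar u * u = (1::'a::cstar_algebra) \<Longrightarrow> norm u = 1"
  using cstar_identity[of u] norm_ge_zero[of u] by (simp add: power2_eq_1_iff)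

lemma norm_iu [simp]: "norm (iu :: 'a::cstar_algebra) = 1"
  by (rule norm_unitary) (simp add: cstar_iu iu_sq)

lemma iu_iu_mult: "iu * (iu * x) = - (x::'a::cstar_algebra)"
  by (simp add: iu_sq mult.assoc[symmetric])

text \<open>A fixed point \<open>y\<close> of \<open>y \<mapsto> (e + y\<^sup>2) / 2\<close> satisfies \<open>(1 - y)\<^sup>2 = 1 - e\<close>; the iteration from \<open>0\<close> is
  dominated by the scalar one with \<open>e = 1\<close>, which increases to \<open>1\<close>.\<close>

fun sqit :: "'a::real_normed_algebra_1 \<Rightarrow> nat \<Rightarrow> 'a" where
  "sqit e 0 = 0"
| "sqit e (Suc n) = (1/2) *\<^sub>R (e + sqit e n * sqit e n)"

lemma sqit_commute: "x * e = e * x \<Longrightarrow> x * sqit e n = sqit e n * x"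
proof (induction n)
  case (Suc n)
  have "x * (sqit e n * sqit e n) = sqit e n * sqit e n * x"
    using Suc by (metis mult.assoc)
  then show ?case using Suc.prems by (simp add: algebra_simps)
qed simp

lemma sqit_real: "0 \<le> sqit (1::real) n \<and> sqit (1::real) n \<le> 1 \<and> sqit (1::real) n \<le> sqit 1 (Suc n)"
proof (induction n)
  case (Suc n)
  let ?t = "sqit (1::real) n"
  have 1: "?t * ?t \<le> 1" using Suc mult_mono[of ?t 1 ?t 1] by simp
  have 2: "?t * ?t \<le> sqit 1 (Suc n) * sqit 1 (Suc n)"
    using Suc mult_mono[of ?t "sqit 1 (Suc n)" ?t "sqit 1 (Suc n)"] by simp
  have "0 \<le> ?t * ?t" by simp
  then show ?case using 1 2 by simp
qed simp

lemma norm_sqit_le: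
  assumes "norm (e::'a::real_normed_algebra_1) \<le> 1"
  shows "norm (sqit e n) \<le> sqit 1 n"
proof (induction n)
  case (Suc n)
  have "norm (e + sqit e n * sqit e n) \<le> 1 + sqit 1 n * sqit 1 n"
    using Suc assms norm_triangle_ineq[of e "sqit e n * sqit e n"]
      norm_mult_ineq[of "sqit e n" "sqit e n"]
      mult_mono[OF Suc Suc] sqit_real[of n] by auto
  then show ?case by simp
qed simp

lemma norm_sqit_step:
  assumes "norm (e::'a::real_normed_algebra_1) \<le> 1"
  shows "norm (sqit e (Suc n) - sqit e n) \<le> sqit 1 (Suc n) - sqit 1 n"
proof (induction n)
  case 0
  then show ?case using assms by simp
next
  case (Suc n)
  let ?a = "sqit e (Suc n)" and ?b = "sqit e n"
  have c: "?a * ?b = ?b * ?a" using sqit_commute[of ?a e n] sqit_commute[of e e "Suc n"] by simp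
  have "sqit e (Suc (Suc n)) - ?a = (1/2) *\<^sub>R ((?a - ?b) * (?a + ?b))"
    using c by (simp only: sqit.simps(2)[of e "Suc n"]) (simp add: algebra_simps)
  moreover have "norm ((?a - ?b) * (?a + ?b)) \<le> (sqit 1 (Suc n) - sqit 1 n) * (sqit 1 (Suc n) + sqit 1 n)"
  proof -
    have "norm (?a + ?b) \<le> sqit 1 (Suc n) + sqit 1 n"
      using norm_triangle_ineq[of ?a ?b] norm_sqit_le[OF assms, of n] norm_sqit_le[OF assms, of "Suc n"] by linarith
    then have "norm (?a - ?b) * norm (?a + ?b) \<le> (sqit 1 (Suc n) - sqit 1 n) * (sqit 1 (Suc n) + sqit 1 n)"
      using Suc sqit_real[of n] by (intro mult_mono) auto
    then show ?thesis using norm_mult_ineq[of "?a - ?b" "?a + ?b"] by linarith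
  qed
  moreover have "sqit (1::real) (Suc (Suc n)) - sqit 1 (Suc n) = (1/2) * ((sqit 1 (Suc n) - sqit 1 n) * (sqit 1 (Suc n) + sqit 1 n))"
    by (simp only: sqit.simps(2)[of "1::real"]) (simp add: field_simps)
  ultimately show ?case by simp
qed

text \<open>The iterates are polynomials in \<open>p\<close>, so the root commutes with whatever
  commutes with \<open>p\<close>; this clause stands in for functional calculus. The bound on
  \<open>1 - s\<close> allows a second root to be taken.\<close>

lemma sqrt_exists:
  assumes "norm (1 - p :: 'a::cstar_algebra) \<le> 1"
  obtains s where "s * s = p" "norm (1 - s) \<le> 1" "cstar p = p \<Longrightarrow> cstar s = s"
    "\<And>x. x * p = p * x \<Longrightarrow> x * s = s * x"
proof -
  define e where "e = 1 - p"
  have ne: "norm e \<le> 1" using assms by (simp add: e_def)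
  have sm: "summable (\<lambda>n. sqit (1::real) (Suc n) - sqit 1 n)"
  proof (rule summableI_nonneg_bounded)
    fix n
    show "0 \<le> sqit (1::real) (Suc n) - sqit 1 n" using sqit_real[of n] by simp
    have "(\<Sum>i<n. sqit (1::real) (Suc i) - sqit 1 i) = sqit 1 n - sqit 1 0"
      by (rule sum_lessThan_telescope)
    then show "(\<Sum>i<n. sqit (1::real) (Suc i) - sqit 1 i) \<le> 1" using sqit_real[of n] by simp
  qed
  have "summable (\<lambda>n. sqit e (Suc n) - sqit e n)"
    by (rule summable_comparison_test'[OF sm, of 0]) (use norm_sqit_step[OF ne] in auto)
  then obtain y where "(\<lambda>n. sqit e (Suc n) - sqit e n) sums y" by (auto simp: summable_def)
  then have y: "sqit e \<longlonglongrightarrow> y"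
    unfolding sums_def sum_lessThan_telescope by simp
  have "(\<lambda>n. sqit e (Suc n)) \<longlonglongrightarrow> (1/2) *\<^sub>R (e + y * y)"
    by (simp only: sqit.simps) (intro tendsto_intros y)
  then have yy: "y = (1/2) *\<^sub>R (e + y * y)"
    using LIMSEQ_Suc[OF y] LIMSEQ_unique by blast
  then have y2: "y + y = e + y * y"
  proof -
    have "2 *\<^sub>R y = e + y * y" using yy
      by (metis (no_types, lifting) scaleR_half_double scaleR_2 scaleR_right_distrib)
    then show ?thesis by (simp add: scaleR_2)
  qed
  show ?thesis
  proof (rule that[of "1 - y"])
    show "(1 - y) * (1 - y) = p" using y2 by (simp add: algebra_simps e_def)
    have "norm (sqit e n) \<le> 1" for n using norm_sqit_le[OF ne, of n] sqit_real[of n] by linarith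
    then have "norm y \<le> 1" using Lim_bounded[OF tendsto_norm[OF y], of 0 1] by simp
    then show "norm (1 - (1 - y)) \<le> 1" by simp
    show "cstar (1 - y) = 1 - y" if "cstar p = p"
    proof -
      have ce: "cstar e = e" using that by (simp add: e_def cstar_simps)
      have cn: "cstar (sqit e n) = sqit e n" for n
        by (induction n) (auto simp: cstar_simps ce)
      have bl: "bounded_linear (cstar :: 'a \<Rightarrow> 'a)"
        by (rule bounded_linear_intro[of _ 1]) (auto simp: cstar_simps)
      have "(\<lambda>n. cstar (sqit e n)) \<longlonglongrightarrow> cstar y"
        by (rule bounded_linear.tendsto[OF bl y])
      then have "cstar y = y" using y LIMSEQ_unique cn by simp
      then show ?thesis by (simp add: cstar_simps)
    qed
    show "x * (1 - y) = (1 - y) * x" if "x * p = p * x" for x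
    proof -
      have "x * e = e * x" using that by (simp add: e_def algebra_simps)
      then have "x * sqit e n = sqit e n * x" for n by (rule sqit_commute)
      moreover have "(\<lambda>n. x * sqit e n) \<longlonglongrightarrow> x * y" "(\<lambda>n. sqit e n * x) \<longlonglongrightarrow> y * x"
        by (intro tendsto_intros y)+
      ultimately have "x * y = y * x" using LIMSEQ_unique by simp
      then show ?thesis by (simp add: algebra_simps)
    qed
  qed
qed

text \<open>A notion without spectra. That every \<open>cstar x * x\<close> is positive becomes the
  theorem \<open>pos_cstar_mult\<close>.\<close>

definition pos :: "'a::cstar_algebra \<Rightarrow> bool" where
  "pos p \<longleftrightarrow> (\<exists>s. cstar s = s \<and> s * s = p)"

lemma posI: "cstar s = s \<Longrightarrow> pos (s * s)"
  by (auto simp: pos_def)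

lemma pos_cstar: "pos p \<Longrightarrow> cstar p = p"
  by (auto simp: pos_def cstar_simps)

lemma pos_0 [simp]: "pos 0"
  using posI[of 0] by simp

lemma pos_scale: "pos p \<Longrightarrow> t \<ge> 0 \<Longrightarrow> pos (t *\<^sub>R p)"
proof -
  assume "pos p" "t \<ge> 0"
  then obtain s where s: "cstar s = s" "s * s = p" by (auto simp: pos_def)
  have "(sqrt t *\<^sub>R s) * (sqrt t *\<^sub>R s) = t *\<^sub>R p" using s \<open>t \<ge> 0\<close> by simp
  moreover have "cstar (sqrt t *\<^sub>R s) = sqrt t *\<^sub>R s" using s(1) by (simp add: cstar_simps)
  ultimately show ?thesis using posI by metis
qed

text \<open>With \<open>s\<close> a root of \<open>1 - h * h\<close> that commutes with
  \<open>h\<close>, the element \<open>u = h + iu * s\<close> satisfies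
  \<open>cstar u * u = 1\<close> and so has norm 1. Then \<open>s\<close>, its imaginary part, has
  norm at most 1.\<close>

lemma norm_one_minus_sq_le:
  assumes "cstar h = h" "norm (h::'a::cstar_algebra) \<le> 1"
  shows "norm (1 - h * h) \<le> 1"
proof -
  have "norm (1 - (1 - h * h)) \<le> 1" using assms by (simp add: norm_selfadj_sq power_le_one)
  then obtain s where s: "s * s = 1 - h * h" "cstar (1 - h * h) = 1 - h * h \<Longrightarrow> cstar s = s"
    "\<And>x. x * (1 - h * h) = (1 - h * h) * x \<Longrightarrow> x * s = s * x"
    using sqrt_exists by blast
  have cs: "cstar s = s" using s(2) assms(1) by (simp add: cstar_simps)
  have hs: "h * s = s * h" by (rule s(3)) (simp add: algebra_simps)
  define u where "u = h + iu * s"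
  have u: "cstar u = h - iu * s" unfolding u_def by (simp add: cstar_simps cs assms iu_central[symmetric])
  have "cstar u * u = h * h + s * s"
  proof -
    have "h * (iu * s) = iu * (s * h)" by (metis hs iu_central mult.assoc)
    moreover have "iu * s * (iu * s) = - (s * s)" by (metis iu_central iu_iu_mult mult.assoc)
    ultimately show ?thesis unfolding u by (simp add: u_def algebra_simps)
  qed
  then have nu: "norm u = 1" using s(1) by (intro norm_unitary) simp
  have "iu * (cstar u - u) = 2 *\<^sub>R s" unfolding u unfolding u_def by (simp add: algebra_simps iu_iu_mult scaleR_2)
  then have "2 * norm s = norm (iu * (cstar u - u))" by simp
  also have "\<dots> \<le> norm (cstar u - u)" using norm_mult_ineq[of iu "cstar u - u"] by simp
  also have "\<dots> \<le> 2" using norm_triangle_ineq4[of "cstar u" u] nu by simp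
  finally have "norm s \<le> 1" by simp
  then show ?thesis using s(1) cs by (metis norm_ge_zero norm_selfadj_sq power_le_one)
qed

text \<open>Scaling by \<open>1 / t\<close> reduces this to \<open>sqrt_exists\<close>, and a root
  of the root shows that \<open>s\<close> is itself positive. Together with the converse
  \<open>pos_norm_diff\<close> it turns positivity into a norm condition.\<close>

lemma pos_criterion:
  assumes "cstar p = p" "t > 0" "norm (t *\<^sub>R 1 - p :: 'a::cstar_algebra) \<le> t"
  obtains s where "cstar s = s" "s * s = p" "\<And>x. x * p = p * x \<Longrightarrow> x * s = s * x" "pos s"
proof -
  define q where "q = (1/t) *\<^sub>R p"
  have q: "cstar q = q" by (simp add: q_def cstar_simps assms)
  have "1 - q = (1/t) *\<^sub>R (t *\<^sub>R 1 - p)" using assms(2) by (simp add: q_def algebra_simps)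
  then have nq: "norm (1 - q) \<le> 1" using assms(2,3) by simp
  obtain s where s: "s * s = q" "norm (1 - s) \<le> 1" "cstar q = q \<Longrightarrow> cstar s = s"
    "\<And>x. x * q = q * x \<Longrightarrow> x * s = s * x" using sqrt_exists[OF nq] by blast
  obtain r where r: "r * r = s" "cstar s = s \<Longrightarrow> cstar r = r" using sqrt_exists[OF s(2)] by blast
  show ?thesis
  proof (rule that[of "sqrt t *\<^sub>R s"])
    show "cstar (sqrt t *\<^sub>R s) = sqrt t *\<^sub>R s" using s(3) q by (simp add: cstar_simps)
    show "sqrt t *\<^sub>R s * sqrt t *\<^sub>R s = p" using s(1) assms(2) by (simp add: q_def)
    show "x * sqrt t *\<^sub>R s = sqrt t *\<^sub>R s * x" if "x * p = p * x" for x
      using s(4)[of x] that by (simp add: q_def)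
    show "pos (sqrt t *\<^sub>R s)" by (rule pos_scale) (use r s(3) q assms(2) posI[of r] in auto)
  qed
qed

lemma pos_norm_diff:
  assumes "pos p" "norm p \<le> t"
  shows "norm (t *\<^sub>R 1 - p) \<le> t"
proof (cases "t = 0")
  case True then show ?thesis using assms by simp
next
  case False
  then have t: "t > 0" using assms norm_ge_zero[of p] by linarith
  obtain s where s: "cstar s = s" "s * s = p" using assms by (auto simp: pos_def)
  define h where "h = (1 / sqrt t) *\<^sub>R s"
  have hh: "h * h = (1/t) *\<^sub>R p" using s t by (simp add: h_def)
  have ch: "cstar h = h" by (simp add: h_def s cstar_simps)
  have "(norm h)\<^sup>2 \<le> 1" using norm_selfadj_sq[OF ch] hh assms t by (simp add: field_simps)
  then have "norm h \<le> 1" by (simp add: power_le_one_iff)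
  then have "norm (1 - h * h) \<le> 1" using norm_one_minus_sq_le ch by blast
  moreover have "t *\<^sub>R 1 - p = t *\<^sub>R (1 - h * h)" unfolding hh using t by (simp add: algebra_simps)
  ultimately show ?thesis using t by simp
qed

lemma pos_sqrt:
  assumes "pos p"
  obtains s where "cstar s = s" "s * s = p" "\<And>x. x * p = p * x \<Longrightarrow> x * s = s * x" "pos s"
  using pos_criterion[of p "norm p + 1"] pos_norm_diff[OF assms, of "norm p + 1"] pos_cstar[OF assms]
  by (smt (verit) norm_ge_zero)

text \<open>The norm conditions of both summands add up by the triangle inequality.\<close>

lemma pos_add:
  assumes "pos p" "pos q"
  shows "pos (p + q)"
proof -
  define t where "t = norm p + norm q + 2"
  have "norm ((norm p + 1) *\<^sub>R 1 - p) \<le> norm p + 1" "norm ((norm q + 1) *\<^sub>R 1 - q) \<le> norm q + 1"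
    using assms pos_norm_diff by (metis less_add_one less_imp_le)+
  moreover have "t *\<^sub>R 1 - (p + q) = ((norm p + 1) *\<^sub>R 1 - p) + ((norm q + 1) *\<^sub>R 1 - q)"
  proof -
    have "t = (norm p + 1) + (norm q + 1)" by (simp add: t_def)
    then show ?thesis by (simp only: scaleR_add_left) simp
  qed
  ultimately have "norm (t *\<^sub>R 1 - (p + q)) \<le> t"
    using norm_triangle_ineq[of "(norm p + 1) *\<^sub>R 1 - p" "(norm q + 1) *\<^sub>R 1 - q"]
    unfolding \<open>t *\<^sub>R 1 - (p + q) = _\<close> by (simp add: t_def)
  moreover have "t > 0" by (simp add: t_def add_nonneg_pos)
  moreover have "cstar (p + q) = p + q" 
    using pos_cstar[OF assms(1)] pos_cstar[OF assms(2)] by (simp add: cstar_simps)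
  ultimately show ?thesis using pos_criterion[of "p + q" t] posI by metis
qed

lemma pos_sum: "(\<And>i. i \<in> A \<Longrightarrow> pos (f i)) \<Longrightarrow> pos (sum f A)"
  by (induction A rule: infinite_finite_induct) (auto intro: pos_add)

text \<open>Let \<open>s\<close> and \<open>r\<close> be commuting roots of \<open>p\<close> and
  \<open>t - p\<close>. Then \<open>u = s + iu * r\<close> satisfies \<open>cstar u * u = t\<close>,
  and \<open>s\<close> is the mean of \<open>u\<close> and \<open>cstar u\<close>.\<close>

lemma pos_norm_leI:
  assumes "pos p" "pos (t *\<^sub>R 1 - p)" "t \<ge> 0"
  shows "norm p \<le> t"
proof -
  obtain s where s: "cstar s = s" "s * s = p" using assms by (auto simp: pos_def)
  obtain r where r: "cstar r = r" "r * r = t *\<^sub>R 1 - p" "\<And>x. x * (t *\<^sub>R 1 - p) = (t *\<^sub>R 1 - p) * x \<Longrightarrow> x * r = r * x"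
    using pos_sqrt[OF assms(2)] by metis
  have sr: "s * r = r * s" by (rule r(3)) (simp add: algebra_simps s(2)[symmetric])
  define u where "u = s + iu * r"
  have u: "cstar u = s - iu * r" unfolding u_def by (simp add: cstar_simps s(1) r(1) iu_central[symmetric])
  have "cstar u * u = s * s + r * r"
  proof -
    have "s * (iu * r) = iu * (r * s)" by (metis sr iu_central mult.assoc)
    moreover have "iu * r * (iu * r) = - (r * r)" by (metis iu_central iu_iu_mult mult.assoc)
    ultimately show ?thesis unfolding u by (simp add: u_def algebra_simps)
  qed
  then have "cstar u * u = t *\<^sub>R 1" using s(2) r(2) by simp
  then have "(norm u)\<^sup>2 = t" using assms(3) cstar_identity[of u] by simp
  moreover have "2 *\<^sub>R s = u + cstar u" unfolding u unfolding u_def by (simp add: scaleR_2)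
  then have "norm (2 *\<^sub>R s) \<le> norm u + norm u" using norm_triangle_ineq[of u "cstar u"]
    by (simp only: norm_cstar)
  then have "norm s \<le> norm u" by simp
  ultimately have "(norm s)\<^sup>2 \<le> t" using power_mono[of "norm s" "norm u" 2] by simp
  then show ?thesis using s norm_selfadj_sq by metis
qed

lemma pos_le_norm:
  assumes "pos p" "norm p \<le> t"
  shows "pos (t *\<^sub>R 1 - p)"
proof (cases "t = 0")
  case True then show ?thesis using assms by simp
next
  case False
  then have t: "t > 0" using assms norm_ge_zero[of p] by linarith
  have "cstar (t *\<^sub>R 1 - p) = t *\<^sub>R 1 - p" using pos_cstar[OF assms(1)] by (simp add: cstar_simps)
  moreover have "norm (t *\<^sub>R 1 - (t *\<^sub>R 1 - p)) \<le> t" using assms(2) by simp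
  ultimately show ?thesis using pos_criterion[of "t *\<^sub>R 1 - p" t] t posI by metis
qed

lemma pos_norm_mono:
  assumes "pos p" "pos q"
  shows "norm p \<le> norm (p + q)"
proof (rule pos_norm_leI)
  have "pos (norm (p + q) *\<^sub>R 1 - (p + q) + q)"
    by (intro pos_add pos_le_norm assms) simp
  then show "pos (norm (p + q) *\<^sub>R 1 - p)" by simp
qed (use assms in auto)

text \<open>Let \<open>h = x\<^sup>* x\<close>, \<open>n = |h| - h\<close> and \<open>y = x n\<close>. Then \<open>y\<^sup>* y = - d\<close> with \<open>d \<ge> 0\<close>, hence \<open>b = y y\<^sup>*\<close> is positive.
  With \<open>N = \<parallel>y\<parallel>\<^sup>2\<close> this forces \<open>\<parallel>N d + d\<^sup>2\<parallel> = \<parallel>y\<^sup>* (N - b) y\<parallel> \<le> N\<^sup>2\<close>, whereas \<open>N d + d\<^sup>2 \<ge> 2 d\<^sup>2\<close> has norm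
  at least \<open>2 N\<^sup>2\<close>. So \<open>y = 0\<close>, and \<open>h = |h|\<close>; no spectral theory is involved.\<close>

lemma pos_cstar_mult:
  fixes x :: "'a::cstar_algebra"
  shows "pos (cstar x * x)"
proof -
  define h where "h = cstar x * x"
  have ch: "cstar h = h" by (simp add: h_def cstar_simps)
  obtain a where a: "cstar a = a" "a * a = h * h" "\<And>z. z * (h * h) = (h * h) * z \<Longrightarrow> z * a = a * z" "pos a"
    using pos_sqrt[OF posI[OF ch]] by metis
  obtain r where r: "cstar r = r" "r * r = a" "\<And>z. z * a = a * z \<Longrightarrow> z * r = r * z"
    using pos_sqrt[OF a(4)] by metis
  have ha: "h * a = a * h" by (rule a(3)) (simp add: mult.assoc)
  define n where "n = a - h"
  have cn: "cstar n = n" by (simp add: n_def cstar_simps a ch)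
  have nr: "n * r = r * n" by (rule r(3)) (simp add: n_def algebra_simps ha)
  have n2: "n * n = 2 *\<^sub>R (h * h - a * h)"
    by (simp add: n_def algebra_simps a(2) ha scaleR_2)
  have nh: "2 *\<^sub>R (n * h) = - (n * n)"
    unfolding n2 by (simp add: n_def algebra_simps)
  have an: "2 *\<^sub>R (a * n) = n * n"
    unfolding n2 by (simp add: n_def algebra_simps a(2))
  define c where "c = r * n"
  have cc: "cstar c = c" by (simp add: c_def cstar_simps r cn nr)
  define y where "y = x * n"
  define d where "d = c * c"
  have d': "d = a * (n * n)"
    unfolding d_def c_def by (metis mult.assoc nr r(2))
  have yd: "cstar y * y = - d"
  proof -
    have "cstar y * y = n * h * n" by (simp add: y_def h_def cstar_simps cn mult.assoc)
    moreover have "2 *\<^sub>R (n * h * n) = - (n * n * n)" using nh by (metis mult_minus_left mult_scaleR_left)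
    moreover have "2 *\<^sub>R d = n * n * n" unfolding d' using an by (metis mult.assoc mult_scaleR_left)
    ultimately have "2 *\<^sub>R (cstar y * y) = 2 *\<^sub>R (- d)" by simp
    then show ?thesis by (metis scaleR_cancel_left zero_neq_numeral)
  qed
  define N where "N = (norm y)\<^sup>2"
  have nd: "norm d = N" using cstar_identity[of y] yd by (simp add: N_def)
  have pd: "pos d" unfolding d_def by (rule posI[OF cc])
  define b where "b = y * cstar y"
  define u where "u = (1/2) *\<^sub>R (y + cstar y)"
  define v where "v = (1/2) *\<^sub>R (iu * (cstar y - y))"
  have cu: "cstar u = u" by (simp add: u_def cstar_simps add.commute)
  have cv: "cstar v = v" by (simp add: v_def cstar_simps iu_central[symmetric] algebra_simps)
  have vv: "v * v = - (1/4) *\<^sub>R ((cstar y - y) * (cstar y - y))"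
  proof -
    have "(iu * w) * (iu * w) = - (w * w)" for w :: 'a by (metis iu_central iu_iu_mult mult.assoc)
    then show ?thesis by (simp add: v_def)
  qed
  \<comment> \<open>Here \<open>y = u + iu * v\<close> with self-adjoint \<open>u\<close> and
    \<open>v\<close>, so \<open>y * cstar y + cstar y * y\<close> is twice
    \<open>u * u + v * v\<close>.\<close>
  have "b = d + 2 *\<^sub>R (u * u) + 2 *\<^sub>R (v * v)"
  proof -
    have "2 *\<^sub>R (u * u) + 2 *\<^sub>R (v * v) =
       (1/2) *\<^sub>R ((y + cstar y) * (y + cstar y) - (cstar y - y) * (cstar y - y))"
      unfolding vv u_def by (simp add: scaleR_right_diff_distrib)
    also have "\<dots> = (1/2) *\<^sub>R (2 *\<^sub>R (y * cstar y + cstar y * y))"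
      by (simp add: algebra_simps scaleR_2)
    finally show ?thesis by (simp add: yd b_def algebra_simps)
  qed
  then have pb: "pos b" 
    using pd posI[OF cu] posI[OF cv] by (auto intro!: pos_add pos_scale)
  have nb: "norm b = N" using cstar_identity[of "cstar y"] by (simp add: b_def N_def cstar_simps)
  have "norm (N *\<^sub>R 1 - b) \<le> N" using pos_norm_diff[OF pb] nb by simp
  then have "norm (cstar y * (N *\<^sub>R 1 - b) * y) \<le> norm y * N * norm y"
    by (smt (verit, best) mult_mono norm_cstar norm_ge_zero norm_mult_ineq mult_nonneg_nonneg)
  then have le: "norm (cstar y * (N *\<^sub>R 1 - b) * y) \<le> N * N" by (simp add: N_def power2_eq_square mult_ac)
  have "cstar y * (N *\<^sub>R 1 - b) * y = N *\<^sub>R (cstar y * y) - (cstar y * y) * (cstar y * y)"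
    by (simp add: b_def algebra_simps)
  then have eq: "cstar y * (N *\<^sub>R 1 - b) * y = - (N *\<^sub>R d + d * d)" unfolding yd by simp
  have pNd: "pos (N *\<^sub>R 1 - d)" using pos_le_norm[OF pd] nd by simp
  \<comment> \<open>The root \<open>w\<close> of \<open>N - d\<close> commutes with
    \<open>c\<close>, so \<open>c * w\<close> is self-adjoint with square \<open>N d - d^2\<close>;
    this yields \<open>N d + d^2 >= 2 d^2\<close>.\<close>
  obtain w where w: "cstar w = w" "w * w = N *\<^sub>R 1 - d" "\<And>z. z * (N *\<^sub>R 1 - d) = (N *\<^sub>R 1 - d) * z \<Longrightarrow> z * w = w * z"
    using pos_sqrt[OF pNd] by metis
  have cw: "c * w = w * c" by (rule w(3)) (simp add: d_def algebra_simps)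
  have "(c * w) * (c * w) = (c * c) * (w * w)" using cw by (metis mult.assoc)
  then have sq: "(c * w) * (c * w) = N *\<^sub>R d - d * d" unfolding w(2) by (simp add: d_def algebra_simps)
  have "pos (N *\<^sub>R d - d * d)" unfolding sq[symmetric] by (rule posI) (simp add: cstar_simps cc w(1) cw)
  moreover have "pos (2 *\<^sub>R (d * d))" by (intro pos_scale posI pos_cstar pd) simp
  ultimately have "norm (2 *\<^sub>R (d * d)) \<le> norm (2 *\<^sub>R (d * d) + (N *\<^sub>R d - d * d))"
    using pos_norm_mono by blast
  also have "2 *\<^sub>R (d * d) + (N *\<^sub>R d - d * d) = N *\<^sub>R d + d * d" by (simp add: scaleR_2)
  also have "norm (N *\<^sub>R d + d * d) \<le> N * N" using le unfolding eq norm_minus_cancel .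
  finally have "2 * (N * N) \<le> N * N"
    using norm_selfadj_sq[OF pos_cstar[OF pd]] nd by (simp add: power2_eq_square)
  then have "N * N \<le> 0" by simp
  then have "N = 0" by (metis antisym mult_eq_0_iff zero_le_square)
  then have "y = 0" "d = 0" using nd by (auto simp: N_def)
  then have "n * n * n = 0"
    using d' an by (metis mult.assoc mult_zero_left mult_scaleR_left scaleR_zero_right)
  then have "n * n * (n * n) = 0" by (metis mult.assoc mult_zero_right mult_zero_left)
  moreover have "cstar (n * n) = n * n" by (simp add: cstar_simps cn)
  ultimately have "n = 0" using norm_selfadj_sq[of "n * n"] norm_selfadj_sq[OF cn] by auto
  then have "h = a" by (simp add: n_def)
  then show ?thesis using a(4) h_def by simp
qed

lemma pos_conj: "pos p \<Longrightarrow> pos (cstar x * p * x)"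
proof -
  assume "pos p"
  then obtain s where s: "cstar s = s" "s * s = p" by (auto simp: pos_def)
  have "cstar (s * x) * (s * x) = cstar x * p * x" using s by (simp add: cstar_simps mult.assoc s(2)[symmetric])
  then show ?thesis using pos_cstar_mult[of "s * x"] by simp
qed

section \<open>Finitely supported matrices\<close>

text \<open>The non-unital normed algebra of finitely supported matrices contains all matrix algebras
  at once: the \<open>k \<times> k\<close> matrices are the corner cut out by the idempotent \<open>dg k 1\<close>.\<close>

typedef (overloaded) 'a fmat =
  "{f :: nat \<Rightarrow> nat \<Rightarrow> 'a::cstar_algebra. \<exists>n. \<forall>i j. n \<le> i \<or> n \<le> j \<longrightarrow> f i j = 0}"
  morphisms ent Abs_fmat
  by (rule exI[of _ "\<lambda>i j. 0"]) auto

definition corner :: "nat \<Rightarrow> 'a::cstar_algebra fmat \<Rightarrow> bool" where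
  "corner n X \<longleftrightarrow> (\<forall>i j. n \<le> i \<or> n \<le> j \<longrightarrow> ent X i j = 0)"

definition mk :: "nat \<Rightarrow> (nat \<Rightarrow> nat \<Rightarrow> 'a::cstar_algebra) \<Rightarrow> 'a fmat" where
  "mk k f = Abs_fmat (\<lambda>i j. if i < k \<and> j < k then f i j else 0)"

text \<open>A support size at which every operation below can cut off its result, so that it is
  again finitely supported; the \<open>ent\<close> lemmas remove the cut-off.\<close>

definition fdim :: "'a::cstar_algebra fmat \<Rightarrow> nat" where
  "fdim X = (LEAST n. corner n X)"

lemma ent_mk: "ent (mk k f) i j = (if i < k \<and> j < k then f i j else 0)"
  unfolding mk_def by (subst Abs_fmat_inverse) (auto intro!: exI[of _ k])

lemma fmat_eqI: "(\<And>i j. ent X i j = ent Y i j) \<Longrightarrow> X = Y"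
  by (metis ent_inject ext)

lemma corner_fdim: "corner (fdim X) X"
proof -
  obtain n where "corner n X" using ent[of X] by (auto simp: corner_def)
  then show ?thesis unfolding fdim_def by (rule LeastI)
qed

lemma corner_mono: "corner m X \<Longrightarrow> m \<le> n \<Longrightarrow> corner n X"
  by (auto simp: corner_def)

lemma corner_mk: "corner k (mk k f)"
  by (auto simp: corner_def ent_mk)

lemma corner_ent: "corner k X \<Longrightarrow> k \<le> i \<or> k \<le> j \<Longrightarrow> ent X i j = 0"
  by (auto simp: corner_def)

lemma corner_eqI:
  "corner k X \<Longrightarrow> corner k Y \<Longrightarrow> (\<And>i j. i < k \<Longrightarrow> j < k \<Longrightarrow> ent X i j = ent Y i j) \<Longrightarrow> X = Y"
  by (rule fmat_eqI) (metis corner_ent not_le)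

instantiation fmat :: (cstar_algebra) "{zero, plus, minus, uminus, times, scaleR}"
begin
definition "0 = mk 0 (\<lambda>i j. 0)"
definition "X + Y = mk (max (fdim X) (fdim Y)) (\<lambda>i j. ent X i j + ent Y i j)"
definition "X - Y = mk (max (fdim X) (fdim Y)) (\<lambda>i j. ent X i j - ent Y i j)"
definition "- X = mk (fdim X) (\<lambda>i j. - ent X i j)"
definition "X * Y = mk (max (fdim X) (fdim Y)) (\<lambda>i j. \<Sum>l<max (fdim X) (fdim Y). ent X i l * ent Y l j)"
definition "r *\<^sub>R X = mk (fdim X) (\<lambda>i j. r *\<^sub>R ent X i j)"
instance ..
end

lemma ent_0 [simp]: "ent 0 i j = 0"
  by (simp add: zero_fmat_def ent_mk)

lemma ent_plus [simp]: "ent (X + Y) i j = ent X i j + ent Y i j"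
  using corner_fdim[of X] corner_fdim[of Y] by (auto simp: plus_fmat_def ent_mk corner_def)

lemma ent_minus [simp]: "ent (X - Y) i j = ent X i j - ent Y i j"
  using corner_fdim[of X] corner_fdim[of Y] by (auto simp: minus_fmat_def ent_mk corner_def)

lemma ent_uminus [simp]: "ent (- X) i j = - ent X i j"
  using corner_fdim[of X] by (auto simp: uminus_fmat_def ent_mk corner_def)

lemma ent_scaleR [simp]: "ent (r *\<^sub>R X) i j = r *\<^sub>R ent X i j"
  using corner_fdim[of X] by (auto simp: scaleR_fmat_def ent_mk corner_def)

lemma ent_times_max: "ent (X * Y) i j = (\<Sum>l<max (fdim X) (fdim Y). ent X i l * ent Y l j)"
proof -
  have "(\<Sum>l<max (fdim X) (fdim Y). ent X i l * ent Y l j) = 0"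
    if "max (fdim X) (fdim Y) \<le> i \<or> max (fdim X) (fdim Y) \<le> j"
    using that corner_fdim[of X] corner_fdim[of Y] by (intro sum.neutral) (auto simp: corner_def)
  then show ?thesis by (auto simp: times_fmat_def ent_mk not_less)
qed

lemma ent_times_any:
  assumes "corner n X \<or> corner n Y"
  shows "ent (X * Y) i j = (\<Sum>l<n. ent X i l * ent Y l j)"
proof -
  let ?m = "max (fdim X) (fdim Y)"
  have z: "ent X i l * ent Y l j = 0" if "n \<le> l \<or> ?m \<le> l" for l
    using that assms corner_fdim[of X] corner_fdim[of Y] by (auto simp: corner_def)
  have "(\<Sum>l<?m. ent X i l * ent Y l j) = (\<Sum>l<max ?m n. ent X i l * ent Y l j)"
    by (rule sum.mono_neutral_left) (auto simp: z)
  also have "\<dots> = (\<Sum>l<n. ent X i l * ent Y l j)"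
    by (rule sum.mono_neutral_right) (auto simp: z)
  finally show ?thesis by (simp add: ent_times_max)
qed

lemma ent_times: "corner n X \<Longrightarrow> ent (X * Y) i j = (\<Sum>l<n. ent X i l * ent Y l j)"
  by (rule ent_times_any) simp

lemma ent_times': "corner n Y \<Longrightarrow> ent (X * Y) i j = (\<Sum>l<n. ent X i l * ent Y l j)"
  by (rule ent_times_any) simp

lemma corner_0 [simp]: "corner k 0" by (simp add: corner_def)
lemma corner_plus: "corner k X \<Longrightarrow> corner k Y \<Longrightarrow> corner k (X + Y)" by (simp add: corner_def)
lemma corner_minus: "corner k X \<Longrightarrow> corner k Y \<Longrightarrow> corner k (X - Y)" by (simp add: corner_def)
lemma corner_uminus: "corner k X \<Longrightarrow> corner k (- X)" by (simp add: corner_def)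
lemma corner_scaleR: "corner k X \<Longrightarrow> corner k (r *\<^sub>R X)" by (simp add: corner_def)
lemma corner_times: "corner k X \<Longrightarrow> corner k Y \<Longrightarrow> corner k (X * Y)"
  unfolding corner_def[of k "X * Y"] by (auto simp: ent_times corner_ent intro!: sum.neutral)

instance fmat :: (cstar_algebra) "{real_vector, ring}"
proof
  fix X Y Z :: "'a fmat" and a b :: real
  show "X * Y * Z = X * (Y * Z)"
  proof (rule fmat_eqI)
    fix i j
    define n where "n = max (fdim X) (max (fdim Y) (fdim Z))"
    have c': "corner n X" "corner n Y" "corner n Z"
      unfolding n_def by (meson max.cobounded1 max.cobounded2 le_trans corner_mono corner_fdim)+
    note c = c' corner_times[OF c'(1,2)] corner_times[OF c'(2,3)]
    have "ent (X * Y * Z) i j = (\<Sum>l<n. \<Sum>m<n. ent X i m * ent Y m l * ent Z l j)"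
      by (simp add: ent_times[OF c(4)] ent_times[OF c(1)] sum_distrib_right)
    also have "\<dots> = (\<Sum>m<n. \<Sum>l<n. ent X i m * ent Y m l * ent Z l j)" by (rule sum.swap)
    also have "\<dots> = ent (X * (Y * Z)) i j"
      by (simp add: ent_times[OF c(1)] ent_times[OF c(2)] sum_distrib_left mult.assoc)
    finally show "ent (X * Y * Z) i j = ent (X * (Y * Z)) i j" .
  qed
  define n where "n = max (fdim X) (max (fdim Y) (fdim Z))"
  have c: "corner n X" "corner n Y" "corner n Z"
    unfolding n_def by (meson max.cobounded1 max.cobounded2 le_trans corner_mono corner_fdim)+
  show "(X + Y) * Z = X * Z + Y * Z" "X * (Y + Z) = X * Y + X * Z"
    by (rule fmat_eqI, simp add: ent_times[OF corner_plus[OF c(1) c(2)]] ent_times[OF c(1)] ent_times[OF c(2)]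
        algebra_simps sum.distrib)+
qed (auto intro!: fmat_eqI simp: algebra_simps)

lemma ent_sum: "ent (sum f A) i j = (\<Sum>x\<in>A. ent (f x) i j)"
  by (induction A rule: infinite_finite_induct) auto

lemma corner_sum: "(\<And>x. x \<in> A \<Longrightarrow> corner k (f x)) \<Longrightarrow> corner k (sum f A)"
  by (induction A rule: infinite_finite_induct) (auto intro: corner_plus)

section \<open>Sesquilinear forms over the Hilbert module and the operator norm\<close>

definition form :: "nat \<Rightarrow> (nat \<Rightarrow> 'a::cstar_algebra) \<Rightarrow> 'a fmat \<Rightarrow> (nat \<Rightarrow> 'a) \<Rightarrow> 'a" where
  "form n z X x = (\<Sum>i<n. \<Sum>j<n. cstar (z i) * ent X i j * x j)"

definition vip :: "nat \<Rightarrow> (nat \<Rightarrow> 'a::cstar_algebra) \<Rightarrow> (nat \<Rightarrow> 'a) \<Rightarrow> 'a" where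
  "vip n z x = (\<Sum>i<n. cstar (z i) * x i)"

definition vn :: "nat \<Rightarrow> (nat \<Rightarrow> 'a::cstar_algebra) \<Rightarrow> real" where
  "vn n x = sqrt (norm (vip n x x))"

definition mv :: "nat \<Rightarrow> 'a::cstar_algebra fmat \<Rightarrow> (nat \<Rightarrow> 'a) \<Rightarrow> nat \<Rightarrow> 'a" where
  "mv n X x i = (\<Sum>j<n. ent X i j * x j)"

lemma form_mv: "form n z X x = vip n z (mv n X x)"
  by (simp add: form_def vip_def mv_def sum_distrib_left mult.assoc)

lemma vn_ge_0 [simp]: "0 \<le> vn n x" by (simp add: vn_def)

lemma vn_sq: "(vn n x)\<^sup>2 = norm (vip n x x)" by (simp add: vn_def)

lemma vn_le_1: "vn n x \<le> 1 \<longleftrightarrow> norm (vip n x x) \<le> 1" by (simp add: vn_def)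

lemma pos_vip: "pos (vip n x x)"
  unfolding vip_def by (intro pos_sum pos_cstar_mult)

lemma vip_cstar: "cstar (vip n x y) = vip n y x"
  by (simp add: vip_def cstar_simps)

lemma norm_le_vn:
  assumes "i < n" shows "norm (x i) \<le> vn n x"
proof -
  have "vip n x x = cstar (x i) * x i + (\<Sum>j\<in>{..<n} - {i}. cstar (x j) * x j)"
    unfolding vip_def using assms by (intro sum.remove) auto
  moreover have "pos (\<Sum>j\<in>{..<n} - {i}. cstar (x j) * x j)" by (intro pos_sum pos_cstar_mult)
  ultimately have "norm (cstar (x i) * x i) \<le> norm (vip n x x)"
    using pos_norm_mono[OF pos_cstar_mult] by metis
  then have "(norm (x i))\<^sup>2 \<le> (vn n x)\<^sup>2" by (simp add: cstar_identity vn_sq)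
  then show ?thesis by (rule power2_le_imp_le) simp
qed

lemma vn_eq_0: "vn n x = 0 \<Longrightarrow> i < n \<Longrightarrow> x i = 0"
  using norm_le_vn[of i n x] by simp

text \<open>Cauchy--Schwarz in the Hilbert module, from positivity of the square of \<open>z a - x\<close>
  with \<open>a = \<langle>z, x\<rangle>\<close> and \<open>z\<close> in the unit ball.\<close>

lemma vip_CS_unit:
  assumes "vn n z \<le> 1" shows "norm (vip n z x) \<le> vn n x"
proof -
  define a where "a = vip n z x"
  define w where "w i = z i * a - x i" for i
  have "vip n w w = cstar a * vip n z z * a - cstar a * vip n z x - vip n x z * a + vip n x x"
    by (simp add: vip_def w_def cstar_simps algebra_simps sum.distrib sum_distrib_left sum_distrib_right sum_subtractf)
  also have "\<dots> = cstar a * vip n z z * a - cstar a * a - cstar a * a + vip n x x"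
    by (simp add: a_def vip_cstar)
  finally have eq: "vip n w w + (cstar a * (1 *\<^sub>R 1 - vip n z z) * a) = vip n x x - cstar a * a"
    by (simp add: algebra_simps)
  have "pos (1 *\<^sub>R 1 - vip n z z)" using assms by (intro pos_le_norm pos_vip) (simp add: vn_le_1)
  then have "pos (vip n x x - cstar a * a)"
    unfolding eq[symmetric] by (intro pos_add pos_vip pos_conj)
  then have "norm (cstar a * a) \<le> norm (cstar a * a + (vip n x x - cstar a * a))"
    by (intro pos_norm_mono pos_cstar_mult)
  then have "(norm a)\<^sup>2 \<le> (vn n x)\<^sup>2" by (simp add: cstar_identity vn_sq)
  then show ?thesis unfolding a_def by (rule power2_le_imp_le) simp
qed

lemma vn_scaleR: "vn n (\<lambda>i. r *\<^sub>R x i) = \<bar>r\<bar> * vn n x"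
proof -
  have "vip n (\<lambda>i. r *\<^sub>R x i) (\<lambda>i. r *\<^sub>R x i) = (r * r) *\<^sub>R vip n x x"
    by (simp add: vip_def cstar_simps scaleR_sum_right)
  then show ?thesis by (simp add: vn_def real_sqrt_mult)
qed

lemma vip_CS: "norm (vip n z x) \<le> vn n z * vn n x"
proof (cases "vn n z = 0")
  case True
  then have "vip n z x = 0" unfolding vip_def by (intro sum.neutral) (auto dest: vn_eq_0)
  then show ?thesis by simp
next
  case False
  then have p: "vn n z > 0" using vn_ge_0[of n z] by linarith
  have "vip n (\<lambda>i. (1 / vn n z) *\<^sub>R z i) x = (1 / vn n z) *\<^sub>R vip n z x"
    by (simp add: vip_def cstar_simps scaleR_sum_right)
  moreover have "norm (vip n (\<lambda>i. (1 / vn n z) *\<^sub>R z i) x) \<le> vn n x"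
    by (rule vip_CS_unit) (use p in \<open>simp add: vn_scaleR\<close>)
  ultimately show ?thesis using p by (simp add: field_simps)
qed

definition cut :: "nat \<Rightarrow> (nat \<Rightarrow> 'a) \<Rightarrow> nat \<Rightarrow> 'a::zero" where
  "cut n z i = (if i < n then z i else 0)"

text \<open>Entries outside the corner vanish, so truncating the test vectors changes nothing. With
  \<open>vn_cut\<close> this lets a norm that is defined by vectors of every length be tested inside
  one corner.\<close>

lemma form_cut:
  assumes "corner k X" shows "form k (cut n z) X (cut n x) = form n z X x"
proof -
  let ?f = "\<lambda>i j. cstar (cut n z i) * ent X i j * cut n x j"
  have z: "?f i j = 0" if "i \<ge> k \<or> j \<ge> k \<or> i \<ge> n \<or> j \<ge> n" for i j
    using that assms by (auto simp: corner_ent cut_def)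
  then have z': "i < k \<and> j < k \<and> i < n \<and> j < n" if "?f i j \<noteq> 0" for i j
    using that by (meson not_le)
  have sw: "(\<Sum>i<m. \<Sum>j<m. ?f i j) = (\<Sum>(i,j)\<in>{..<m}\<times>{..<m}. ?f i j)" for m
    by (simp add: sum.cartesian_product)
  have "form k (cut n z) X (cut n x) = (\<Sum>(i,j)\<in>{..<max k n}\<times>{..<max k n}. ?f i j)"
    unfolding form_def sw by (rule sum.mono_neutral_left) (auto dest!: z')
  also have "\<dots> = (\<Sum>(i,j)\<in>{..<n}\<times>{..<n}. ?f i j)"
    by (rule sum.mono_neutral_right) (auto dest!: z')
  also have "\<dots> = form n z X x" unfolding sw[symmetric] form_def by (simp add: cut_def)
  finally show ?thesis .
qed

lemma vn_cut: "vn k (cut n z) \<le> vn n z"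
proof -
  let ?f = "\<lambda>i. cstar (cut n z i) * cut n z i"
  have *: "vip n z z = vip (max k n) (cut n z) (cut n z)" unfolding vip_def
    by (rule sum.mono_neutral_cong_left) (auto simp: cut_def)
  have "vip (max k n) (cut n z) (cut n z) = vip k (cut n z) (cut n z) + (\<Sum>i\<in>{..<max k n} - {..<k}. ?f i)"
    unfolding vip_def by (subst sum.subset_diff[of "{..<k}"]) (auto simp: add.commute)
  moreover have "pos (\<Sum>i\<in>{..<max k n} - {..<k}. ?f i)" by (intro pos_sum pos_cstar_mult)
  ultimately have "norm (vip k (cut n z) (cut n z)) \<le> norm (vip n z z)"
    using pos_norm_mono[OF pos_vip] * by metis
  then show ?thesis by (simp add: vn_def)
qed

lemma norm_form_le_sum:
  assumes "vn n z \<le> 1" "vn n x \<le> 1"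
  shows "norm (form n z X x) \<le> (\<Sum>i<n. \<Sum>j<n. norm (ent X i j))"
  unfolding form_def
proof (intro sum_norm_le)
  fix i j assume "i \<in> {..<n}" "j \<in> {..<n}"
  then have "norm (z i) \<le> 1" "norm (x j) \<le> 1"
    using norm_le_vn[of i n z] norm_le_vn[of j n x] assms by auto
  then have "norm (cstar (z i) * ent X i j) \<le> norm (ent X i j)"
    using norm_mult_ineq[of "cstar (z i)" "ent X i j"] mult_right_mono[of "norm (z i)" 1 "norm (ent X i j)"]
    by simp
  then show "norm (cstar (z i) * ent X i j * x j) \<le> norm (ent X i j)"
    using norm_mult_ineq[of "cstar (z i) * ent X i j" "x j"] \<open>norm (x j) \<le> 1\<close>
    by (smt (verit, best) mult_left_le norm_ge_zero)
qed

instantiation fmat :: (cstar_algebra) real_normed_vector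
begin
definition norm_fmat where
  "norm X = Sup {norm (form n z X x) | n z x. vn n z \<le> 1 \<and> vn n x \<le> 1}"
definition dist_fmat :: "'a fmat \<Rightarrow> 'a fmat \<Rightarrow> real" where "dist_fmat X Y = norm (X - Y)"
definition sgn_fmat :: "'a fmat \<Rightarrow> 'a fmat" where "sgn_fmat X = X /\<^sub>R norm X"
definition uniformity_fmat :: "('a fmat \<times> 'a fmat) filter" where
  "uniformity_fmat = (INF e\<in>{0<..}. principal {(X, Y). dist X Y < e})"
definition open_fmat :: "'a fmat set \<Rightarrow> bool" where
  "open_fmat U \<longleftrightarrow> (\<forall>X\<in>U. eventually (\<lambda>(X', Y). X' = X \<longrightarrow> Y \<in> U) uniformity)"

lemma norm_fmat_bdd: "bdd_above {norm (form n z (X :: 'a fmat) x) | n z x. vn n z \<le> 1 \<and> vn n x \<le> 1}"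
proof (rule bdd_aboveI, safe)
  fix n :: nat and z x :: "nat \<Rightarrow> 'a" assume "vn n z \<le> 1" "vn n x \<le> 1"
  then show "norm (form n z X x) \<le> (\<Sum>i<fdim X. \<Sum>j<fdim X. norm (ent X i j))"
    unfolding form_cut[OF corner_fdim, of X n z x, symmetric]
    by (intro norm_form_le_sum) (meson vn_cut order_trans)+
qed

lemma norm_form_le_unit: "vn n z \<le> 1 \<Longrightarrow> vn n x \<le> 1 \<Longrightarrow> norm (form n z (X :: 'a fmat) x) \<le> norm X"
  unfolding norm_fmat_def by (rule cSup_upper) (auto intro: norm_fmat_bdd)

lemma norm_fmat_leI:
  fixes X :: "'a fmat"
  assumes "corner k X" "\<And>z x. vn k z \<le> 1 \<Longrightarrow> vn k x \<le> 1 \<Longrightarrow> norm (form k z X x) \<le> c"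
  shows "norm X \<le> c"
  unfolding norm_fmat_def
proof (rule cSup_least)
  have "vn 0 (\<lambda>_. 0::'a) \<le> 1" by (simp add: vn_def vip_def)
  then show "{norm (form n z X x) | n z x. vn n z \<le> 1 \<and> vn n x \<le> 1} \<noteq> {}" by blast
  fix r assume "r \<in> {norm (form n z X x) | n z x. vn n z \<le> 1 \<and> vn n x \<le> 1}"
  then obtain n z x where r: "r = norm (form n z X x)" "vn n z \<le> 1" "vn n x \<le> 1" by auto
  have "norm (form k (cut n z) X (cut n x)) \<le> c"
    using vn_cut[of k n z] vn_cut[of k n x] r by (intro assms) auto
  then show "r \<le> c" using form_cut[OF assms(1)] r by simp
qed

lemma form_scaleR: "form n (\<lambda>i. r *\<^sub>R z i) X (\<lambda>i. s *\<^sub>R x i) = (r * s) *\<^sub>R form n z X x"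
  by (simp add: form_def cstar_simps scaleR_sum_right mult.commute)

lemma norm_form_le: "norm (form n z (X :: 'a fmat) x) \<le> norm X * vn n z * vn n x"
proof (cases "vn n z = 0 \<or> vn n x = 0")
  case True
  then have "form n z X x = 0" unfolding form_def by (intro sum.neutral ballI) (auto dest: vn_eq_0)
  then show ?thesis using True by auto
next
  case False
  then have p: "vn n z > 0" "vn n x > 0" using vn_ge_0[of n z] vn_ge_0[of n x] by linarith+
  have "norm (form n (\<lambda>i. (1 / vn n z) *\<^sub>R z i) X (\<lambda>i. (1 / vn n x) *\<^sub>R x i)) \<le> norm X"
    by (rule norm_form_le_unit) (use p in \<open>auto simp: vn_scaleR\<close>)
  then show ?thesis unfolding form_scaleR using p by (simp add: field_simps)
qed

lemma norm_ent_le: "norm (ent (X :: 'a fmat) i j) \<le> norm X"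
proof -
  define n where "n = Suc (max i j)"
  define u where "u l = (\<lambda>m. if m = l then 1 else 0 :: 'a)" for l :: nat
  have v: "vn n (u l) = 1" if "l < n" for l
  proof -
    have "vip n (u l) (u l) = (\<Sum>m<n. if m = l then 1 else 0)"
      unfolding vip_def by (rule sum.cong) (auto simp: u_def)
    then show ?thesis using that by (simp add: vn_def)
  qed
  have "form n (u i) X (u j) = (\<Sum>a<n. \<Sum>b<n. if b = j then (if a = i then ent X i j else 0) else 0)"
    unfolding form_def by (intro sum.cong) (auto simp: u_def)
  also have "\<dots> = ent X i j" by (simp add: n_def)
  finally show ?thesis using norm_form_le_unit[of n "u i" "u j" X] v[of i] v[of j] by (simp add: n_def)
qed

instance
proof
  fix X Y :: "'a fmat" and a :: real
  show "norm X = 0 \<longleftrightarrow> X = 0"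
  proof
    assume "norm X = 0" then show "X = 0" using norm_ent_le[of X] by (intro fmat_eqI) simp
  next
    assume "X = 0"
    moreover have "norm (0::'a fmat) \<le> 0" by (rule norm_fmat_leI[of 0]) (auto simp: form_def)
    moreover have "norm (0::'a fmat) \<ge> 0" using norm_ent_le[of 0 0 0] norm_ge_zero by (metis order_trans)
    ultimately show "norm X = 0" by simp
  qed
  have fp: "form n z (X + Y) x = form n z X x + form n z Y x" for n z x
    by (simp add: form_def algebra_simps sum.distrib)
  have c: "corner (max (fdim X) (fdim Y)) (X + Y)"
    by (intro corner_plus) (meson corner_fdim corner_mono max.cobounded1 max.cobounded2)+
  show "norm (X + Y) \<le> norm X + norm Y"
    by (rule norm_fmat_leI[OF c]) (metis fp norm_form_le_unit norm_triangle_mono)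
  have fs: "norm (form n z (r *\<^sub>R Z) x) = \<bar>r\<bar> * norm (form n z Z x)" for n z x r and Z :: "'a fmat"
  proof -
    have "form n z (r *\<^sub>R Z) x = r *\<^sub>R form n z Z x" by (simp add: form_def scaleR_sum_right)
    then show ?thesis by simp
  qed
  have le: "norm (r *\<^sub>R Z) \<le> \<bar>r\<bar> * norm Z" for r and Z :: "'a fmat"
    by (rule norm_fmat_leI[OF corner_scaleR[OF corner_fdim]])
      (auto simp: fs intro!: mult_left_mono norm_form_le_unit)
  show "norm (a *\<^sub>R X) = \<bar>a\<bar> * norm X"
  proof (cases "a = 0")
    case True
    have "norm (0 *\<^sub>R X) = 0"
      using le[of 0 X] norm_ent_le[of "0 *\<^sub>R X" 0 0] norm_ge_zero[of "ent (0 *\<^sub>R X) 0 0"] by linarith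
    then show ?thesis using True by (simp only: abs_zero mult_zero_left)
  next
    case False
    have "norm X = norm ((1/a) *\<^sub>R (a *\<^sub>R X))" using False by simp
    also have "\<dots> \<le> \<bar>1/a\<bar> * norm (a *\<^sub>R X)" by (rule le)
    finally have "\<bar>a\<bar> * norm X \<le> norm (a *\<^sub>R X)" using False by (simp add: field_simps)
    then show ?thesis using le[of a X] by simp
  qed
qed (auto simp: dist_fmat_def sgn_fmat_def uniformity_fmat_def open_fmat_def)

end

text \<open>Testing the form against the vector \<open>mv n X x\<close> bounds the square of its
  length, and one factor cancels.\<close>

lemma norm_mv_le:
  assumes "vn n x \<le> c" shows "vn n (mv n X x) \<le> norm X * c"
proof -
  have "(vn n (mv n X x))\<^sup>2 \<le> norm X * vn n (mv n X x) * vn n x"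
    using norm_form_le[of n "mv n X x" X x] by (simp add: form_mv vn_sq)
  then have *: "vn n (mv n X x) * vn n (mv n X x) \<le> (norm X * vn n x) * vn n (mv n X x)"
    by (simp add: power2_eq_square mult_ac)
  have "vn n (mv n X x) \<le> norm X * vn n x"
  proof (cases "vn n (mv n X x) = 0")
    case False
    then show ?thesis using mult_right_le_imp_le[OF *] vn_ge_0[of n "mv n X x"] by linarith
  qed (simp add: mult_nonneg_nonneg)
  also have "\<dots> \<le> norm X * c" using assms by (intro mult_left_mono) auto
  finally show ?thesis .
qed

lemma mv_times:
  assumes "corner n X \<or> corner n Y"
  shows "mv n (X * Y) x i = mv n X (mv n Y x) i"
proof -
  have "mv n (X * Y) x i = (\<Sum>j<n. \<Sum>l<n. ent X i l * ent Y l j * x j)"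
    by (simp add: mv_def ent_times_any[OF assms] sum_distrib_right)
  also have "\<dots> = (\<Sum>l<n. \<Sum>j<n. ent X i l * ent Y l j * x j)" by (rule sum.swap)
  finally show ?thesis by (simp add: mv_def sum_distrib_left mult.assoc)
qed

lemma form_times: "corner n X \<or> corner n Y \<Longrightarrow> form n z (X * Y) x = form n z X (mv n Y x)"
  by (simp add: form_mv vip_def mv_times)

instance fmat :: (cstar_algebra) real_normed_algebra
proof
  fix X Y :: "'a fmat" and a :: real
  show "norm (X * Y) \<le> norm X * norm Y"
  proof -
    define n where "n = max (fdim X) (fdim Y)"
    have c: "corner n X" "corner n Y" unfolding n_def by (meson corner_fdim corner_mono max.cobounded1 max.cobounded2)+
    show ?thesis
    proof (rule norm_fmat_leI[OF corner_times[OF c]])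
      fix z x :: "nat \<Rightarrow> 'a" assume v: "vn n z \<le> 1" "vn n x \<le> 1"
      have "norm (form n z (X * Y) x) \<le> norm X * vn n z * vn n (mv n Y x)"
        using c by (simp add: form_times norm_form_le)
      also have "\<dots> \<le> norm X * 1 * (norm Y * 1)"
        by (intro mult_mono norm_mv_le v) (auto intro: mult_nonneg_nonneg)
      finally show "norm (form n z (X * Y) x) \<le> norm X * norm Y" by simp
    qed
  qed
  define n where "n = max (fdim X) (fdim Y)"
  have c: "corner n X" "corner n Y" unfolding n_def by (meson corner_fdim corner_mono max.cobounded1 max.cobounded2)+
  show "a *\<^sub>R X * Y = a *\<^sub>R (X * Y)" "X * a *\<^sub>R Y = a *\<^sub>R (X * Y)"
    using c by (auto intro!: fmat_eqI simp: ent_times[of n] corner_scaleR scaleR_sum_right)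
qed

section \<open>The adjoint and the C*-identity\<close>

definition adj :: "'a::cstar_algebra fmat \<Rightarrow> 'a fmat" where
  "adj X = mk (fdim X) (\<lambda>i j. cstar (ent X j i))"

lemma ent_adj [simp]: "ent (adj X) i j = cstar (ent X j i)"
  using corner_fdim[of X] by (auto simp: adj_def ent_mk corner_def)

lemma corner_adj: "corner k X \<Longrightarrow> corner k (adj X)"
  by (auto simp: corner_def)

lemma adj_adj [simp]: "adj (adj X) = X" by (rule fmat_eqI) (simp add: cstar_simps)
lemma adj_0 [simp]: "adj 0 = 0" by (rule fmat_eqI) simp
lemma adj_plus: "adj (X + Y) = adj X + adj Y" by (rule fmat_eqI) (simp add: cstar_simps)
lemma adj_minus: "adj (X - Y) = adj X - adj Y" by (rule fmat_eqI) (simp add: cstar_simps)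
lemma adj_uminus: "adj (- X) = - adj X" by (rule fmat_eqI) (simp add: cstar_simps)
lemma adj_scaleR: "adj (r *\<^sub>R X) = r *\<^sub>R adj X" by (rule fmat_eqI) (simp add: cstar_simps)
lemma adj_times: "adj (X * Y) = adj Y * adj X"
  by (rule fmat_eqI) (simp add: ent_times[OF corner_fdim[of X]] ent_times'[OF corner_adj[OF corner_fdim[of X]]] cstar_simps)

lemmas adj_simps = adj_plus adj_minus adj_uminus adj_scaleR adj_times

lemma form_adj: "form n z (adj X) x = cstar (form n x X z)"
proof -
  have "form n z (adj X) x = (\<Sum>j<n. \<Sum>i<n. cstar (z i) * cstar (ent X j i) * x j)"
    unfolding form_def ent_adj by (rule sum.swap)
  then show ?thesis by (simp add: form_def cstar_simps mult.assoc)
qed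

lemma norm_adj [simp]: "norm (adj X) = norm X"
proof -
  have le: "norm (adj Z) \<le> norm Z" for Z :: "'a fmat"
    by (rule norm_fmat_leI[OF corner_adj[OF corner_fdim]]) (simp add: form_adj norm_form_le_unit)
  show ?thesis using le[of X] le[of "adj X"] by simp
qed

lemma form_adj_times:
  assumes "corner n X" shows "form n x (adj X * X) x = vip n (mv n X x) (mv n X x)"
proof -
  have "form n x (adj X * X) x = cstar (form n (mv n X x) X x)"
    using assms by (simp add: form_times form_adj)
  then show ?thesis by (simp add: form_mv vip_cstar)
qed

text \<open>Evaluated at a vector, both summands become positive elements of the algebra, where
  \<open>pos_norm_mono\<close> applies. The case \<open>Y = 0\<close> is the essential half of the
  C*-identity; the general case replaces order comparisons between matrices.\<close>

lemma norm_adj_times_mono: "(norm X)\<^sup>2 \<le> norm (adj X * X + adj Y * Y)"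
proof -
  define n where "n = max (fdim X) (fdim Y)"
  have c: "corner n X" "corner n Y" unfolding n_def by (meson corner_fdim corner_mono max.cobounded1 max.cobounded2)+
  let ?N = "norm (adj X * X + adj Y * Y)"
  have "norm X \<le> sqrt ?N"
  proof (rule norm_fmat_leI[OF c(1)])
    fix z x :: "nat \<Rightarrow> 'a" assume v: "vn n z \<le> 1" "vn n x \<le> 1"
    have "norm (form n z X x) \<le> vn n z * vn n (mv n X x)" unfolding form_mv by (rule vip_CS)
    also have "\<dots> \<le> 1 * vn n (mv n X x)" using v by (intro mult_right_mono) auto
    finally have 1: "norm (form n z X x) \<le> vn n (mv n X x)" by simp
    have "form n x (adj X * X + adj Y * Y) x = form n x (adj X * X) x + form n x (adj Y * Y) x"
      by (simp add: form_def algebra_simps sum.distrib)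
    also have "\<dots> = vip n (mv n X x) (mv n X x) + vip n (mv n Y x) (mv n Y x)"
      using c by (simp add: form_adj_times)
    finally have "norm (vip n (mv n X x) (mv n X x)) \<le> norm (form n x (adj X * X + adj Y * Y) x)"
      using pos_norm_mono pos_vip by metis
    also have "\<dots> \<le> ?N" by (rule norm_form_le_unit[OF v(2) v(2)])
    finally have "vn n (mv n X x) \<le> sqrt ?N" by (simp add: vn_def)
    then show "norm (form n z X x) \<le> sqrt ?N" using 1 by linarith
  qed
  then have "(norm X)\<^sup>2 \<le> (sqrt ?N)\<^sup>2" by (rule power_mono) simp
  then show ?thesis by simp
qed

lemma norm_adj_times: "norm (adj X * X) = (norm X)\<^sup>2"
  using norm_adj_times_mono[of X 0] norm_mult_ineq[of "adj X" X] by (simp add: power2_eq_square)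

lemma norm_times_adj: "norm (X * adj X) = (norm X)\<^sup>2"
  using norm_adj_times[of "adj X"] by simp

lemma norm_le_sum_ent:
  assumes "corner k X" shows "norm X \<le> (\<Sum>i<k. \<Sum>j<k. norm (ent X i j))"
  by (rule norm_fmat_leI[OF assms]) (rule norm_form_le_sum)

lemma norm_eq_Sup:
  assumes "corner k X"
  shows "norm X = Sup {norm (form k z X x) | z x. vn k z \<le> 1 \<and> vn k x \<le> 1}"
proof -
  have "{norm (form n z X x) | n z x. vn n z \<le> 1 \<and> vn n x \<le> 1} =
        {norm (form k z X x) | z x. vn k z \<le> 1 \<and> vn k x \<le> 1}" (is "?L = ?R")
  proof
    show "?L \<subseteq> ?R"
    proof safe
      fix n and z x :: "nat \<Rightarrow> 'a" assume "vn n z \<le> 1" "vn n x \<le> 1"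
      then have "vn k (cut n z) \<le> 1" "vn k (cut n x) \<le> 1" using vn_cut order_trans by blast+
      then show "\<exists>z' x'. norm (form n z X x) = norm (form k z' X x') \<and> vn k z' \<le> 1 \<and> vn k x' \<le> 1"
        using form_cut[OF assms] by metis
    qed
  qed auto
  then show ?thesis by (simp add: norm_fmat_def)
qed

definition dg :: "nat \<Rightarrow> 'a::cstar_algebra \<Rightarrow> 'a fmat" where
  "dg k a = mk k (\<lambda>i j. if i = j then a else 0)"

lemma ent_dg: "ent (dg k a) i j = (if i = j \<and> i < k then a else 0)"
  by (auto simp: dg_def ent_mk)

lemma corner_dg [simp]: "corner k (dg k a)" by (simp add: dg_def corner_mk)

lemma ent_dg_times: "ent (dg k a * X) i j = (if i < k then a * ent X i j else 0)"
proof -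
  have "ent (dg k a * X) i j = (\<Sum>l<k. if l = i then (if i < k then a * ent X i j else 0) else 0)"
    unfolding ent_times[OF corner_dg] by (rule sum.cong) (auto simp: ent_dg)
  then show ?thesis by simp
qed

lemma ent_times_dg: "ent (X * dg k a) i j = (if j < k then ent X i j * a else 0)"
proof -
  have "ent (X * dg k a) i j = (\<Sum>l<k. if l = j then (if j < k then ent X i j * a else 0) else 0)"
    unfolding ent_times'[OF corner_dg] by (rule sum.cong) (auto simp: ent_dg)
  then show ?thesis by simp
qed

lemma dg_one_left: "corner k X \<Longrightarrow> dg k 1 * X = X"
  by (rule fmat_eqI) (auto simp: ent_dg_times corner_ent)

lemma dg_one_right: "corner k X \<Longrightarrow> X * dg k 1 = X"
  by (rule fmat_eqI) (auto simp: ent_times_dg corner_ent)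

lemma dg_0 [simp]: "dg k 0 = 0" by (rule fmat_eqI) (simp add: ent_dg)
lemma dg_plus: "dg k (a + b) = dg k a + dg k b" by (rule fmat_eqI) (simp add: ent_dg)
lemma dg_uminus: "dg k (- a) = - dg k a" by (rule fmat_eqI) (simp add: ent_dg)
lemma dg_scaleR: "dg k (r *\<^sub>R a) = r *\<^sub>R dg k a" by (rule fmat_eqI) (simp add: ent_dg)
lemma dg_times: "dg k a * dg k b = dg k (a * b)" by (rule fmat_eqI) (auto simp: ent_dg_times ent_dg)
lemma adj_dg: "adj (dg k a) = dg k (cstar a)" by (rule fmat_eqI) (auto simp: ent_dg)

lemma iu_commute: "corner k X \<Longrightarrow> dg k iu * X = X * dg k iu"
  by (rule fmat_eqI) (auto simp: ent_dg_times ent_times_dg corner_ent iu_central)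

text \<open>The element \<open>(norm a)^2 - cstar a * a\<close> is positive; conjugating it by the
  coordinates of a vector and summing shows that \<open>a\<close>, acting on all coordinates at
  once, lengthens no vector by more than \<open>norm a\<close>.\<close>

lemma norm_dg_le: "norm (dg k a) \<le> norm a"
proof (rule norm_fmat_leI[OF corner_dg])
  fix z x :: "nat \<Rightarrow> 'a" assume v: "vn k z \<le> 1" "vn k x \<le> 1"
  define y where "y i = a * x i" for i
  have "form k z (dg k a) x = vip k z y"
    unfolding form_def vip_def
  proof (rule sum.cong)
    fix i assume "i \<in> {..<k}"
    then have "(\<Sum>j<k. cstar (z i) * ent (dg k a) i j * x j) = (\<Sum>j<k. if j = i then cstar (z i) * y i else 0)"
      by (intro sum.cong) (auto simp: ent_dg y_def mult.assoc)
    then show "(\<Sum>j<k. cstar (z i) * ent (dg k a) i j * x j) = cstar (z i) * y i"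
      using \<open>i \<in> {..<k}\<close> by simp
  qed simp
  then have "norm (form k z (dg k a) x) \<le> vn k y" using vip_CS_unit v by metis
  moreover have "vn k y \<le> norm a"
  proof -
    define c where "c = (norm a)\<^sup>2 *\<^sub>R 1 - cstar a * a"
    have "pos c" unfolding c_def by (rule pos_le_norm[OF pos_cstar_mult]) (simp add: cstar_identity)
    then have "pos (\<Sum>i<k. cstar (x i) * c * x i)" by (intro pos_sum pos_conj)
    moreover have "vip k y y + (\<Sum>i<k. cstar (x i) * c * x i) = (norm a)\<^sup>2 *\<^sub>R vip k x x"
      by (simp add: vip_def y_def c_def cstar_simps algebra_simps sum.distrib[symmetric] scaleR_sum_right sum_subtractf)
    ultimately have "norm (vip k y y) \<le> norm ((norm a)\<^sup>2 *\<^sub>R vip k x x)"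
      using pos_norm_mono[OF pos_vip] by metis
    also have "\<dots> \<le> (norm a)\<^sup>2 * 1" using v(2) by (simp add: vn_le_1 mult_left_le)
    finally have "(vn k y)\<^sup>2 \<le> (norm a)\<^sup>2" by (simp add: vn_sq)
    then show ?thesis by (rule power2_le_imp_le) simp
  qed
  ultimately show "norm (form k z (dg k a) x) \<le> norm a" by linarith
qed

section \<open>Positivity and inversion in the corners\<close>

text \<open>The factor \<open>W\<close> may occupy a larger corner than \<open>X\<close>, so that
  stacked columns count as factors.\<close>

definition psd :: "'a::cstar_algebra fmat \<Rightarrow> bool" where
  "psd X \<longleftrightarrow> (\<exists>W. X = adj W * W)"

text \<open>An isometry that moves the first \<open>n\<close> coordinates to the next
  \<open>n\<close>. Adding \<open>shf n * C\<close> to \<open>A\<close> stacks two matrices of the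
  corner \<open>n\<close> into one column.\<close>

definition shf :: "nat \<Rightarrow> 'a::cstar_algebra fmat" where
  "shf n = mk (2 * n) (\<lambda>i j. if i = n + j \<and> j < n then 1 else 0)"

lemma ent_shf: "ent (shf n) i j = (if i = n + j \<and> j < n then 1 else 0)"
  by (auto simp: shf_def ent_mk)

lemma corner_shf: "corner (2 * n) (shf n)"
  by (simp add: shf_def corner_mk)

lemma adj_shf_shf: "adj (shf n) * shf n = dg n (1::'a::cstar_algebra)"
proof (rule fmat_eqI)
  fix i j
  have "ent (adj (shf n) * shf n) i j = (\<Sum>l<2*n. if l = n + j then (if i = j \<and> i < n then 1 else 0) else 0 :: 'a)"
    unfolding ent_times'[OF corner_shf] by (rule sum.cong) (auto simp: ent_shf)
  then show "ent (adj (shf n) * shf n) i j = ent (dg n (1::'a)) i j" by (simp add: ent_dg)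
qed

lemma times_shf:
  assumes "corner n A" shows "A * shf n = 0" "adj (shf n) * A = 0"
proof -
  have *: "X * shf n = 0" if "corner n X" for X :: "'a fmat"
    by (rule fmat_eqI) (auto simp: ent_times[OF that] ent_shf intro!: sum.neutral)
  show "A * shf n = 0" by (rule * assms)+
  have "adj (adj (shf n) * A) = 0" using *[OF corner_adj[OF assms]] by (simp add: adj_times)
  then show "adj (shf n) * A = 0" by (metis adj_adj adj_0)
qed

lemma common_corner:
  obtains n where "corner n X" "corner n Y"
  by (meson corner_fdim corner_mono max.cobounded1 max.cobounded2)

lemma psd_square: "psd (adj W * W)" by (auto simp: psd_def)

lemma psd_0 [simp]: "psd 0" using psd_square[of 0] by simp

text \<open>The column with blocks \<open>A\<close> and \<open>C\<close> has the required square,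
  since the shift makes the cross terms vanish.\<close>

lemma psd_add:
  assumes "psd X" "psd Y" shows "psd (X + Y)"
proof -
  obtain A C where A: "X = adj A * A" "Y = adj C * C" using assms by (auto simp: psd_def)
  obtain n where n: "corner n A" "corner n C" by (rule common_corner)
  have s: "adj A * (shf n * C) = 0" "(adj C * adj (shf n)) * A = 0"
    using times_shf(1)[OF corner_adj[OF n(1)]] times_shf(2)[OF n(1)]
    by (simp_all add: mult.assoc mult.assoc[symmetric, of "adj A"])
  have "(adj C * adj (shf n)) * (shf n * C) = adj C * C"
    using dg_one_left[OF n(2)] adj_shf_shf[of n, where ?'a = 'a] by (metis mult.assoc)
  then have "adj (A + shf n * C) * (A + shf n * C) = X + Y"
    using s by (simp add: A adj_simps distrib_left distrib_right)
  then show ?thesis by (metis psd_square)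
qed

lemma psd_scaleR: "psd X \<Longrightarrow> t \<ge> 0 \<Longrightarrow> psd (t *\<^sub>R X)"
proof -
  assume "psd X" "t \<ge> 0"
  then obtain W where "X = adj W * W" by (auto simp: psd_def)
  then have "t *\<^sub>R X = adj (sqrt t *\<^sub>R W) * (sqrt t *\<^sub>R W)" using \<open>t \<ge> 0\<close> by (simp add: adj_simps)
  then show ?thesis by (metis psd_square)
qed

lemma psd_conj: "psd X \<Longrightarrow> psd (adj V * X * V)"
  by (auto simp: psd_def) (metis adj_times mult.assoc)

lemma norm_square_le:
  assumes "psd Q" shows "(norm X)\<^sup>2 \<le> norm (adj X * X + Q)"
  using assms norm_adj_times_mono by (auto simp: psd_def)

text \<open>Having \<open>iu\<close> in \<open>S\<close> keeps the shifts along the imaginary axis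
  inside \<open>S\<close>, and closedness keeps Neumann series there. Recording which algebra
  contains the entries of a resolvent is what later makes monotone independence applicable to
  it.\<close>

definition calg :: "'a::cstar_algebra set \<Rightarrow> bool" where
  "calg S \<longleftrightarrow> 1 \<in> S \<and> iu \<in> S \<and> closed S \<and> (\<forall>x\<in>S. \<forall>y\<in>S. x + y \<in> S \<and> x * y \<in> S) \<and>
     (\<forall>x\<in>S. \<forall>r. r *\<^sub>R x \<in> S)"

definition ovr :: "nat \<Rightarrow> 'a::cstar_algebra set \<Rightarrow> 'a fmat \<Rightarrow> bool" where
  "ovr k S X \<longleftrightarrow> corner k X \<and> (\<forall>i j. ent X i j \<in> S)"

lemma calgD:
  assumes "calg S"
  shows "1 \<in> S" "iu \<in> S" "closed S" "x \<in> S \<Longrightarrow> y \<in> S \<Longrightarrow> x + y \<in> S" "x \<in> S \<Longrightarrow> y \<in> S \<Longrightarrow> x * y \<in> S"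
    "x \<in> S \<Longrightarrow> r *\<^sub>R x \<in> S" "0 \<in> S" "x \<in> S \<Longrightarrow> - x \<in> S" "x \<in> S \<Longrightarrow> y \<in> S \<Longrightarrow> x - y \<in> S"
proof -
  show *: "1 \<in> S" "iu \<in> S" "closed S" "x \<in> S \<Longrightarrow> y \<in> S \<Longrightarrow> x + y \<in> S" "x \<in> S \<Longrightarrow> y \<in> S \<Longrightarrow> x * y \<in> S"
    "x \<in> S \<Longrightarrow> r *\<^sub>R x \<in> S" for x y r using assms by (auto simp: calg_def)
  show "0 \<in> S" using *(6)[OF *(1), of 0] by simp
  have m: "- z \<in> S" if "z \<in> S" for z using *(6)[OF that, of "-1"] by simp
  then show "x \<in> S \<Longrightarrow> - x \<in> S" .
  show "x - y \<in> S" if "x \<in> S" "y \<in> S" using *(4)[OF that(1) m[OF that(2)]] by simp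
qed

lemma calg_UNIV: "calg UNIV" by (simp add: calg_def)

lemma calg_sum: "calg S \<Longrightarrow> (\<And>i. i \<in> A \<Longrightarrow> f i \<in> S) \<Longrightarrow> sum f A \<in> S"
  by (induction A rule: infinite_finite_induct) (auto intro: calgD)

lemma calg_sums:
  assumes "calg S" "\<And>n. f n \<in> S" "f sums l" shows "l \<in> S"
proof (rule Lim_in_closed_set[of S "\<lambda>n. \<Sum>i<n. f i" sequentially])
  show "closed S" using assms by (simp add: calgD)
  show "\<forall>\<^sub>F n in sequentially. (\<Sum>i<n. f i) \<in> S" 
    by (intro always_eventually allI calg_sum assms(1,2))
  show "((\<lambda>n. \<Sum>i<n. f i) \<longlongrightarrow> l) sequentially" using assms(3) by (simp add: sums_def)
qed simp

lemma ovr_corner: "ovr k S X \<Longrightarrow> corner k X" by (simp add: ovr_def)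
lemma ovr_ent: "ovr k S X \<Longrightarrow> ent X i j \<in> S" by (simp add: ovr_def)
lemma ovr_mono: "ovr k S X \<Longrightarrow> S \<subseteq> S' \<Longrightarrow> ovr k S' X" by (auto simp: ovr_def)

lemma ovr_plus: "calg S \<Longrightarrow> ovr k S X \<Longrightarrow> ovr k S Y \<Longrightarrow> ovr k S (X + Y)"
  by (auto simp: ovr_def corner_plus calgD)
lemma ovr_minus: "calg S \<Longrightarrow> ovr k S X \<Longrightarrow> ovr k S Y \<Longrightarrow> ovr k S (X - Y)"
  by (auto simp: ovr_def corner_minus calgD)
lemma ovr_uminus: "calg S \<Longrightarrow> ovr k S X \<Longrightarrow> ovr k S (- X)"
  by (auto simp: ovr_def corner_uminus calgD)
lemma ovr_scaleR: "calg S \<Longrightarrow> ovr k S X \<Longrightarrow> ovr k S (r *\<^sub>R X)"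
  by (auto simp: ovr_def corner_scaleR calgD)
lemma ovr_times: "calg S \<Longrightarrow> ovr k S X \<Longrightarrow> ovr k S Y \<Longrightarrow> ovr k S (X * Y)"
  by (auto simp: ovr_def corner_times ent_times[of k X Y] intro!: calg_sum calgD(5))
lemma ovr_dg: "calg S \<Longrightarrow> a \<in> S \<Longrightarrow> ovr k S (dg k a)"
  by (auto simp: ovr_def ent_dg calgD)
lemma ovr_one: "calg S \<Longrightarrow> ovr k S (dg k 1)"
  by (simp add: ovr_dg calgD)

lemmas ovr_intros = ovr_plus ovr_minus ovr_uminus ovr_scaleR ovr_times ovr_one ovr_dg

lemma norm_one_corner: "norm (dg k 1) \<le> 1"
  using norm_dg_le[of k 1] by simp

text \<open>The space \<open>fmat\<close> is not complete, so the series is summed entry by entry;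
  this also shows that the entries of the inverse remain in \<open>S\<close>.\<close>

lemma neumann_corner:
  assumes S: "calg S" and X: "ovr k S X" "norm X < 1"
  obtains N where "ovr k S N" "(dg k 1 - X) * N = dg k 1" "N * (dg k 1 - X) = dg k 1"
proof -
  define p where "p = rec_nat (dg k 1) (\<lambda>_ Y. X * Y)"
  have p0: "p 0 = dg k 1" and pS: "p (Suc n) = X * p n" for n by (simp_all add: p_def)
  have cX: "corner k X" using X by (simp add: ovr_def)
  have po: "ovr k S (p n)" for n by (induction n) (auto simp: p0 pS intro: ovr_intros S X)
  have pX: "p n * X = X * p n" for n
    by (induction n) (auto simp: p0 pS mult.assoc dg_one_left[OF cX] dg_one_right[OF cX])
  have np: "norm (p n) \<le> norm X ^ n" for n
  proof (induction n)
    case (Suc n)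
    then show ?case unfolding pS using norm_mult_ineq[of X "p n"]
      by (simp add: order_trans[OF _ mult_left_mono])
  qed (simp add: p0 norm_one_corner)
  have sm: "summable (\<lambda>n. ent (p n) i j)" for i j
    by (rule summable_comparison_test'[of "\<lambda>n. norm X ^ n" 0])
      (use X(2) order_trans[OF norm_ent_le np] in \<open>auto intro: summable_geometric\<close>)
  define N where "N = mk k (\<lambda>i j. \<Sum>n. ent (p n) i j)"
  have cp: "ent (p n) i j = 0" if "k \<le> i \<or> k \<le> j" for n i j using that po[of n] by (auto simp: ovr_def corner_def)
  have sN: "(\<lambda>n. ent (p n) i j) sums ent N i j" for i j
    using summable_sums[OF sm[of i j]] cp[of i j] by (auto simp: N_def ent_mk not_less)
  have "ent N i j \<in> S" for i j by (rule calg_sums[OF S ovr_ent[OF po] sN])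
  then have oN: "ovr k S N" by (simp add: ovr_def N_def corner_mk)
  have cN: "corner k N" using oN by (simp add: ovr_def)
  have sNs: "(\<lambda>n. ent (p (Suc n)) i j) sums (ent N i j - ent (dg k 1) i j)" for i j
    using sums_split_initial_segment[OF sN[of i j], of 1] by (simp add: p0)
  have XN: "ent (X * N) i j = ent N i j - ent (dg k 1) i j" for i j
  proof (rule sums_unique2[OF _ sNs])
    show "(\<lambda>n. ent (p (Suc n)) i j) sums ent (X * N) i j"
      unfolding pS ent_times[OF cX] by (intro sums_sum sums_mult sN)
  qed
  have NX: "ent (N * X) i j = ent N i j - ent (dg k 1) i j" for i j
  proof (rule sums_unique2[OF _ sNs])
    show "(\<lambda>n. ent (p (Suc n)) i j) sums ent (N * X) i j"
      unfolding pS pX[symmetric] ent_times'[OF cX] by (intro sums_sum sums_mult2 sN)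
  qed
  show ?thesis
  proof (rule that[OF oN])
    show "(dg k 1 - X) * N = dg k 1" unfolding left_diff_distrib dg_one_left[OF cN]
      by (rule fmat_eqI) (simp add: XN)
    show "N * (dg k 1 - X) = dg k 1" unfolding right_diff_distrib dg_one_right[OF cN]
      by (rule fmat_eqI) (simp add: NX)
  qed
qed

definition inverses :: "nat \<Rightarrow> 'a::cstar_algebra fmat \<Rightarrow> 'a fmat \<Rightarrow> bool" where
  "inverses k T R \<longleftrightarrow> corner k T \<and> corner k R \<and> T * R = dg k 1 \<and> R * T = dg k 1"

lemma inverses_unique: "inverses k T R \<Longrightarrow> inverses k T R' \<Longrightarrow> R = R'"
  unfolding inverses_def by (metis dg_one_left dg_one_right mult.assoc)

lemma inverses_sym: "inverses k T R \<Longrightarrow> inverses k R T"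
  by (auto simp: inverses_def)

lemma inverses_adj: "inverses k T R \<Longrightarrow> inverses k (adj T) (adj R)"
  by (simp add: inverses_def corner_adj adj_times[symmetric] adj_dg)

lemma inverses_uminus: "inverses k T R \<Longrightarrow> inverses k (- T) (- R)"
  by (simp add: inverses_def corner_uminus)

lemma inverses_perturb:
  assumes S: "calg S" and i: "inverses k T R" and R: "ovr k S R" and X: "ovr k S X" and n: "norm X * norm R < 1"
  obtains R' where "inverses k (T - X) R'" "ovr k S R'"
proof -
  have TR: "T * R = dg k 1" "R * T = dg k 1" "corner k T" "corner k R" using i by (auto simp: inverses_def)
  have cX: "corner k X" using X by (simp add: ovr_def)
  have "norm (R * X) < 1" using n norm_mult_ineq[of R X] by (simp add: mult.commute)
  then obtain N where N: "ovr k S N" "(dg k 1 - R * X) * N = dg k 1" "N * (dg k 1 - R * X) = dg k 1"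
    using neumann_corner[OF S ovr_times[OF S R X]] by metis
  have RT: "R * (T - X) = dg k 1 - R * X" by (simp add: right_diff_distrib TR)
  have TX: "T * (dg k 1 - R * X) = T - X"
    by (simp add: right_diff_distrib dg_one_right[OF TR(3)] mult.assoc[symmetric] TR dg_one_left[OF cX])
  show ?thesis
  proof (rule that[of "N * R"])
    show "ovr k S (N * R)" by (intro ovr_times S N R)
    then have c: "corner k (N * R)" by (simp add: ovr_def)
    have "(T - X) * (N * R) = T * ((dg k 1 - R * X) * N) * R" by (simp add: TX[symmetric] mult.assoc)
    then have "(T - X) * (N * R) = dg k 1" by (simp add: N dg_one_right[OF TR(3)] TR)
    moreover have "(N * R) * (T - X) = dg k 1" using RT N by (simp add: mult.assoc)
    ultimately show "inverses k (T - X) (N * R)" by (simp add: inverses_def c corner_minus TR cX)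
  qed
qed

definition imp :: "nat \<Rightarrow> 'a::cstar_algebra fmat \<Rightarrow> 'a fmat" where
  "imp k T = (- 1 / 2) *\<^sub>R (dg k iu * (T - adj T))"

lemma corner_imp: "corner k T \<Longrightarrow> corner k (imp k T)"
  by (simp add: imp_def corner_scaleR corner_uminus corner_times corner_minus corner_adj)

lemma imp_plus: "imp k (S + T) = imp k S + imp k T"
  by (simp add: imp_def adj_simps algebra_simps)

lemma imp_uminus: "imp k (- T) = - imp k T"
  by (simp add: imp_def adj_simps algebra_simps)

lemma imp_selfadj: "adj T = T \<Longrightarrow> imp k T = 0"
  by (simp add: imp_def)

lemma imp_iu: "imp k (s *\<^sub>R dg k iu) = s *\<^sub>R dg k 1"
  by (simp add: imp_def adj_simps adj_dg cstar_iu dg_uminus dg_times iu_sq scaleR_2[symmetric] right_diff_distrib)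

lemma norm_iu_times: "norm (dg k iu * (X :: 'a::cstar_algebra fmat)) \<le> norm X"
  using norm_mult_ineq[of "dg k iu" X] norm_dg_le[of k "iu :: 'a"] mult_right_mono[of "norm (dg k (iu :: 'a))" 1 "norm X"]
  by simp

lemma imp_conj:
  assumes "corner k T" "corner k V"
  shows "adj V * imp k T * V = imp k (adj V * T * V)"
proof -
  have "adj V * (dg k iu * (T - adj T)) = dg k iu * (adj V * (T - adj T))"
    using iu_commute[OF corner_adj[OF assms(2)]] by (metis mult.assoc)
  then have "adj V * imp k T * V = (- 1 / 2) *\<^sub>R (dg k iu * (adj V * (T - adj T) * V))"
    by (simp add: imp_def mult.assoc)
  then show ?thesis by (simp add: imp_def adj_simps algebra_simps)
qed

lemma norm_imp_le: "norm (imp k T) \<le> norm T"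
proof -
  have "norm (dg k iu * (T - adj T)) \<le> norm T + norm (adj T)"
    using norm_iu_times[of k "T - adj T"] norm_triangle_ineq4[of T "adj T"] by linarith
  then show ?thesis by (simp add: imp_def)
qed

text \<open>For \<open>Z\<^sup>* Z\<close> invertible this holds with \<open>D = \<parallel>(Z\<^sup>* Z)\<^sup>-\<^sup>1\<parallel>\<close>; it replaces the order inequality
  \<open>Z\<^sup>* Z \<ge> 1 / D\<close>.\<close>

definition lowbd :: "nat \<Rightarrow> 'a::cstar_algebra fmat \<Rightarrow> real \<Rightarrow> bool" where
  "lowbd k Z D \<longleftrightarrow> D \<ge> 0 \<and> (\<forall>x. corner k x \<longrightarrow> (norm x)\<^sup>2 \<le> D * (norm (Z * x))\<^sup>2)"

text \<open>The imaginary part of \<open>adj x * T * x\<close> dominates the square of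
  \<open>Z * x\<close> and is bounded by \<open>norm x * norm (T * x)\<close>; after
  \<open>lowbd\<close> one factor \<open>norm x\<close> cancels. With an inverse of \<open>T\<close>
  for \<open>x\<close> it bounds that inverse by \<open>D\<close>.\<close>

lemma lower_bound:
  assumes l: "lowbd k Z D" and T: "corner k T" "psd (imp k T - adj Z * Z)" and x: "corner k x"
  shows "norm x \<le> D * norm (T * x)"
proof -
  have "psd (adj x * (imp k T - adj Z * Z) * x)" using T(2) by (rule psd_conj)
  then have "(norm (Z * x))\<^sup>2 \<le> norm (adj (Z * x) * (Z * x) + adj x * (imp k T - adj Z * Z) * x)"
    by (rule norm_square_le)
  also have "adj (Z * x) * (Z * x) + adj x * (imp k T - adj Z * Z) * x = imp k (adj x * T * x)"
    unfolding imp_conj[OF T(1) x, symmetric] by (simp add: adj_simps algebra_simps)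
  also have "norm \<dots> \<le> norm (adj x * (T * x))" using norm_imp_le by (simp add: mult.assoc)
  also have "\<dots> \<le> norm x * norm (T * x)" using norm_mult_ineq[of "adj x"] by simp
  finally have "(norm (Z * x))\<^sup>2 \<le> norm x * norm (T * x)" .
  then have "D * (norm (Z * x))\<^sup>2 \<le> D * (norm x * norm (T * x))"
    using l by (intro mult_left_mono) (auto simp: lowbd_def)
  moreover have "(norm x)\<^sup>2 \<le> D * (norm (Z * x))\<^sup>2" using l x by (auto simp: lowbd_def)
  ultimately have *: "norm x * norm x \<le> norm x * (D * norm (T * x))" by (simp add: power2_eq_square mult_ac)
  show ?thesis
  proof (cases "norm x = 0")
    case True then show ?thesis using l by (simp add: lowbd_def)
  next
    case False
    then show ?thesis using mult_left_le_imp_le[OF *] by simp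
  qed
qed

text \<open>Far up the imaginary axis \<open>T + is\<close> is inverted by a Neumann series; the uniform lower
  bound lets the inversion be carried down to \<open>s = 0\<close> in steps of fixed length, so that the inverse
  stays in every closed complex algebra containing \<open>T\<close>.\<close>

lemma resolvent_exists:
  assumes S: "calg S" and l: "lowbd k Z D" and T: "ovr k S T" "psd (imp k T - adj Z * Z)"
  obtains R where "inverses k T R" "ovr k S R" "norm R \<le> D"
proof -
  define J where "J = dg k (iu :: 'a)"
  \<comment> \<open>As \<open>q * D < 1\<close>, a Neumann step of length \<open>q\<close> works at
    every height \<open>s >= 0\<close>, where inverses are bounded by \<open>D\<close>.\<close>
  define q where "q = 1 / (D + 1)"
  have D: "D \<ge> 0" using l by (simp add: lowbd_def)
  have q: "q > 0" using D by (simp add: q_def)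
  have cT: "corner k T" using T by (simp add: ovr_def)
  have oJ: "ovr k S (r *\<^sub>R J)" for r unfolding J_def by (intro ovr_intros S calgD(2))
  have bd: "norm R \<le> D" if i: "inverses k (T + s *\<^sub>R J) R" and "s \<ge> 0" for s R
  proof -
    have "norm R \<le> D * norm ((T + s *\<^sub>R J) * R)"
    proof (rule lower_bound[OF l])
      show "corner k (T + s *\<^sub>R J)" "corner k R" using i by (auto simp: inverses_def)
      have "psd ((imp k T - adj Z * Z) + s *\<^sub>R (adj (dg k 1) * dg k 1))"
        using T \<open>s \<ge> 0\<close> by (intro psd_add psd_scaleR psd_square)
      then show "psd (imp k (T + s *\<^sub>R J) - adj Z * Z)"
        by (simp add: J_def imp_plus imp_iu adj_dg dg_times algebra_simps)
    qed
    also have "(T + s *\<^sub>R J) * R = dg k 1" using i by (simp add: inverses_def)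
    finally show ?thesis using norm_one_corner[of k] D by (smt (verit) mult_left_le)
  qed
  define P where "P s \<longleftrightarrow> (\<exists>R. inverses k (T + s *\<^sub>R J) R \<and> ovr k S R)" for s
  have large: "P s" if "s > norm T" for s
  proof -
    have s: "s > 0" using that norm_ge_zero[of T] by linarith
    have "inverses k (s *\<^sub>R J) ((- 1 / s) *\<^sub>R J)"
      using s by (simp add: inverses_def J_def corner_scaleR corner_uminus dg_times iu_sq dg_uminus)
    moreover have "norm (- T) * norm ((- 1 / s) *\<^sub>R J) < 1"
    proof -
      have "norm J \<le> 1" using norm_dg_le[of k iu] by (simp add: J_def)
      then have "norm ((- 1 / s) *\<^sub>R J) \<le> 1 / s" using s by (simp add: divide_right_mono)
      then have "norm T * norm ((- 1 / s) *\<^sub>R J) \<le> norm T * (1 / s)" by (rule mult_left_mono) simp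
      also have "\<dots> < 1" using s that by simp
      finally show ?thesis by simp
    qed
    ultimately obtain R where "inverses k (s *\<^sub>R J - (- T)) R" "ovr k S R"
      using inverses_perturb[OF S _ oJ ovr_uminus[OF S T(1)]] by metis
    then show ?thesis by (auto simp: P_def add.commute)
  qed
  have step: "P (s - q)" if Ps: "P s" and s: "s \<ge> 0" for s
  proof -
    obtain R where R: "inverses k (T + s *\<^sub>R J) R" "ovr k S R" using Ps by (auto simp: P_def)
    have "norm J \<le> 1" using norm_dg_le[of k iu] by (simp add: J_def)
    then have "norm (q *\<^sub>R J) \<le> q" using q by (simp add: mult_left_le)
    then have "norm (q *\<^sub>R J) * norm R \<le> q * D" using bd[OF R(1) s] q by (intro mult_mono) auto
    also have "\<dots> < 1" using D by (simp add: q_def)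
    finally obtain R' where "inverses k (T + s *\<^sub>R J - q *\<^sub>R J) R'" "ovr k S R'"
      using inverses_perturb[OF S R(1) R(2) oJ[of q]] by metis
    moreover have "T + s *\<^sub>R J - q *\<^sub>R J = T + (s - q) *\<^sub>R J" by (simp add: algebra_simps)
    ultimately show ?thesis by (auto simp: P_def)
  qed
  have down: "P (real n * q) \<Longrightarrow> P 0" for n
  proof (induction n)
    case (Suc n)
    have "P (real (Suc n) * q - q)" by (rule step[OF Suc.prems]) (use q in simp)
    then show ?case using Suc.IH by (simp add: algebra_simps)
  qed simp
  obtain n where "norm T < real n * q" using q reals_Archimedean3 by blast
  then have "P 0" using large down by blast
  then obtain R where R: "inverses k T R" "ovr k S R" by (auto simp: P_def)
  then show ?thesis using that bd[of 0 R] by simp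
qed

section \<open>Conditional expectations on matrices\<close>

definition tofm :: "nat \<Rightarrow> 'a::cstar_algebra mat \<Rightarrow> 'a fmat" where
  "tofm k M = mk k (\<lambda>i j. M $$ (i, j))"

definition ofm :: "nat \<Rightarrow> 'a::cstar_algebra fmat \<Rightarrow> 'a mat" where
  "ofm k X = Matrix.mat k k (\<lambda>(i, j). ent X i j)"

lemma corner_tofm [simp]: "corner k (tofm k M)" by (simp add: tofm_def corner_mk)

lemma ofm_carrier [simp]: "ofm k X \<in> carrier_mat k k" by (simp add: ofm_def)

lemma tofm_ofm: "corner k X \<Longrightarrow> tofm k (ofm k X) = X"
  by (rule corner_eqI[of k]) (auto simp: tofm_def ofm_def corner_mk ent_mk)

lemma ofm_tofm: "M \<in> carrier_mat k k \<Longrightarrow> ofm k (tofm k M) = M"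
  by (rule eq_matI) (auto simp: tofm_def ofm_def ent_mk)

lemma tofm_times:
  assumes "M \<in> carrier_mat k k" "N \<in> carrier_mat k k"
  shows "tofm k (M * N) = tofm k M * tofm k N"
proof (rule corner_eqI[of k])
  fix i j assume "i < k" "j < k"
  then show "ent (tofm k (M * N)) i j = ent (tofm k M * tofm k N) i j"
    using assms by (simp add: ent_times[of k] tofm_def corner_mk ent_mk scalar_prod_def lessThan_atLeast0)
qed (simp_all add: corner_times)

lemma tofm_madj: "M \<in> carrier_mat k k \<Longrightarrow> tofm k (madj M) = adj (tofm k M)"
  by (rule fmat_eqI) (auto simp: tofm_def ent_mk madj_def)

lemma madj_carrier: "M \<in> carrier_mat k k \<Longrightarrow> madj M \<in> carrier_mat k k"
  by (auto simp: madj_def)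

locale opval_space =
  fixes B :: "'a::cstar_algebra set" and E :: "'a \<Rightarrow> 'a"
  assumes opval: "opval_cstar_prob_space B E"
begin

lemma calg_B: "calg B"
  using opval by (auto simp: opval_cstar_prob_space_def unital_cstar_subalg_def calg_def)

lemma cstar_B: "b \<in> B \<Longrightarrow> cstar b \<in> B"
  using opval by (auto simp: opval_cstar_prob_space_def unital_cstar_subalg_def)

lemma E_in: "E a \<in> B" and E_id: "b \<in> B \<Longrightarrow> E b = b" and E_add: "E (a + c) = E a + E c"
  and E_scaleR: "E (r *\<^sub>R a) = r *\<^sub>R E a"
  and E_bimod: "b1 \<in> B \<Longrightarrow> b2 \<in> B \<Longrightarrow> E (b1 * a * b2) = b1 * E a * b2"
  and E_cp: "completely_positive E"
  using opval by (auto simp: opval_cstar_prob_space_def cond_exp_def)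

lemma E_0 [simp]: "E 0 = 0" using E_scaleR[of 0 0] by simp
lemma E_uminus: "E (- a) = - E a" using E_scaleR[of "-1" a] by simp
lemma E_minus: "E (a - c) = E a - E c" using E_add[of a "- c"] by (simp add: E_uminus)
lemma E_sum: "E (sum f A) = (\<Sum>i\<in>A. E (f i))"
  by (induction A rule: infinite_finite_induct) (auto simp: E_add)
lemma E_left: "b \<in> B \<Longrightarrow> E (b * a) = b * E a"
  using E_bimod[of b 1 a] calg_B by (simp add: calgD)
lemma E_right: "b \<in> B \<Longrightarrow> E (a * b) = E a * b"
  using E_bimod[of 1 b a] calg_B by (simp add: calgD)

definition Ef :: "'a fmat \<Rightarrow> 'a fmat" where
  "Ef X = mk (fdim X) (\<lambda>i j. E (ent X i j))"

lemma ent_Ef [simp]: "ent (Ef X) i j = E (ent X i j)"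
  using corner_fdim[of X] by (auto simp: Ef_def ent_mk corner_def)

lemma corner_Ef: "corner k X \<Longrightarrow> corner k (Ef X)" by (simp add: corner_def)

lemma ovr_Ef: "corner k X \<Longrightarrow> ovr k B (Ef X)" by (simp add: ovr_def corner_Ef E_in)

lemma Ef_plus: "Ef (X + Y) = Ef X + Ef Y" by (rule fmat_eqI) (simp add: E_add)
lemma Ef_minus: "Ef (X - Y) = Ef X - Ef Y" by (rule fmat_eqI) (simp add: E_minus)
lemma Ef_uminus: "Ef (- X) = - Ef X" by (rule fmat_eqI) (simp add: E_uminus)
lemma Ef_scaleR: "Ef (r *\<^sub>R X) = r *\<^sub>R Ef X" by (rule fmat_eqI) (simp add: E_scaleR)
lemma Ef_0 [simp]: "Ef 0 = 0" by (rule fmat_eqI) simp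
lemma Ef_dg: "Ef (dg k a) = dg k (E a)" by (rule fmat_eqI) (simp add: ent_dg)
lemma Ef_id: "ovr k B X \<Longrightarrow> Ef X = X" by (rule fmat_eqI) (simp add: ovr_def E_id)
lemma Ef_left: "ovr k B b \<Longrightarrow> Ef (b * X) = b * Ef X"
  by (rule fmat_eqI) (simp add: ent_times[of k] ovr_def E_sum E_left)
lemma Ef_right: "ovr k B b \<Longrightarrow> Ef (X * b) = Ef X * b"
  by (rule fmat_eqI) (simp add: ent_times'[of k] ovr_def E_sum E_right)

lemmas Ef_simps = Ef_plus Ef_minus Ef_uminus Ef_scaleR

lemma tofm_E: "M \<in> carrier_mat k k \<Longrightarrow> tofm k (map_mat E M) = Ef (tofm k M)"
  by (rule fmat_eqI) (auto simp: tofm_def ent_mk)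

text \<open>The single appeal to complete positivity. Positivity, compatibility with adjoints,
  Cauchy--Schwarz and contractivity of \<open>E\<close> all descend from it.\<close>

lemma Ef_square:
  assumes "corner k W" obtains V where "corner k V" "Ef (adj W * W) = adj V * V"
proof -
  define M where "M = ofm k W"
  have M: "M \<in> carrier_mat k k" by (simp add: M_def)
  have MM: "madj M * M \<in> carrier_mat k k" using M madj_carrier[OF M] by auto
  then have "mpos k (madj M * M)" using M by (auto simp: mpos_def)
  then have "mpos k (map_mat E (madj M * M))" using E_cp by (auto simp: completely_positive_def)
  then obtain N where N: "N \<in> carrier_mat k k" "map_mat E (madj M * M) = madj N * N"
    by (auto simp: mpos_def)
  have "Ef (tofm k (madj M * M)) = tofm k (madj N * N)" by (simp add: tofm_E[OF MM, symmetric] N)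
  moreover have "tofm k M = W" by (simp add: M_def tofm_ofm[OF assms])
  ultimately have "Ef (adj W * W) = adj (tofm k N) * tofm k N"
    using M N(1) by (simp add: tofm_times madj_carrier tofm_madj)
  then show ?thesis by (rule that[OF corner_tofm])
qed

text \<open>Complete positivity applied to the row \<open>[X Z]\<close>, realised inside a corner of twice the size.\<close>

lemma Ef_gram:
  assumes c: "corner n X" "corner n Z"
  obtains P Q where "Ef (adj X * X) = adj P * P" "Ef (adj X * Z) = adj P * Q"
    "Ef (adj Z * X) = adj Q * P" "Ef (adj Z * Z) = adj Q * Q"
proof -
  define s e where "s = (shf n :: 'a fmat)" and "e = (dg n 1 :: 'a fmat)"
  have s: "ovr (2 * n) B s" "ovr (2 * n) B (adj s)"
    using calg_B by (auto simp: s_def ovr_def corner_shf corner_adj ent_shf calgD)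
  have ss: "adj s * s = e" by (simp add: s_def e_def adj_shf_shf)
  have es: "e * s = 0" "adj s * e = 0" using times_shf[of n e] by (auto simp: s_def e_def)
  have ee: "ovr n B e" "adj e = e" unfolding e_def by (auto intro: ovr_one calg_B simp: adj_dg)
  define W where "W = X + Z * adj s"
  have cW: "corner (2 * n) W"
    unfolding W_def by (intro corner_plus corner_times ovr_corner[OF s(2)] corner_mono[of n _ "2 * n"] c) auto
  obtain V where V: "Ef (adj W * W) = adj V * V" using Ef_square[OF cW] by metis
  define K where "K = adj V * V"
  have WW: "adj W * W = adj X * X + (adj X * Z) * adj s + s * (adj Z * X) + s * (adj Z * Z) * adj s"
    by (simp add: W_def adj_simps algebra_simps)
  have K: "K = Ef (adj X * X) + Ef (adj X * Z) * adj s + s * Ef (adj Z * X) + s * Ef (adj Z * Z) * adj s"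
    unfolding K_def V[symmetric] WW Ef_plus Ef_left[OF s(1)] Ef_right[OF s(2)] ..
  have ce: "Y * e = Y" "e * Y = Y" if "corner n Y" for Y
    using that by (auto simp: e_def dg_one_left dg_one_right)
  have cc: "corner n (Ef (adj X * X))" "corner n (Ef (adj X * Z))" "corner n (Ef (adj Z * X))" "corner n (Ef (adj Z * Z))"
    using c by (auto intro!: corner_Ef corner_times corner_adj)
  have sY: "adj s * Y = 0" "Y * s = 0" if "corner n Y" for Y
    using times_shf[OF that] by (auto simp: s_def)
  have esY: "e * (s * Y) = 0" "adj s * (s * Y) = e * Y" "e * (e * Y) = e * Y" for Y
    by (simp_all add: mult.assoc[symmetric] es ss) (simp add: e_def dg_times)
  \<comment> \<open>Cutting by \<open>e\<close> and \<open>s\<close> reads off the four blocks of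
    \<open>K\<close>; the same cuts applied to \<open>V\<close> are the factors \<open>P\<close> and
    \<open>Q\<close>.\<close>
  have Kp: "e * K * e = Ef (adj X * X)" "e * K * s = Ef (adj X * Z)" "adj s * K * e = Ef (adj Z * X)"
     "adj s * K * s = Ef (adj Z * Z)"
    by (simp_all add: K distrib_left distrib_right mult.assoc es ss ce cc sY esY)
  show ?thesis
  proof (rule that[of "V * e" "V * s"])
    show "Ef (adj X * X) = adj (V * e) * (V * e)" "Ef (adj X * Z) = adj (V * e) * (V * s)"
      "Ef (adj Z * X) = adj (V * s) * (V * e)" "Ef (adj Z * Z) = adj (V * s) * (V * s)"
      unfolding Kp[symmetric] by (simp_all add: K_def adj_simps ee mult.assoc)
  qed
qed

lemma psd_Ef: "psd X \<Longrightarrow> psd (Ef X)"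
proof -
  assume "psd X"
  then obtain W where W: "X = adj W * W" by (auto simp: psd_def)
  obtain V where "Ef (adj W * W) = adj V * V" using Ef_square[OF corner_fdim] by metis
  then show "psd (Ef X)" unfolding W by (simp add: psd_square)
qed

text \<open>Compatibility with the involution is read off the two off-diagonal blocks of the Gram
  matrix of the unit and \<open>X\<close>, which are adjoint to each other.\<close>

lemma Ef_adj: "Ef (adj X) = adj (Ef X)"
proof -
  obtain n where n: "corner n X" using corner_fdim by blast
  obtain P Q where "Ef (adj (dg n 1) * X) = adj P * Q" "Ef (adj X * dg n 1) = adj Q * P"
    using Ef_gram[OF corner_dg n] by metis
  then show ?thesis
    by (simp add: adj_dg dg_one_left[OF n] dg_one_right[OF corner_adj[OF n]] adj_simps)
qed

text \<open>The Gram factors reduce this to submultiplicativity of the norm, since the diagonal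
  blocks have norms \<open>(norm P)^2\<close> and \<open>(norm Q)^2\<close>.\<close>

lemma Ef_CS: "(norm (Ef (adj X * Y)))\<^sup>2 \<le> norm (Ef (adj X * X)) * norm (Ef (adj Y * Y))"
proof -
  obtain n where n: "corner n X" "corner n Y" by (rule common_corner)
  obtain P Q where PQ: "Ef (adj X * X) = adj P * P" "Ef (adj X * Y) = adj P * Q" "Ef (adj Y * Y) = adj Q * Q"
    using Ef_gram[OF n] by metis
  have "(norm (adj P * Q))\<^sup>2 \<le> (norm P * norm Q)\<^sup>2"
    using norm_mult_ineq[of "adj P" Q] by (intro power_mono) auto
  then show ?thesis by (simp add: PQ norm_adj_times power_mult_distrib)
qed

lemma psd_ent: "psd X \<Longrightarrow> pos (ent X i i)"
  unfolding psd_def by (auto simp: ent_times'[OF corner_fdim] intro!: pos_sum pos_cstar_mult)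

lemma pos_E: "pos p \<Longrightarrow> pos (E p)"
proof -
  assume "pos p"
  then obtain s where s: "cstar s = s" "s * s = p" by (auto simp: pos_def)
  have "psd (Ef (adj (dg 1 s) * dg 1 s))" by (intro psd_Ef psd_square)
  then have "pos (ent (Ef (adj (dg 1 s) * dg 1 s)) 0 0)" by (rule psd_ent)
  then show ?thesis by (simp add: adj_dg dg_times ent_dg s)
qed

lemma norm_dg_1: "norm (dg 1 a) = norm a"
  using norm_dg_le[of 1 a] norm_ent_le[of "dg 1 a" 0 0] by (simp add: ent_dg)

text \<open>For positive elements this follows by applying \<open>E\<close> to
  \<open>norm p - p\<close>; the general case is Cauchy--Schwarz against the unit.\<close>

lemma norm_E_le: "norm (E a) \<le> norm a"
proof -
  have p: "norm (E p) \<le> norm p" if "pos p" for p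
  proof (rule pos_norm_leI)
    have "pos (E (norm p *\<^sub>R 1 - p))" by (intro pos_E pos_le_norm that) simp
    then show "pos (norm p *\<^sub>R 1 - E p)" using calg_B by (simp add: E_minus E_scaleR E_id calgD)
  qed (use that pos_E in auto)
  have "(norm (Ef (adj (dg 1 1) * dg 1 a)))\<^sup>2 \<le> norm (Ef (adj (dg 1 1) * dg 1 1)) * norm (Ef (adj (dg 1 a) * dg 1 a))"
    by (rule Ef_CS)
  then have "(norm (E a))\<^sup>2 \<le> norm (E (cstar a * a))"
    using calg_B by (simp add: adj_dg dg_times Ef_dg norm_dg_1[simplified] E_id calgD)
  also have "\<dots> \<le> (norm a)\<^sup>2" using p[OF pos_cstar_mult, of a] by (simp add: cstar_identity)
  finally show ?thesis by (rule power2_le_imp_le) simp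
qed

lemma bounded_linear_E: "bounded_linear E"
  by (rule bounded_linear_intro[of _ 1]) (auto simp: E_add E_scaleR norm_E_le)

text \<open>With \<open>K\<close> the norm of the map \<open>h \<mapsto> E[x\<^sup>* h x]\<close> and \<open>N = \<parallel>E[x\<^sup>* x]\<parallel>\<close>, Cauchy--Schwarz gives
  \<open>K\<^sup>2 \<le> N K\<close>.\<close>

lemma norm_Ef_conj_le:
  assumes x: "corner k x" and h: "corner k h"
  shows "norm (Ef (adj x * h * x)) \<le> norm (Ef (adj x * x)) * norm h"
proof -
  let ?a = "\<lambda>h. norm (Ef (adj x * h * x))" and ?N = "norm (Ef (adj x * x))"
  define A where "A = ?a ` {h. corner k h \<and> norm h \<le> 1}"
  define K where "K = Sup A"
  have bdd: "bdd_above A" unfolding A_def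
  proof (rule bdd_aboveI2)
    fix h :: "'a fmat" assume "h \<in> {h. corner k h \<and> norm h \<le> 1}"
    then have h: "corner k h" "norm h \<le> 1" by auto
    have n: "norm (adj x * h * x) \<le> norm x * norm x"
      using norm_mult3_mono[of "adj x" "norm x" h 1 x "norm x"] h(2) by simp
    have "?a h \<le> (\<Sum>i<k. \<Sum>j<k. norm (ent (Ef (adj x * h * x)) i j))"
      by (intro norm_le_sum_ent corner_Ef corner_times corner_adj x h)
    also have "\<dots> \<le> (\<Sum>i<k. \<Sum>j<k. norm x * norm x)"
    proof (intro sum_mono)
      fix i j
      show "norm (ent (Ef (adj x * h * x)) i j) \<le> norm x * norm x"
        using norm_E_le[of "ent (adj x * h * x) i j"] norm_ent_le[of "adj x * h * x" i j] n by simp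
    qed
    finally show "?a h \<le> (\<Sum>i<k. \<Sum>j<k. norm x * norm x)" .
  qed
  have inA: "?a h \<in> A" if "corner k h" "norm h \<le> 1" for h using that by (auto simp: A_def)
  have K0: "K \<ge> 0" using cSup_upper[OF inA[of 0] bdd] by (simp add: K_def)
  have step: "?a h \<le> sqrt (?N * K)" if "corner k h" "norm h \<le> 1" for h
  proof -
    have "(?a h)\<^sup>2 \<le> ?N * norm (Ef (adj (h * x) * (h * x)))"
      using Ef_CS[of x "h * x"] by (simp add: mult.assoc)
    also have "adj (h * x) * (h * x) = adj x * (adj h * h) * x" by (simp add: adj_simps mult.assoc)
    also have "norm (Ef (adj x * (adj h * h) * x)) \<le> K" unfolding K_def
    proof (rule cSup_upper[OF inA bdd])
      show "norm (adj h * h) \<le> 1" using that by (simp add: norm_adj_times power_le_one)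
    qed (intro corner_times corner_adj that)
    finally have "(?a h)\<^sup>2 \<le> ?N * K" by (simp add: mult_left_mono)
    then show ?thesis by (rule real_le_rsqrt)
  qed
  have "A \<noteq> {}" using inA[of 0] by auto
  then have "K \<le> sqrt (?N * K)" unfolding K_def[symmetric]
    by (subst K_def, intro cSup_least) (auto simp: A_def intro: step)
  then have "K\<^sup>2 \<le> ?N * K" using K0 by (metis real_sqrt_le_iff real_sqrt_abs abs_of_nonneg)
  then have "K * K \<le> ?N * K" by (simp add: power2_eq_square)
  then have KN: "K \<le> ?N" using K0 mult_right_le_imp_le[of K K ?N] by (cases "K = 0") auto
  show ?thesis
  proof (cases "norm h = 0")
    case False
    then have p: "norm h > 0" by simp
    have "?a ((1 / norm h) *\<^sub>R h) \<le> ?N"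
      using cSup_upper[OF inA[of "(1 / norm h) *\<^sub>R h"] bdd] KN p h by (simp add: K_def corner_scaleR)
    then show ?thesis using p by (simp add: Ef_scaleR field_simps)
  qed simp
qed

lemma norm_Ef_le: "corner k h \<Longrightarrow> norm (Ef h) \<le> norm h"
proof -
  assume h: "corner k h"
  have "norm (Ef (adj (dg k 1) * h * dg k 1)) \<le> norm (Ef (adj (dg k 1) * dg k 1)) * norm h"
    by (rule norm_Ef_conj_le[OF corner_dg h])
  then have "norm (Ef h) \<le> norm (dg k (1::'a)) * norm h"
    using calg_B by (simp add: adj_dg dg_times Ef_dg E_id calgD dg_one_left[OF h] dg_one_right[OF h])
  also have "\<dots> \<le> 1 * norm h" using norm_one_corner by (intro mult_right_mono) auto
  finally show ?thesis by simp
qed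

end

section \<open>Cauchy transforms on a half plane\<close>

definition res :: "nat \<Rightarrow> 'a::cstar_algebra fmat \<Rightarrow> 'a fmat" where
  "res k T = (THE R. inverses k T R)"

lemma res_eq: "inverses k T R \<Longrightarrow> res k T = R"
  unfolding res_def using inverses_unique by blast

locale half_plane = opval_space +
  fixes k :: nat and Z Pi :: "'a::cstar_algebra fmat"
  assumes corner_Z: "corner k Z" and corner_Pi: "corner k Pi"
    and Z_Pi: "adj Z * Z * Pi = dg k 1" and Pi_Z: "Pi * (adj Z * Z) = dg k 1"
begin

definition "D = norm Pi"

lemma D_nonneg: "0 \<le> D" by (simp add: D_def)

text \<open>On the corner \<open>Pi * adj Z\<close> is a left inverse of \<open>Z\<close>; its norm,
  the square root of \<open>D\<close>, gives the constant in \<open>lowbd_Z\<close>.\<close>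

lemma norm_Pi_Z: "(norm (Pi * adj Z))\<^sup>2 = D"
proof -
  have "(Pi * adj Z) * adj (Pi * adj Z) = Pi * (adj Z * Z) * adj Pi" by (simp add: adj_simps mult.assoc)
  also have "\<dots> = adj Pi" by (simp add: Pi_Z dg_one_left corner_adj corner_Pi)
  finally show ?thesis using norm_times_adj[of "Pi * adj Z"] by (simp add: D_def)
qed

lemma lowbd_Z: "lowbd k Z D"
  unfolding lowbd_def
proof (intro conjI allI impI D_nonneg)
  fix x :: "'a fmat" assume "corner k x"
  then have "x = (Pi * adj Z) * (Z * x)" using Pi_Z by (metis dg_one_left mult.assoc)
  then have "norm x \<le> norm (Pi * adj Z) * norm (Z * x)" using norm_mult_ineq by metis
  then have "(norm x)\<^sup>2 \<le> (norm (Pi * adj Z) * norm (Z * x))\<^sup>2" by (rule power_mono) simp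
  then show "(norm x)\<^sup>2 \<le> D * (norm (Z * x))\<^sup>2" by (simp add: power_mult_distrib norm_Pi_Z)
qed

text \<open>\<open>up w\<close> says \<open>Im w \<ge> Z\<^sup>* Z\<close>, a half plane that the reciprocal Cauchy transforms preserve; \<open>rs\<close>, \<open>gs\<close>
  and \<open>fs\<close> are the resolvent \<open>(w - x)\<^sup>-\<^sup>1\<close>, the Cauchy transform \<open>G\<close> and its reciprocal \<open>F = G\<^sup>-\<^sup>1\<close>.\<close>

definition up :: "'a fmat \<Rightarrow> bool" where
  "up w \<longleftrightarrow> ovr k B w \<and> psd (imp k w - adj Z * Z)"

definition rs :: "'a \<Rightarrow> 'a fmat \<Rightarrow> 'a fmat" where "rs x w = res k (w - dg k x)"
definition gs :: "'a \<Rightarrow> 'a fmat \<Rightarrow> 'a fmat" where "gs x w = Ef (rs x w)"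
definition fs :: "'a \<Rightarrow> 'a fmat \<Rightarrow> 'a fmat" where "fs x w = res k (gs x w)"

lemma up_ovr: "up w \<Longrightarrow> ovr k B w" and up_corner: "up w \<Longrightarrow> corner k w"
  by (auto simp: up_def ovr_def)

lemma imp_shift: "cstar x = x \<Longrightarrow> imp k (w - dg k x) = imp k w"
  using imp_plus[of k w "- dg k x"] imp_selfadj[of "- dg k x" k] by (simp add: adj_simps adj_dg)

text \<open>Uniqueness of inverses makes the resolvent the same for every choice of
  \<open>S\<close>. The last clause thus puts its entries into any closed complex algebra containing
  \<open>B\<close> and \<open>x\<close>.\<close>

lemma up_rs:
  assumes "up w" "cstar x = x"
  shows "inverses k (w - dg k x) (rs x w)" "norm (rs x w) \<le> D"
    "calg S \<Longrightarrow> B \<subseteq> S \<Longrightarrow> x \<in> S \<Longrightarrow> ovr k S (rs x w)"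
proof -
  have *: "\<exists>R. inverses k (w - dg k x) R \<and> ovr k S R \<and> norm R \<le> D"
    if "calg S" "B \<subseteq> S" "x \<in> S" for S
  proof -
    have "ovr k S (w - dg k x)" 
      by (intro ovr_minus ovr_dg that ovr_mono[OF up_ovr[OF assms(1)]])
    moreover have "psd (imp k (w - dg k x) - adj Z * Z)" using assms by (simp add: imp_shift up_def)
    ultimately show ?thesis using resolvent_exists[OF that(1) lowbd_Z] by metis
  qed
  show "inverses k (w - dg k x) (rs x w)" "norm (rs x w) \<le> D"
    using *[OF calg_UNIV] res_eq by (auto simp: rs_def)
  show "ovr k S (rs x w)" if "calg S" "B \<subseteq> S" "x \<in> S"
    using *[OF that] res_eq by (auto simp: rs_def)
qed

lemma up_rs_corner: "up w \<Longrightarrow> cstar x = x \<Longrightarrow> corner k (rs x w)"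
  using up_rs(1) by (auto simp: inverses_def)

lemma up_rs_eqs:
  assumes "up w" "cstar x = x"
  shows "(w - dg k x) * rs x w = dg k 1" "rs x w * (w - dg k x) = dg k 1"
  using up_rs(1)[OF assms] by (auto simp: inverses_def)

lemma gs_ovr: "up w \<Longrightarrow> cstar x = x \<Longrightarrow> ovr k B (gs x w)"
  unfolding gs_def by (intro ovr_Ef up_rs_corner)

lemma gs_corner: "up w \<Longrightarrow> cstar x = x \<Longrightarrow> corner k (gs x w)"
  using gs_ovr ovr_corner by blast

lemma norm_gs_le: "up w \<Longrightarrow> cstar x = x \<Longrightarrow> norm (gs x w) \<le> D"
  unfolding gs_def using norm_Ef_le[OF up_rs_corner] up_rs(2) order_trans by blast

lemma imp_adj: "imp k (adj X) = - imp k X"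
  by (simp add: imp_def algebra_simps)

lemma Ef_imp: "Ef (imp k X) = imp k (Ef X)"
proof -
  have "ovr k B (dg k iu)" by (intro ovr_dg calg_B calgD(2))
  then show ?thesis by (simp add: imp_def Ef_simps Ef_left Ef_adj)
qed

lemma imp_inverse:
  assumes "inverses k T R" shows "imp k R = - (adj R * imp k T * R)"
proof -
  have i: "corner k T" "corner k R" "T * R = dg k 1" using assms by (auto simp: inverses_def)
  have "adj R * imp k T * R = imp k (adj R * (T * R))" using imp_conj[OF i(1,2)] by (simp add: mult.assoc)
  then show ?thesis by (simp add: i dg_one_right[OF corner_adj[OF i(2)]] imp_adj)
qed

lemma ovr_adj: "ovr k B X \<Longrightarrow> ovr k B (adj X)"
  by (auto simp: ovr_def corner_adj cstar_B)

lemma ovr_imp: "ovr k B X \<Longrightarrow> ovr k B (imp k X)"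
  unfolding imp_def by (intro ovr_intros calg_B ovr_adj calgD(2))

text \<open>With \<open>R\<close> the resolvent and \<open>M = Im w\<close>, the imaginary part of
  \<open>- g\<close> is \<open>E[adj R * M * R]\<close>, which dominates the square of
  \<open>Z * R\<close> under \<open>E\<close>; a lower bound for the latter inverts
  \<open>g\<close>. Then \<open>Im F = M + adj F * U * F\<close> with \<open>U\<close> positive
  semidefinite, so \<open>F\<close> stays in the half plane.\<close>

lemma fs_props:
  assumes w: "up w" and x: "cstar x = x"
  shows "inverses k (gs x w) (fs x w)" "up (fs x w)" "norm (fs x w) \<le> (norm (w - dg k x))\<^sup>2 * D"
proof -
  define T R g M where "T = w - dg k x" and "R = rs x w" and "g = gs x w" and "M = imp k w"
  have TR: "T * R = dg k 1" "R * T = dg k 1" "inverses k T R"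
    using up_rs_eqs[OF w x] up_rs(1)[OF w x] by (auto simp: T_def R_def)
  have c: "corner k T" "corner k R" "corner k g"
    using TR(3) gs_corner[OF w x] by (auto simp: inverses_def g_def)
  have og: "ovr k B g" using gs_ovr[OF w x] by (simp add: g_def)
  have oM: "ovr k B M" using ovr_imp[OF up_ovr[OF w]] by (simp add: M_def)
  have M: "imp k T = M" using imp_shift[OF x] by (simp add: T_def M_def)
  have pM: "psd (M - adj Z * Z)" using w by (simp add: up_def M_def)
  have pM': "psd M" using psd_add[OF pM psd_square[of Z]] by simp
  have Efg: "Ef R = g" by (simp add: g_def gs_def R_def)
  have ig: "imp k (- g) = Ef (adj R * M * R)"
    unfolding imp_uminus Efg[symmetric] Ef_imp[symmetric] imp_inverse[OF TR(3)] M by (simp add: Ef_uminus)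
  \<comment> \<open>A left inverse of \<open>Z * R\<close>. From \<open>E[L * (Z * R)] = 1\<close>
    the Gram factors satisfy \<open>adj P * Q = 1\<close>, so the norm of \<open>P\<close> bounds
    \<open>Q\<close> from below.\<close>
  define L where "L = T * (Pi * adj Z)"
  have cL: "corner k L" unfolding L_def by (intro corner_times corner_adj c corner_Pi corner_Z)
  have LV: "L * (Z * R) = dg k 1"
  proof -
    have "L * (Z * R) = T * (Pi * (adj Z * Z)) * R" by (simp add: L_def mult.assoc)
    then show ?thesis by (simp add: Pi_Z dg_one_right[OF c(1)] TR)
  qed
  obtain P Q where PQ: "Ef (adj (adj L) * adj L) = adj P * P" "Ef (adj (adj L) * (Z * R)) = adj P * Q"
    "Ef (adj (Z * R) * (Z * R)) = adj Q * Q"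
    using Ef_gram[OF corner_adj[OF cL] corner_times[OF corner_Z c(2)]] by metis
  have e: "adj P * Q = dg k 1"
    using PQ(2) calg_B by (simp add: LV Ef_dg E_id calgD)
  have "(norm P)\<^sup>2 = norm (Ef (L * adj L))" using PQ(1) norm_adj_times[of P] by simp
  also have "\<dots> \<le> (norm L)\<^sup>2"
    using norm_Ef_le[OF corner_times[OF cL corner_adj[OF cL]]] by (simp add: norm_times_adj)
  also have "\<dots> \<le> (norm T * norm (Pi * adj Z))\<^sup>2"
    unfolding L_def by (intro power_mono norm_mult_ineq norm_ge_zero)
  finally have nP: "(norm P)\<^sup>2 \<le> (norm T)\<^sup>2 * D" by (simp add: power_mult_distrib norm_Pi_Z)
  have "lowbd k Q ((norm T)\<^sup>2 * D)" unfolding lowbd_def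
  proof (intro conjI allI impI)
    fix y :: "'a fmat" assume "corner k y"
    then have "y = adj P * (Q * y)" using e by (metis dg_one_left mult.assoc)
    then have "norm y \<le> norm P * norm (Q * y)" using norm_mult_ineq[of "adj P" "Q * y"] by simp
    then have "(norm y)\<^sup>2 \<le> (norm P * norm (Q * y))\<^sup>2" by (rule power_mono) simp
    also have "\<dots> \<le> (norm T)\<^sup>2 * D * (norm (Q * y))\<^sup>2"
      unfolding power_mult_distrib by (intro mult_right_mono nP) simp
    finally show "(norm y)\<^sup>2 \<le> (norm T)\<^sup>2 * D * (norm (Q * y))\<^sup>2" .
  qed (simp add: D_nonneg)
  moreover have "psd (imp k (- g) - adj Q * Q)"
  proof -
    have "imp k (- g) - adj Q * Q = Ef (adj R * (M - adj Z * Z) * R)"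
      unfolding ig PQ(3)[symmetric] Ef_minus[symmetric] by (simp add: adj_simps algebra_simps)
    then show ?thesis using psd_Ef[OF psd_conj[OF pM]] by simp
  qed
  ultimately obtain R' where R': "inverses k (- g) R'" "ovr k B R'" "norm R' \<le> (norm T)\<^sup>2 * D"
    using resolvent_exists[OF calg_B _ ovr_uminus[OF calg_B og]] by metis
  define F where "F = - R'"
  have iF: "inverses k g F" using inverses_uminus[OF R'(1)] by (simp add: F_def)
  have fsF: "fs x w = F" using res_eq[OF iF] by (simp add: fs_def g_def)
  have oF: "ovr k B F" unfolding F_def by (intro ovr_uminus calg_B R')
  show "inverses k (gs x w) (fs x w)" using iF fsF by (simp add: g_def)
  show "norm (fs x w) \<le> (norm (w - dg k x))\<^sup>2 * D" using R'(3) by (simp add: fsF F_def T_def)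
  have gF: "g * F = dg k 1" "adj F * adj g = dg k 1" "corner k F"
    using iF inverses_adj[OF iF] by (auto simp: inverses_def)
  \<comment> \<open>A conditional variance of \<open>R\<close>, weighted by \<open>M\<close>.
    Because \<open>g\<close> and \<open>M\<close> have entries in \<open>B\<close>, the mixed terms
    all reduce to \<open>adj g * M * g\<close>.\<close>
  define U where "U = Ef (adj (R - g) * M * (R - g))"
  have U: "Ef (adj R * M * R) = adj g * M * g + U"
  proof -
    have b: "Ef (adj R * (M * g)) = adj g * (M * g)" "Ef (adj g * (M * R)) = adj g * (M * g)"
      "Ef (adj g * (M * g)) = adj g * (M * g)"
      by (simp_all add: Ef_right[OF ovr_times[OF calg_B oM og]] Ef_left[OF ovr_adj[OF og]]
           Ef_left[OF oM] Ef_adj Efg Ef_id[OF ovr_times[OF calg_B oM og]] Ef_id[OF og])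
    show ?thesis unfolding U_def
      by (simp add: adj_simps left_diff_distrib right_diff_distrib mult.assoc Ef_simps b)
  qed
  have cM: "corner k M" using oM by (rule ovr_corner)
  have "imp k F = adj F * (adj g * M * g + U) * F"
  proof -
    have "imp k g = - (adj g * M * g + U)" using ig U by (metis imp_uminus minus_minus)
    then show ?thesis unfolding imp_inverse[OF iF]
      by (simp only: mult_minus_left mult_minus_right minus_minus)
  qed
  also have "\<dots> = (adj F * adj g) * M * (g * F) + adj F * U * F"
    by (simp add: algebra_simps)
  also have "\<dots> = M + adj F * U * F"
    by (simp add: gF dg_one_left[OF cM] dg_one_right[OF cM])
  finally have eq: "imp k F - adj Z * Z = (M - adj Z * Z) + adj F * U * F" by simp
  have "psd (imp k F - adj Z * Z)" unfolding eq U_def by (intro psd_add pM psd_conj psd_Ef pM')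
  then show "up (fs x w)" using oF by (simp add: up_def fsF)
qed

text \<open>The resolvent identity, with both resolvents bounded by \<open>D\<close>.\<close>

lemma gs_diff_le:
  assumes v: "up v" "up v'" and x: "cstar x = x"
  shows "norm (gs x v - gs x v') \<le> D\<^sup>2 * norm (v - v')"
proof -
  have c: "corner k (rs x v)" "corner k (rs x v')" using v x up_rs_corner by auto
  have "rs x v * (v' - v) * rs x v' = rs x v * ((v' - dg k x) - (v - dg k x)) * rs x v'" by simp
  also have "\<dots> = rs x v * ((v' - dg k x) * rs x v') - (rs x v * (v - dg k x)) * rs x v'"
    by (simp only: left_diff_distrib right_diff_distrib mult.assoc)
  also have "\<dots> = rs x v - rs x v'"
    using v x c by (simp add: up_rs_eqs dg_one_left dg_one_right)
  finally have "gs x v - gs x v' = Ef (rs x v * (v' - v) * rs x v')" by (simp add: gs_def Ef_minus)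
  also have "norm \<dots> \<le> norm (rs x v * (v' - v) * rs x v')"
    using v by (intro norm_Ef_le[of k] corner_times corner_minus c up_corner)
  also have "\<dots> \<le> D * norm (v' - v) * D"
    using v x up_rs(2) by (intro norm_mult3_mono) auto
  finally show ?thesis by (simp add: norm_minus_commute power2_eq_square mult_ac)
qed

end

section \<open>Monotone independence and composition of reciprocal Cauchy transforms\<close>

text \<open>The algebra generated by \<open>B\<close> and the first \<open>m\<close> summands,
  arranged for induction letter by letter. Coefficients standing to the left of a letter are
  absorbed by \<open>balg\<close>, so a free one occurs only at the right end.\<close>

inductive_set walg :: "'a::cstar_algebra set \<Rightarrow> (nat \<Rightarrow> 'a) \<Rightarrow> nat \<Rightarrow> 'a set" for B y m where
  base: "b \<in> B \<Longrightarrow> b \<in> walg B y m"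
| step: "i < m \<Longrightarrow> g \<in> balg B (y i) \<Longrightarrow> T \<in> walg B y m \<Longrightarrow> g * T \<in> walg B y m"
| add: "T \<in> walg B y m \<Longrightarrow> T' \<in> walg B y m \<Longrightarrow> T + T' \<in> walg B y m"

lemma closure_binop:
  fixes f :: "'a::metric_space \<Rightarrow> 'b::metric_space \<Rightarrow> 'c::metric_space"
  assumes f: "\<And>X Y x y. X \<longlonglongrightarrow> x \<Longrightarrow> Y \<longlonglongrightarrow> y \<Longrightarrow> (\<lambda>n. f (X n) (Y n)) \<longlonglongrightarrow> f x y"
    and A: "\<And>x y. x \<in> A \<Longrightarrow> y \<in> A' \<Longrightarrow> f x y \<in> C" and xy: "x \<in> closure A" "y \<in> closure A'"
  shows "f x y \<in> closure C"
proof -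
  obtain X Y where "\<forall>n. X n \<in> A" "X \<longlonglongrightarrow> x" "\<forall>n. Y n \<in> A'" "Y \<longlonglongrightarrow> y"
    using xy by (auto simp: closure_sequential)
  then show ?thesis using f[of X x Y y] A unfolding closure_sequential
    by (intro exI[of _ "\<lambda>n. f (X n) (Y n)"]) auto
qed

lemma calg_closure:
  assumes "1 \<in> A" "iu \<in> A" "\<And>x y. x \<in> A \<Longrightarrow> y \<in> A \<Longrightarrow> x + y \<in> A"
    "\<And>x y. x \<in> A \<Longrightarrow> y \<in> A \<Longrightarrow> x * y \<in> A" "\<And>x r. x \<in> A \<Longrightarrow> r *\<^sub>R x \<in> A"
  shows "calg (closure A)"
proof -
  have "x + y \<in> closure A" "x * y \<in> closure A" if "x \<in> closure A" "y \<in> closure A" for x y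
    by (rule closure_binop[OF _ _ that]; (intro tendsto_intros assms; assumption))+
  moreover have "r *\<^sub>R x \<in> closure A" if "x \<in> closure A" for x r
    by (rule closure_binop[where f = "\<lambda>x y. r *\<^sub>R x", OF _ _ that that]) (auto intro: tendsto_intros assms)
  ultimately show ?thesis using assms(1,2) closure_subset[of A] by (auto simp: calg_def)
qed

lemma word_Cons: "bs \<noteq> [] \<Longrightarrow> word x (b # bs) = b * x * word x bs"
  by (cases bs) auto

locale mono_family = opval_space +
  fixes n :: nat and y :: "nat \<Rightarrow> 'a"
  assumes mono: "mono_indep B E n y"
begin

definition ps :: "nat \<Rightarrow> 'a" where "ps m = (\<Sum>i<m. y i)"

lemma walg_left: "b \<in> B \<Longrightarrow> T \<in> walg B y m \<Longrightarrow> b * T \<in> walg B y m"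
proof (rotate_tac, induction rule: walg.induct)
  case (base c) then show ?case using calg_B by (auto intro: walg.base calgD)
next
  case (step i g T) then show ?case using walg.step[of i m "b * g" B y T] balg.lmult by (auto simp: mult.assoc)
qed (auto simp: distrib_left intro: walg.add)

lemma walg_mult: "T \<in> walg B y m \<Longrightarrow> T' \<in> walg B y m \<Longrightarrow> T * T' \<in> walg B y m"
  by (induction rule: walg.induct) (auto simp: walg_left mult.assoc distrib_right intro: walg.intros)

lemma balg_walg: "i < m \<Longrightarrow> g \<in> balg B (y i) \<Longrightarrow> g \<in> walg B y m"
  using walg.step[of i m g B y 1] calg_B by (auto intro: walg.base calgD)

lemma walg_scaleR: "T \<in> walg B y m \<Longrightarrow> r *\<^sub>R T \<in> walg B y m"
  using walg_left[of "r *\<^sub>R 1" T m] calg_B by (simp add: calgD)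

lemma walg_sum: "(\<And>i. i \<in> A \<Longrightarrow> f i \<in> walg B y m) \<Longrightarrow> sum f A \<in> walg B y m"
  using calg_B by (induction A rule: infinite_finite_induct) (auto intro: walg.intros calgD)

lemma ps_walg: "m \<le> m' \<Longrightarrow> ps m \<in> walg B y m'"
  unfolding ps_def by (rule walg_sum, rule balg_walg[OF _ balg.gen]) auto

lemma calg_walg: "calg (closure (walg B y m))"
  using calg_B by (intro calg_closure walg.add walg_mult walg_scaleR) (auto intro: walg.base calgD)

definition valid :: "nat \<Rightarrow> (nat \<times> 'a) list \<Rightarrow> bool" where
  "valid m us \<longleftrightarrow> (\<forall>(i, a) \<in> set us. i < m \<and> a \<in> balg B (y i))"

abbreviation "pr us \<equiv> prod_list (map snd us)"

text \<open>This recasts the index functions of \<open>mono_indep\<close> as lists of letters. All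
  indices in \<open>us\<close> lie below \<open>m\<close>, but in \<open>vs\<close> only the first
  has to: \<open>m\<close> may recur further right.\<close>

lemma peak:
  assumes m: "m < n" and us: "valid m us" and a: "a \<in> balg B (y m)" and vs: "valid (Suc m) vs"
    and hd: "vs = [] \<or> fst (hd vs) < m"
  shows "E (pr us * a * pr vs) = E (pr us * E a * pr vs)"
proof -
  define L where "L = us @ (m, a) # vs"
  define j where "j = length us"
  have jL: "j < length L" "L ! j = (m, a)" by (simp_all add: L_def j_def)
  have val: "fst (L ! l) < n \<and> snd (L ! l) \<in> balg B (y (fst (L ! l)))" if "l < length L" for l
  proof -
    have "\<forall>q\<in>set L. fst q < n \<and> snd q \<in> balg B (y (fst q))"
      using us vs a m by (auto simp: L_def valid_def)
    then show ?thesis using that by simp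
  qed
  have lo: "fst (L ! (j - 1)) < fst (L ! j)" if "0 < j"
  proof -
    have "L ! (j - 1) \<in> set us" using that by (simp add: L_def j_def nth_append)
    then show ?thesis using us jL by (auto simp: valid_def)
  qed
  have hi: "fst (L ! (j + 1)) < fst (L ! j)" if "j + 1 < length L"
  proof -
    have "vs \<noteq> []" using that by (auto simp: L_def j_def)
    then show ?thesis using hd jL by (cases vs) (auto simp: L_def j_def nth_append)
  qed
  have eq: "E (prod_list (map (\<lambda>l. snd (L ! l)) [0..<length L])) =
    E (prod_list (map ((\<lambda>l. snd (L ! l))(j := E (snd (L ! j)))) [0..<length L]))"
    using mono[unfolded mono_indep_def, rule_format, of "length L" "\<lambda>l. fst (L ! l)" "\<lambda>l. snd (L ! l)" j]
      val lo hi jL(1) by simp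
  have 1: "map (\<lambda>l. snd (L ! l)) [0..<length L] = map snd L"
    by (rule nth_equalityI) auto
  have 2: "map ((\<lambda>l. snd (L ! l))(j := E (snd (L ! j)))) [0..<length L] = map snd (us @ (m, E a) # vs)"
    by (rule nth_equalityI) (auto simp: L_def j_def nth_append nth_Cons' simp del: upt_Suc)
  show ?thesis using eq unfolding 1 2 by (simp add: L_def mult.assoc)
qed

text \<open>Induction on \<open>T\<close> moves its letters into \<open>vs\<close>; the coefficient
  at the end leaves the expectation by \<open>E_right\<close>.\<close>

lemma peak_tail:
  assumes m: "m < n" and us: "valid m us" and a: "a \<in> balg B (y m)"
    and T: "T \<in> walg B y (Suc m)"
  shows "valid (Suc m) vs \<Longrightarrow> vs \<noteq> [] \<Longrightarrow> fst (hd vs) < m \<Longrightarrow>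
     E (pr us * a * (pr vs * T)) = E (pr us * E a * (pr vs * T))"
  using T
proof (induction arbitrary: vs rule: walg.induct)
  case (base b)
  have "E (pr us * c * (pr vs * b)) = E (pr us * c * pr vs) * b" for c
    using E_right[OF base(1), of "pr us * c * pr vs"] by (simp add: mult.assoc)
  then show ?case using peak[OF m us a base(2)] base by simp
next
  case (step i g T)
  have "valid (Suc m) (vs @ [(i, g)])" using step by (auto simp: valid_def)
  then show ?case using step.IH[of "vs @ [(i, g)]"] step.prems by (simp add: mult.assoc)
next
  case (add T T')
  then show ?case by (simp add: distrib_left E_add)
qed

text \<open>The factor \<open>ps m\<close> in front of \<open>T\<close> ensures that the right
  neighbour of \<open>a\<close> has an index below \<open>m\<close>. Induction moves the letters of
  \<open>p\<close> into \<open>us\<close>, and its last coefficient merges with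
  \<open>a\<close>.\<close>

lemma peak_inner:
  assumes m: "m < n" and T: "T \<in> walg B y (Suc m)" and p: "p \<in> walg B y m"
  shows "valid m us \<Longrightarrow> a \<in> balg B (y m) \<Longrightarrow>
     E (pr us * p * a * (ps m * T)) = E (pr us * p * E a * (ps m * T)) \<and> E (pr us * p * a) = E (pr us * p * E a)"
  using p
proof (induction arbitrary: us a rule: walg.induct)
  case (base b)
  have ba: "b * a \<in> balg B (y m)" using base by (auto intro: balg.lmult)
  have "E (pr us * (b * a) * (ps m * T)) = E (pr us * E (b * a) * (ps m * T))"
  proof -
    have "E (pr us * (b * a) * (y i * T)) = E (pr us * E (b * a) * (y i * T))" if "i < m" for i
      using peak_tail[OF m base(2) ba T, of "[(i, y i)]"] that by (simp add: valid_def balg.gen)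
    then show ?thesis by (simp add: ps_def sum_distrib_right sum_distrib_left E_sum)
  qed
  moreover have "E (pr us * (b * a)) = E (pr us * E (b * a))"
    using peak[OF m base(2) ba, of "[]"] by (simp add: valid_def)
  ultimately show ?case by (simp add: E_left[OF base(1)] mult.assoc)
next
  case (step i g p)
  have "valid m (us @ [(i, g)])" using step by (auto simp: valid_def)
  then show ?case using step.IH[of "us @ [(i, g)]"] step.prems by (simp add: mult.assoc)
next
  case (add p p')
  then show ?case by (simp add: distrib_left distrib_right E_add)
qed

text \<open>Since \<open>balg\<close> is generated without a unit, \<open>B\<close> is added to make
  room for resolvents. On \<open>B\<close> replacing \<open>a\<close> by \<open>E a\<close> changes
  nothing, so the independence relation carries over.\<close>

definition yalg :: "nat \<Rightarrow> 'a set" where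
  "yalg m = {b + a | b a. b \<in> B \<and> a \<in> balg B (y m)}"

lemma balg_0: "0 \<in> balg B z"
  using balg.scale[OF balg.gen[of z B], of 0] by simp

lemma B_yalg: "b \<in> B \<Longrightarrow> b \<in> yalg m"
  unfolding yalg_def using balg_0 by force

lemma balg_yalg: "a \<in> balg B (y m) \<Longrightarrow> a \<in> yalg m"
  unfolding yalg_def using calg_B by (force intro: calgD)

lemma calg_yalg: "calg (closure (yalg m))"
proof (rule calg_closure)
  show "1 \<in> yalg m" "iu \<in> yalg m" using calg_B by (auto intro: B_yalg calgD)
  fix x z assume "x \<in> yalg m" "z \<in> yalg m"
  then obtain b a c d where x: "x = b + a" "z = c + d" "b \<in> B" "c \<in> B" "a \<in> balg B (y m)" "d \<in> balg B (y m)"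
    by (auto simp: yalg_def)
  have "x + z = (b + c) + (a + d)" "x * z = b * c + (b * d + a * c + a * d)"
    by (simp_all add: x algebra_simps)
  moreover have "b + c \<in> B" "b * c \<in> B" using x calg_B by (auto intro: calgD)
  moreover have "a + d \<in> balg B (y m)" "b * d + a * c + a * d \<in> balg B (y m)"
    using x by (auto intro: balg.intros)
  ultimately show "x + z \<in> yalg m" "x * z \<in> yalg m" unfolding yalg_def by blast+
next
  fix x r assume "x \<in> yalg m"
  then obtain b a where x: "x = b + a" "b \<in> B" "a \<in> balg B (y m)" by (auto simp: yalg_def)
  have "r *\<^sub>R x = r *\<^sub>R b + r *\<^sub>R a" by (simp add: x scaleR_add_right)
  moreover have "r *\<^sub>R b \<in> B" "r *\<^sub>R a \<in> balg B (y m)" using x calg_B by (auto intro: calgD balg.intros)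
  ultimately show "r *\<^sub>R x \<in> yalg m" unfolding yalg_def by blast
qed

lemma cont_E: "continuous_on A f \<Longrightarrow> continuous_on A (\<lambda>x. E (f x))"
  by (rule bounded_linear.continuous_on[OF bounded_linear_E])

text \<open>One argument is closed at a time: with the other two fixed, each equation defines a
  closed set because \<open>E\<close> is continuous.\<close>

lemma mono_closure:
  assumes m: "m < n" and p: "p \<in> closure (walg B y m)" and a: "a \<in> closure (yalg m)"
    and T: "T \<in> closure (walg B y (Suc m))"
  shows "E (p * a * (ps m * T)) = E (p * E a * (ps m * T))" "E (p * a) = E (p * E a)"
proof -
  have 0: "E (p * a * (ps m * T)) = E (p * E a * (ps m * T)) \<and> E (p * a) = E (p * E a)"
    if p: "p \<in> walg B y m" and a: "a \<in> yalg m" and T: "T \<in> walg B y (Suc m)" for p a T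
  proof -
    obtain b c where "a = b + c" "b \<in> B" "c \<in> balg B (y m)" using a by (auto simp: yalg_def)
    then show ?thesis
      using peak_inner[OF m T p, of "[]" c]
      by (simp add: valid_def E_add E_id distrib_left distrib_right)
  qed
  have 1: "E (p * a * (ps m * T)) = E (p * E a * (ps m * T)) \<and> E (p * a) = E (p * E a)"
    if "p \<in> walg B y m" "a \<in> yalg m" for p a
  proof -
    have "closure (walg B y (Suc m)) \<subseteq> {T. E (p * a * (ps m * T)) = E (p * E a * (ps m * T))}"
      using 0[OF that] by (intro closure_minimal closed_Collect_eq cont_E continuous_intros) auto
    then show ?thesis using T 0[OF that, of 1] calg_B by (auto intro: walg.base calgD)
  qed
  have 2: "E (p * a * (ps m * T)) = E (p * E a * (ps m * T)) \<and> E (p * a) = E (p * E a)"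
    if "p \<in> walg B y m" for p
  proof -
    have "closure (yalg m) \<subseteq> {a. E (p * a * (ps m * T)) = E (p * E a * (ps m * T))}"
      "closure (yalg m) \<subseteq> {a. E (p * a) = E (p * E a)}"
      using 1[OF that] by (intro closure_minimal closed_Collect_eq cont_E continuous_intros; auto)+
    then show ?thesis using a by auto
  qed
  have "closure (walg B y m) \<subseteq> {p. E (p * a * (ps m * T)) = E (p * E a * (ps m * T))}"
    "closure (walg B y m) \<subseteq> {p. E (p * a) = E (p * E a)}"
    using 2 by (intro closure_minimal closed_Collect_eq cont_E continuous_intros; auto)+
  then show "E (p * a * (ps m * T)) = E (p * E a * (ps m * T))" "E (p * a) = E (p * E a)" using p by auto
qed

lemma mono_matrix:
  assumes m: "m < n" and p: "ovr k (closure (walg B y m)) p" and R: "ovr k (closure (yalg m)) R"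
    and T: "ovr k (closure (walg B y (Suc m))) T"
  shows "Ef (p * R * (dg k (ps m) * T)) = Ef (p * Ef R * (dg k (ps m) * T))" "Ef (p * R) = Ef (p * Ef R)"
proof -
  have c: "corner k p" "corner k R" "corner k T" "corner k (p * R)" "corner k (p * Ef R)"
    using p R T by (auto simp: ovr_def intro!: corner_times corner_Ef)
  show "Ef (p * R) = Ef (p * Ef R)"
    by (rule fmat_eqI)
      (simp add: ent_times[OF c(1)] E_sum mono_closure(2)[OF m ovr_ent[OF p] ovr_ent[OF R] ovr_ent[OF T]])
  show "Ef (p * R * (dg k (ps m) * T)) = Ef (p * Ef R * (dg k (ps m) * T))"
  proof (rule fmat_eqI)
    fix i j
    have "ent (p * X * (dg k (ps m) * T)) i j = (\<Sum>l<k. \<Sum>q<k. ent p i q * ent X q l * (ps m * ent T l j))"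
      if "corner k X" for X
      unfolding ent_times[OF corner_times[OF c(1) that]] ent_times[OF c(1)]
      by (simp add: ent_dg_times sum_distrib_right)
    then show "ent (Ef (p * R * (dg k (ps m) * T))) i j = ent (Ef (p * Ef R * (dg k (ps m) * T))) i j"
      using mono_closure(1)[OF m ovr_ent[OF p] ovr_ent[OF R] ovr_ent[OF T]] c corner_Ef
      by (simp add: E_sum)
  qed
qed

end

locale mono_half_plane = half_plane + mono_family +
  assumes y_selfadj: "i < n \<Longrightarrow> cstar (y i) = y i"
begin

lemma ps_selfadj: "m \<le> n \<Longrightarrow> cstar (ps m) = ps m"
  by (auto simp: ps_def cstar_sum y_selfadj)

text \<open>With \<open>R = (w - y)\<^sup>-\<^sup>1\<close> and \<open>Q = (w - x - y)\<^sup>-\<^sup>1\<close> one has \<open>Q = R + R x Q\<close>, and monotone independence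
  allows \<open>R\<close> to be replaced by \<open>E[R] = F\<^sup>-\<^sup>1\<close> to the right of any \<open>p\<close> in the closed algebra of \<open>x\<close>.
  The choice \<open>p = (F - x)\<^sup>-\<^sup>1 F\<close> isolates \<open>E[Q]\<close>.\<close>

lemma gs_compose:
  assumes w: "up w" and m: "m < n"
  shows "gs (ps (Suc m)) w = gs (ps m) (fs (y m) w)"
proof -
  have sa: "cstar (y m) = y m" "cstar (ps m) = ps m" "cstar (ps (Suc m)) = ps (Suc m)"
    using m y_selfadj ps_selfadj by auto
  define x F R Q p0 G where "x = dg k (ps m)" and "F = fs (y m) w" and "R = rs (y m) w"
    and "Q = rs (ps (Suc m)) w" and "p0 = rs (ps m) F" and "G = gs (y m) w"
  have F: "up F" "inverses k G F" using fs_props[OF w sa(1)] by (auto simp: F_def G_def)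
  have GR: "G = Ef R" by (simp add: G_def R_def gs_def)
  have oR: "ovr k (closure (yalg m)) R" unfolding R_def
    by (rule up_rs(3)[OF w sa(1) calg_yalg])
      (meson B_yalg balg_yalg balg.gen closure_subset subset_iff)+
  have oQ: "ovr k (closure (walg B y (Suc m))) Q" unfolding Q_def
    by (rule up_rs(3)[OF w sa(3) calg_walg])
      (meson walg.base ps_walg order_refl closure_subset subset_iff)+
  have op0: "ovr k (closure (walg B y m)) p0" unfolding p0_def
    by (rule up_rs(3)[OF F(1) sa(2) calg_walg])
      (meson walg.base ps_walg order_refl closure_subset subset_iff)+
  have "B \<subseteq> closure (walg B y m)" by (meson walg.base closure_subset subset_iff)
  then have oF: "ovr k (closure (walg B y m)) F" using ovr_mono[OF up_ovr[OF F(1)]] by blast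
  define p where "p = p0 * F"
  have op: "ovr k (closure (walg B y m)) p" unfolding p_def by (rule ovr_times[OF calg_walg op0 oF])
  have c: "corner k w" "corner k F" "corner k R" "corner k Q" "corner k p0" "corner k p" "corner k x"
    using up_corner[OF w] up_corner[OF F(1)] oR oQ op0 op by (auto simp: ovr_def x_def)
  have Re: "R * (w - dg k (y m)) = dg k 1" using up_rs_eqs[OF w sa(1)] by (simp add: R_def)
  have Qe: "(w - dg k (ps (Suc m))) * Q = dg k 1" using up_rs_eqs[OF w sa(3)] by (simp add: Q_def)
  have pe: "p0 * (F - x) = dg k 1" using up_rs_eqs[OF F(1) sa(2)] by (simp add: p0_def x_def)
  have FG: "F * G = dg k 1" using F(2) by (simp add: inverses_def)
  have "w - dg k (ps (Suc m)) = (w - dg k (y m)) - x" by (simp add: x_def ps_def dg_plus)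
  then have "(w - dg k (y m)) * Q - x * Q = dg k 1" using Qe by (simp only: left_diff_distrib)
  then have "(w - dg k (y m)) * Q = dg k 1 + x * Q" by (simp add: diff_eq_eq)
  then have "R * (w - dg k (y m)) * Q = R + R * (x * Q)"
    using dg_one_right[OF c(3)] by (simp add: mult.assoc distrib_left)
  then have Q: "Q = R + R * (x * Q)" using dg_one_left[OF c(4)] Re by simp
  have "Ef (p * Q) = Ef (p * R) + Ef (p * R * (x * Q))"
    by (subst Q) (simp add: distrib_left Ef_plus mult.assoc)
  also have "\<dots> = Ef (p * G) + Ef (p * G * (x * Q))"
    using mono_matrix[OF m op oR oQ] by (simp add: GR x_def)
  finally have "Ef (p * Q - p * G * (x * Q)) = Ef (p * G)" by (simp add: Ef_minus)
  moreover have "p * Q - p * G * (x * Q) = Q"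
  proof -
    have "p * Q - p * G * (x * Q) = p0 * (F * Q - (F * G) * (x * Q))"
      by (simp add: p_def mult.assoc right_diff_distrib)
    also have "\<dots> = p0 * (F - x) * Q"
      using dg_one_left[OF corner_times[OF c(7) c(4)]] by (simp add: FG mult.assoc left_diff_distrib)
    finally show ?thesis by (simp add: pe dg_one_left[OF c(4)])
  qed
  moreover have "p * G = p0" using FG dg_one_right[OF c(5)] by (simp add: p_def mult.assoc)
  ultimately show ?thesis by (simp add: gs_def Q_def p0_def F_def)
qed

end

section \<open>Fourth moments and the one-step estimate\<close>

text \<open>For \<open>X = adj W * W\<close> the norm equals that of \<open>W * adj W\<close>, which
  splits along the diagonal units \<open>u i\<close>; each piece has at most the norm of one
  diagonal entry of \<open>X\<close>.\<close>

lemma norm_psd_le_trace: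
  assumes X: "psd X" "corner k X"
  shows "norm X \<le> (\<Sum>i<k. norm (ent X i i))"
proof -
  obtain V where V: "X = adj V * V" using X by (auto simp: psd_def)
  define W where "W = V * dg k 1"
  have W: "X = adj W * W"
  proof -
    have "X = dg k 1 * X * dg k 1" by (simp add: dg_one_left dg_one_right X)
    then show ?thesis by (simp add: W_def V adj_simps adj_dg mult.assoc)
  qed
  define u where "u i = (mk k (\<lambda>a b. if a = i \<and> b = i then 1 else 0) :: 'a fmat)" for i
  have cu: "corner k (u i)" for i by (simp add: u_def corner_mk)
  have u: "adj (u i) = u i" for i by (rule fmat_eqI) (auto simp: u_def ent_mk)
  have uu: "(\<Sum>i<k. u i * u i) = dg k 1"
  proof (rule fmat_eqI)
    fix a b
    have "ent (u i * u i) a b = (if a = i then (if b = i then 1 else 0) else 0)" if "i < k" for i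
    proof -
      have "ent (u i * u i) a b = (\<Sum>l<k. if l = i then (if a = i \<and> b = i then 1 else 0) else 0)"
        unfolding ent_times[OF cu]
        using that by (intro sum.cong) (auto simp: u_def ent_mk)
      then show ?thesis using that by simp
    qed
    then show "ent (\<Sum>i<k. u i * u i) a b = ent (dg k 1) a b"
      by (simp add: ent_sum ent_dg)
  qed
  have n: "norm (W * u i * adj (W * u i)) \<le> norm (ent X i i)" if "i < k" for i
  proof -
    have "norm (W * u i * adj (W * u i)) = norm (u i * X * u i)"
      unfolding norm_times_adj norm_adj_times[symmetric] by (simp add: W adj_simps u mult.assoc)
    also have "\<dots> \<le> (\<Sum>a<k. \<Sum>b<k. norm (ent (u i * X * u i) a b))"
      by (intro norm_le_sum_ent corner_times X) (auto simp: u_def corner_mk)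
    also have "\<dots> = (\<Sum>a<k. \<Sum>b<k. if a = i then (if b = i then norm (ent X i i) else 0) else 0)"
    proof (intro sum.cong refl)
      fix a b assume ab: "a \<in> {..<k}" "b \<in> {..<k}"
      have 1: "ent (u i * X) a l = (if a = i then ent X i l else 0)" for l
      proof -
        have "ent (u i * X) a l = (\<Sum>m<k. if m = i then (if a = i then ent X i l else 0) else 0)"
          unfolding ent_times'[OF X(2)] using that ab by (intro sum.cong) (auto simp: u_def ent_mk)
        then show ?thesis using that by simp
      qed
      have "ent (u i * X * u i) a b = (\<Sum>m<k. if m = i then (if b = i then ent (u i * X) a i else 0) else 0)"
        unfolding ent_times'[OF cu]
        using that ab by (intro sum.cong) (auto simp: u_def ent_mk)
      then have "ent (u i * X * u i) a b = (if b = i then ent (u i * X) a i else 0)" using that by simp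
      then show "norm (ent (u i * X * u i) a b) = (if a = i then (if b = i then norm (ent X i i) else 0) else 0)"
        using 1[of i] by auto
    qed
    also have "\<dots> = (\<Sum>a<k. if a = i then norm (ent X i i) else 0)"
      using that by (intro sum.cong) auto
    also have "\<dots> = norm (ent X i i)" using that by simp
    finally show ?thesis .
  qed
  have "norm X = norm (W * adj W)" by (simp add: W norm_adj_times norm_times_adj)
  also have "W * adj W = (\<Sum>i<k. W * u i * adj (W * u i))"
  proof -
    have "W * adj W = W * (\<Sum>i<k. u i * u i) * adj W"
      by (simp add: uu W_def mult.assoc adj_simps adj_dg dg_times mult.assoc[symmetric, of "dg k 1"])
    then show ?thesis by (simp add: sum_distrib_left sum_distrib_right adj_simps u mult.assoc)
  qed
  also have "norm \<dots> \<le> (\<Sum>i<k. norm (W * u i * adj (W * u i)))" by (rule norm_sum)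
  also have "\<dots> \<le> (\<Sum>i<k. norm (ent X i i))" by (intro sum_mono n) simp
  finally show ?thesis .
qed

section \<open>Moments of the identically distributed summands\<close>

locale iid_family = mono_half_plane +
  assumes n_pos: "n \<ge> 1" and centered: "E (ps n) = 0"
    and iid: "i < n \<Longrightarrow> set bs \<subseteq> B \<Longrightarrow> E (word (y i) bs) = E (word (y 0) bs)"
begin

definition "Y = ps n"
definition eta :: "'a \<Rightarrow> 'a" where "eta b = E (Y * b * Y)"
definition "cov b = E (y 0 * b * y 0)"
definition "mom4 b b' = E (y 0 * b * y 0 * y 0 * b' * y 0)"
definition "S4 = Sup {norm (h4 E Y c c') | c c'. c \<in> B \<and> c' \<in> B \<and> norm c = 1 \<and> norm c' = 1}"

lemma one_B: "1 \<in> B" using calg_B by (rule calgD)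

lemma E_y: assumes i: "i < n" shows "E (y i) = 0"
proof -
  have eq: "E (y i) = E (y 0)" if "i < n" for i
    using iid[OF that, of "[1, 1]"] one_B by simp
  have "(\<Sum>i<n. E (y 0)) = real n *\<^sub>R E (y 0)" by (simp add: sum_constant_scaleR del: sum_constant)
  moreover have "E (ps n) = (\<Sum>i<n. E (y 0))" unfolding ps_def E_sum by (intro sum.cong eq) auto
  ultimately have "real n *\<^sub>R E (y 0) = 0" using centered by simp
  then show ?thesis using eq[OF i] n_pos by simp
qed

lemma E_ps: "m \<le> n \<Longrightarrow> E (ps m) = 0"
  by (simp add: ps_def E_sum E_y)

lemma E_cov: "i < n \<Longrightarrow> b \<in> B \<Longrightarrow> E (y i * b * y i) = cov b"
  using iid[of i "[1, b, 1]"] one_B by (simp add: cov_def mult.assoc)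

lemma E_mom4: "i < n \<Longrightarrow> b \<in> B \<Longrightarrow> b' \<in> B \<Longrightarrow> E (y i * b * y i * y i * b' * y i) = mom4 b b'"
  using iid[of i "[1, b, 1, b', 1]"] one_B by (simp add: mom4_def mult.assoc)

lemma mono_rules:
  assumes "m < n" "p \<in> walg B y m" "a \<in> balg B (y m)"
  shows "T \<in> walg B y (Suc m) \<Longrightarrow> E (p * a * (ps m * T)) = E (p * E a * (ps m * T))" "E (p * a) = E (p * E a)"
  using peak_inner[OF assms(1) _ assms(2), of _ "[]" a] assms(3) one_B
  by (auto simp: valid_def intro: walg.base)

text \<open>The mixed terms vanish by independence and centering, so covariances add.\<close>

lemma cov_ps: "m \<le> n \<Longrightarrow> b \<in> B \<Longrightarrow> E (ps m * b * ps m) = real m *\<^sub>R cov b"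
proof (induction m)
  case (Suc m)
  let ?x = "ps m" and ?y = "y m"
  have m: "m < n" using Suc by simp
  have w: "?x * b \<in> walg B y m" "1 \<in> walg B y m" "1 \<in> walg B y (Suc m)"
    using Suc.prems(2) one_B by (auto intro: walg_mult ps_walg walg.base)
  have g: "?y \<in> balg B ?y" "?y * b \<in> balg B ?y" using Suc.prems by (auto intro: balg.intros)
  have "E (?x * b * ?y) = 0" using mono_rules(2)[OF m w(1) g(1)] by (simp add: E_y m)
  moreover have "E (?y * b * ?x) = 0"
    using mono_rules(1)[OF m w(2) g(2) w(3)] by (simp add: E_y m E_right[OF Suc.prems(2)])
  moreover have "E (?y * b * ?y) = cov b" using E_cov m Suc.prems by simp
  ultimately show ?case using Suc
    by (simp add: ps_def[of "Suc m"] ps_def[symmetric] distrib_left distrib_right E_add scaleR_add_left)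
qed (simp add: ps_def)

lemma eta_cov: "b \<in> B \<Longrightarrow> eta b = real n *\<^sub>R cov b"
  using cov_ps[of n b] by (simp add: eta_def Y_def)

lemma cov_eta: "b \<in> B \<Longrightarrow> cov b = (1 / real n) *\<^sub>R eta b"
  using eta_cov n_pos by simp

text \<open>Passing from \<open>m\<close> to \<open>m + 1\<close>, only four new words survive: the
  pure one, the two products of adjacent pairs, and the nested pair whose inner index is the larger.
  The mirror image of the last one is zero, and this asymmetry produces the factor
  \<open>1/2\<close> in the coefficient of the nested term and in \<open>h4\<close>.\<close>

lemma mom4_ps:
  assumes b: "b \<in> B" "b' \<in> B"
  shows "m \<le> n \<Longrightarrow> E (ps m * b * ps m * ps m * b' * ps m) =
    real m *\<^sub>R mom4 b b' + (real m * (real m - 1)) *\<^sub>R (cov b * cov b') +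
    (real m * (real m - 1) / 2) *\<^sub>R cov (b * cov 1 * b')"
proof (induction m)
  case (Suc m)
  let ?x = "ps m" and ?y = "y m"
  have m: "m < n" and m': "m \<le> n" using Suc by auto
  have x: "?x \<in> walg B y m" "?x \<in> walg B y (Suc m)" by (auto intro: ps_walg)
  have yw: "?y \<in> walg B y (Suc m)" by (auto intro: balg_walg balg.gen)
  have bw: "b \<in> walg B y m'" "b' \<in> walg B y m'" "1 \<in> walg B y m'" for m' using b one_B by (auto intro: walg.base)
  note wi = walg_mult x yw bw
  have gy: "?y \<in> balg B ?y" by (rule balg.gen)
  note gi = gy balg.rmult[OF b(1)] balg.rmult[OF b(2)] balg.lmult[OF b(1)] balg.lmult[OF b(2)] balg.mult
  note R1 = mono_rules(1)[OF m] and R2 = mono_rules(2)[OF m]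
  have Ey: "E ?y = 0" "E (?y * b) = 0" "E (?y * b') = 0" using E_y[OF m] b by (simp_all add: E_right)
  have c1: "cov c \<in> B" for c by (simp add: cov_def E_in)
  have t2: "E (?x * b * ?x * ?x * b' * ?y) = 0"
    using R2[of "?x * b * ?x * ?x * b'" ?y] by (simp add: wi gi Ey)
  have t3: "E (?x * b * ?x * ?y * b' * ?x) = 0"
    using R1[of "?x * b * ?x" "?y * b'" 1] by (simp add: wi gi Ey mult.assoc)
  have t4: "E (?x * b * ?x * ?y * b' * ?y) = real m *\<^sub>R (cov b * cov b')"
    using R2[of "?x * b * ?x" "?y * b' * ?y"] cov_ps[OF m' b(1)]
    by (simp add: wi gi E_cov[OF m b(2)] E_right[OF c1] mult.assoc[symmetric])
  have t5: "E (?x * b * ?y * ?x * b' * ?x) = 0"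
    using R1[of "?x * b" "?y" "b' * ?x"] by (simp add: wi gi Ey mult.assoc)
  have t6: "E (?x * b * ?y * ?x * b' * ?y) = 0"
    using R1[of "?x * b" "?y" "b' * ?y"] by (simp add: wi gi Ey mult.assoc)
  have t7: "E (?x * b * ?y * ?y * b' * ?x) = real m *\<^sub>R cov (b * cov 1 * b')"
  proof -
    have "E (?y * ?y * b') = cov 1 * b'" using E_cov[OF m one_B] by (simp add: E_right[OF b(2)])
    then have "E (?x * b * ?y * ?y * b' * ?x) = E (?x * (b * cov 1 * b') * ?x)"
      using R1[of "?x * b" "?y * ?y * b'" 1] by (simp add: wi gi mult.assoc)
    also have "\<dots> = real m *\<^sub>R cov (b * cov 1 * b')"
      using b c1 calg_B by (intro cov_ps m') (auto intro: calgD)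
    finally show ?thesis .
  qed
  have t8: "E (?x * b * ?y * ?y * b' * ?y) = 0"
  proof -
    have "E (?x * (b * E (?y * ?y * b' * ?y))) = 0"
      using E_ps[OF m'] calg_B b E_in by (subst E_right) (auto intro: calgD)
    then show ?thesis using R2[of "?x * b" "?y * ?y * b' * ?y"] by (simp add: wi gi mult.assoc)
  qed
  have t9: "E (?y * b * ?x * ?x * b' * ?x) = 0"
    using R1[of 1 "?y * b" "?x * b' * ?x"] by (simp add: wi gi Ey mult.assoc)
  have t10: "E (?y * b * ?x * ?x * b' * ?y) = 0"
    using R1[of 1 "?y * b" "?x * b' * ?y"] by (simp add: wi gi Ey mult.assoc)
  have t11: "E (?y * b * ?x * ?y * b' * ?x) = 0"
    using R1[of 1 "?y * b" "?y * b' * ?x"] by (simp add: wi gi Ey mult.assoc)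
  have t12: "E (?y * b * ?x * ?y * b' * ?y) = 0"
    using R1[of 1 "?y * b" "?y * b' * ?y"] by (simp add: wi gi Ey mult.assoc)
  have t13: "E (?y * b * ?y * ?x * b' * ?x) = real m *\<^sub>R (cov b * cov b')"
    using R1[of 1 "?y * b * ?y" "b' * ?x"] cov_ps[OF m' b(2)]
    by (simp add: wi gi E_cov[OF m b(1), unfolded mult.assoc] mult.assoc E_left[OF c1])
  have t14: "E (?y * b * ?y * ?x * b' * ?y) = 0"
    using R1[of 1 "?y * b * ?y" "b' * ?y"] R2[of "?x * b'" ?y]
    by (simp add: wi gi Ey E_cov[OF m b(1), unfolded mult.assoc] mult.assoc E_left[OF c1])
  have t15: "E (?y * b * ?y * ?y * b' * ?x) = 0"
    using R1[of 1 "?y * b * ?y * ?y * b'" 1] by (simp add: wi gi E_left[OF E_in] E_ps[OF m'] mult.assoc)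
  have t16: "E (?y * b * ?y * ?y * b' * ?y) = mom4 b b'" by (rule E_mom4[OF m b])
  have ps: "ps (Suc m) = ?x + ?y" by (simp add: ps_def)
  have "E (ps (Suc m) * b * ps (Suc m) * ps (Suc m) * b' * ps (Suc m)) =
    E (?x * b * ?x * ?x * b' * ?x) + mom4 b b' + (2 * real m) *\<^sub>R (cov b * cov b') + real m *\<^sub>R cov (b * cov 1 * b')"
    unfolding ps distrib_left distrib_right E_add t2 t3 t4 t5 t6 t7 t8 t9 t10 t11 t12 t13 t14 t15 t16
    by (simp add: scaleR_2[symmetric] algebra_simps)
  moreover have "real (Suc m) * (real (Suc m) - 1) = real m * (real m - 1) + 2 * real m"
    "real (Suc m) * (real (Suc m) - 1) / 2 = real m * (real m - 1) / 2 + real m" "real (Suc m) = real m + 1"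
    by (simp_all add: field_simps)
  ultimately show ?case unfolding Suc.IH[OF m'] by (simp only: scaleR_add_left scaleR_one add_ac)
qed (simp add: ps_def)

lemma eta_in: "eta b \<in> B" by (simp add: eta_def E_in)

lemma norm_eta_le: "norm (eta b) \<le> norm Y * norm b * norm Y"
  unfolding eta_def by (rule order_trans[OF norm_E_le norm_mult3_le])

lemma h4_eta: "h4 E Y b b' = E (Y * b * Y * Y * b' * Y) - eta b * eta b' - (1 / 2) *\<^sub>R eta (b * eta 1 * b')"
  by (simp add: h4_def eta_def mult.assoc)

text \<open>The previous formula at \<open>m = n\<close>, solved for \<open>mom4\<close>. In terms
  of \<open>eta\<close> its two quadratic coefficients become \<open>1 - 1/n\<close> and half of
  that, so subtracting the limits leaves \<open>h4\<close> and an explicit remainder of order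
  \<open>1/n\<close>.\<close>

lemma mom4_h4:
  assumes b: "b \<in> B" "b' \<in> B"
  shows "real n *\<^sub>R mom4 b b' = h4 E Y b b' + (1 / real n) *\<^sub>R (eta b * eta b' + (1 / 2) *\<^sub>R eta (b * eta 1 * b'))"
proof -
  have n: "real n \<noteq> 0" using n_pos by simp
  have B: "b * eta 1 * b' \<in> B" using calg_B b eta_in by (auto intro: calgD)
  have "cov (b * cov 1 * b') = (1 / real n) *\<^sub>R cov (b * eta 1 * b')"
    using one_B by (simp add: cov_eta[of 1]) (simp add: cov_def E_scaleR)
  then have c: "cov (b * cov 1 * b') = (1 / (real n * real n)) *\<^sub>R eta (b * eta 1 * b')"
    using B by (simp add: cov_eta)
  have "E (Y * b * Y * Y * b' * Y) = real n *\<^sub>R mom4 b b' + ((real n - 1) / real n) *\<^sub>R (eta b * eta b')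
     + ((real n - 1) / (2 * real n)) *\<^sub>R eta (b * eta 1 * b')"
    unfolding Y_def mom4_ps[OF b order_refl] c unfolding cov_eta[OF b(1)] cov_eta[OF b(2)] using n
    by (simp add: Y_def[symmetric])
  then have "h4 E Y b b' = real n *\<^sub>R mom4 b b' + ((real n - 1) / real n - 1) *\<^sub>R (eta b * eta b')
     + ((real n - 1) / (2 * real n) - 1 / 2) *\<^sub>R eta (b * eta 1 * b')"
    unfolding h4_eta by (simp add: algebra_simps)
  moreover have "(real n - 1) / real n - 1 = - (1 / real n)" "(real n - 1) / (2 * real n) - 1 / 2 = - (1 / real n) * (1 / 2)"
    using n by (simp_all add: field_simps)
  ultimately show ?thesis by (simp add: scaleR_add_right)
qed

lemma norm_eta_terms:
  assumes "norm b \<le> 1" "norm b' \<le> 1"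
  shows "norm (eta b * eta b' + (1 / 2) *\<^sub>R eta (b * eta 1 * b')) \<le> 2 * norm Y ^ 4"
proof -
  have e: "norm (eta c) \<le> (norm Y)\<^sup>2 * norm c" for c
    using norm_eta_le[of c] by (simp add: power2_eq_square mult_ac)
  have e1: "norm (eta c) \<le> (norm Y)\<^sup>2" if "norm c \<le> 1" for c
    using e[of c] mult_left_le[of "norm c" "(norm Y)\<^sup>2"] that by simp
  have "norm (eta b * eta b') \<le> (norm Y)\<^sup>2 * (norm Y)\<^sup>2"
    using norm_mult_ineq[of "eta b" "eta b'"] mult_mono[OF e1[OF assms(1)] e1[OF assms(2)]] by simp
  moreover have "norm (eta (b * eta 1 * b')) \<le> (norm Y)\<^sup>2 * (norm Y)\<^sup>2"
  proof -
    have "norm b * norm (eta 1) \<le> 1 * (norm Y)\<^sup>2" using e1[of 1] assms by (intro mult_mono) auto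
    then have 1: "norm (b * eta 1) \<le> (norm Y)\<^sup>2" using norm_mult_ineq[of b "eta 1"] by simp
    then have "norm (b * eta 1) * norm b' \<le> (norm Y)\<^sup>2 * 1" using assms by (intro mult_mono) auto
    then have "norm (b * eta 1 * b') \<le> (norm Y)\<^sup>2" using norm_mult_ineq[of "b * eta 1" b'] by simp
    then show ?thesis using e[of "b * eta 1 * b'"] mult_left_mono[of "norm (b * eta 1 * b')" "(norm Y)\<^sup>2" "(norm Y)\<^sup>2"] by simp
  qed
  moreover have "(norm Y)\<^sup>2 * (norm Y)\<^sup>2 = norm Y ^ 4" by (simp add: power2_eq_square power4_eq_xxxx)
  ultimately show ?thesis
    using norm_triangle_ineq[of "eta b * eta b'" "(1 / 2) *\<^sub>R eta (b * eta 1 * b')"]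
      norm_ge_zero[of "eta (b * eta 1 * b')"] unfolding norm_scaleR by linarith
qed

lemma S4_bdd: "bdd_above {norm (h4 E Y c c') | c c'. c \<in> B \<and> c' \<in> B \<and> norm c = 1 \<and> norm c' = 1}"
proof (rule bdd_aboveI, safe)
  fix c c' assume c: "c \<in> B" "c' \<in> B" "norm c = 1" "norm c' = 1"
  have "norm (E (Y * c * Y * Y * c' * Y)) \<le> norm Y * norm c * norm Y * norm Y * norm c' * norm Y"
    by (rule order_trans[OF norm_E_le]) (meson norm_mult_ineq mult_right_mono norm_ge_zero order_trans)
  then have 1: "norm (E (Y * c * Y * Y * c' * Y)) \<le> norm Y ^ 4" using c by (simp add: power4_eq_xxxx)
  have "h4 E Y c c' = E (Y * c * Y * Y * c' * Y) - (eta c * eta c' + (1 / 2) *\<^sub>R eta (c * eta 1 * c'))"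
    by (simp add: h4_eta)
  then have "norm (h4 E Y c c') \<le> norm (E (Y * c * Y * Y * c' * Y)) + norm (eta c * eta c' + (1 / 2) *\<^sub>R eta (c * eta 1 * c'))"
    using norm_triangle_ineq4 by metis
  then show "norm (h4 E Y c c') \<le> 3 * norm Y ^ 4" using 1 norm_eta_terms[of c c'] c by simp
qed

lemma h4_le_S4: "c \<in> B \<Longrightarrow> c' \<in> B \<Longrightarrow> norm c = 1 \<Longrightarrow> norm c' = 1 \<Longrightarrow> norm (h4 E Y c c') \<le> S4"
  unfolding S4_def by (rule cSup_upper[OF _ S4_bdd]) auto

lemma S4_nonneg: "0 \<le> S4"
  using order_trans[OF norm_ge_zero h4_le_S4[OF one_B one_B]] by simp

definition "nu = S4 + 2 * norm Y ^ 4 / real n"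

lemma nu_nonneg: "0 \<le> nu" using S4_nonneg by (simp add: nu_def)

lemma norm_mom4_le:
  assumes "b \<in> B" "b' \<in> B"
  shows "real n * norm (mom4 b b') \<le> nu * norm b * norm b'"
proof (cases "b = 0 \<or> b' = 0")
  case True then show ?thesis by (auto simp: mom4_def)
next
  case False
  define c c' where "c = (1 / norm b) *\<^sub>R b" and "c' = (1 / norm b') *\<^sub>R b'"
  have c: "c \<in> B" "c' \<in> B" "norm c = 1" "norm c' = 1"
    using assms calg_B False by (auto simp: c_def c'_def calgD)
  have "norm (real n *\<^sub>R mom4 c c') \<le> norm (h4 E Y c c') + (1 / real n) * (2 * norm Y ^ 4)"
    unfolding mom4_h4[OF c(1,2)] using c norm_eta_terms[of c c']
    by (intro norm_triangle_le add_left_mono) (simp add: divide_right_mono)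
  also have "\<dots> \<le> nu" using h4_le_S4[OF c] by (simp add: nu_def)
  finally have "real n * norm (mom4 c c') \<le> nu" by simp
  moreover have "mom4 c c' = (1 / (norm b * norm b')) *\<^sub>R mom4 b b'"
    by (simp add: mom4_def c_def c'_def E_scaleR mult.commute)
  ultimately show ?thesis using False by (simp add: field_simps)
qed

definition etaf :: "'a fmat \<Rightarrow> 'a fmat" where "etaf c = Ef (dg k Y * c * dg k Y)"

lemma ent_conj_dg: "corner k c \<Longrightarrow> ent (dg k a * c * dg k d) i j = (if i < k \<and> j < k then a * ent c i j * d else 0)"
  by (simp add: ent_dg_times ent_times_dg)

lemma Ef_cov: "ovr k B c \<Longrightarrow> i < n \<Longrightarrow> Ef (dg k (y i) * c * dg k (y i)) = (1 / real n) *\<^sub>R etaf c"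
proof (rule fmat_eqI)
  fix a b assume c: "ovr k B c" and i: "i < n"
  have "cov (ent c a b) = (1 / real n) *\<^sub>R eta (ent c a b)" by (rule cov_eta[OF ovr_ent[OF c]])
  then show "ent (Ef (dg k (y i) * c * dg k (y i))) a b = ent ((1 / real n) *\<^sub>R etaf c) a b"
    using c by (auto simp: etaf_def ent_conj_dg ovr_corner E_cov[OF i] ovr_ent eta_def)
qed

lemma norm_Ef_conj_y:
  assumes "corner k h" "i < n"
  shows "norm (Ef (dg k (y i) * h * dg k (y i))) \<le> norm (eta 1) / real n * norm h"
proof -
  have a: "adj (dg k (y i)) = dg k (y i)" using y_selfadj[OF assms(2)] by (simp add: adj_dg)
  have "E (y i * y i) = (1 / real n) *\<^sub>R eta 1" using E_cov[OF assms(2) one_B] cov_eta[OF one_B] by simp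
  then have "norm (Ef (adj (dg k (y i)) * dg k (y i))) \<le> norm (eta 1) / real n"
    using norm_dg_le[of k "(1 / real n) *\<^sub>R eta 1"] by (simp add: a dg_times Ef_dg)
  then have "norm (Ef (adj (dg k (y i)) * dg k (y i))) * norm h \<le> norm (eta 1) / real n * norm h"
    by (rule mult_right_mono) simp
  then show ?thesis using norm_Ef_conj_le[OF corner_dg[of k "y i"] assms(1)] unfolding a by simp
qed

text \<open>This is \<open>n\<close> times the bound for the third-order term of one summand. Since
  \<open>nu\<close> tends to \<open>S4\<close> as \<open>n\<close> grows, \<open>D^2 * rho0\<close>
  tends to the right-hand side of the theorem.\<close>

definition "rho0 = real k * D\<^sup>2 * sqrt nu * sqrt (norm (eta 1))"

lemma rho0_nonneg: "0 \<le> rho0" using nu_nonneg by (simp add: rho0_def)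

definition rho :: "nat \<Rightarrow> 'a fmat \<Rightarrow> 'a fmat" where
  "rho i w = Ef (dg k (y i) * rs 0 w * dg k (y i) * rs (y i) w * dg k (y i))"

text \<open>As \<open>E[adj X * (R * y')]\<close>, the term splits by Cauchy--Schwarz: the factor of
  \<open>R * y'\<close> carries the variance, the factor of \<open>X\<close> the fourth moments. The
  latter are values of \<open>mom4\<close>, because the entries of \<open>c\<close> lie in
  \<open>B\<close>.\<close>

lemma norm_rho_le:
  assumes w: "up w" and i: "i < n" shows "norm (rho i w) \<le> rho0 / real n"
proof -
  define c R y' X where "c = rs 0 w" and "R = rs (y i) w" and "y' = dg k (y i)" and "X = y' * adj c * y'"
  have sa: "cstar (y i) = y i" "cstar (0::'a) = 0" using y_selfadj i by auto
  have ay: "adj y' = y'" by (simp add: y'_def adj_dg sa)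
  have np: "real n > 0" using n_pos by simp
  have oc: "ovr k B c" unfolding c_def using calg_B by (intro up_rs(3)[OF w sa(2) calg_B]) (auto intro: calgD)
  have cor: "corner k c" "corner k R" "corner k y'" "corner k X"
    using oc up_rs_corner[OF w sa(1)] by (auto simp: ovr_def R_def y'_def X_def intro!: corner_times corner_adj)
  have nc: "norm c \<le> D" "norm R \<le> D" using up_rs(2)[OF w sa(2)] up_rs(2)[OF w sa(1)] by (auto simp: c_def R_def)
  have "(norm (rho i w))\<^sup>2 = (norm (Ef (adj X * (R * y'))))\<^sup>2"
    by (simp add: rho_def X_def adj_simps ay mult.assoc c_def R_def y'_def[symmetric])
  also have "\<dots> \<le> norm (Ef (adj X * X)) * norm (Ef (adj (R * y') * (R * y')))" by (rule Ef_CS)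
  also have "\<dots> \<le> ((real k)\<^sup>2 * nu / real n * D\<^sup>2) * (norm (eta 1) / real n * D\<^sup>2)"
  proof (rule mult_mono)
    have "adj (R * y') * (R * y') = y' * (adj R * R) * y'" by (simp add: adj_simps ay mult.assoc)
    then have "norm (Ef (adj (R * y') * (R * y'))) \<le> norm (eta 1) / real n * norm (adj R * R)"
      using norm_Ef_conj_y[OF corner_times[OF corner_adj[OF cor(2)] cor(2)] i] by (simp add: y'_def)
    also have "\<dots> \<le> norm (eta 1) / real n * D\<^sup>2"
      using nc(2) by (intro mult_left_mono) (auto simp: norm_adj_times power_mono)
    finally show "norm (Ef (adj (R * y') * (R * y'))) \<le> norm (eta 1) / real n * D\<^sup>2" .
    have "norm (Ef (adj X * X)) \<le> (\<Sum>a<k. norm (ent (Ef (adj X * X)) a a))"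
      by (intro norm_psd_le_trace psd_Ef psd_square corner_Ef corner_times corner_adj cor)
    also have "\<dots> \<le> (\<Sum>a<k. \<Sum>l<k. nu / real n * D\<^sup>2)"
    proof (rule sum_mono)
      fix a assume "a \<in> {..<k}"
      then have a: "a < k" by simp
      have "ent (adj X * X) a a = (\<Sum>l<k. y i * ent c a l * y i * y i * cstar (ent c a l) * y i)"
        unfolding ent_times'[OF cor(4)]
      proof (rule sum.cong)
        fix l assume "l \<in> {..<k}"
        then have "ent X l a = y i * cstar (ent c a l) * y i"
          using a ent_conj_dg[OF corner_adj[OF cor(1)]] by (simp add: X_def y'_def)
        then show "ent (adj X) a l * ent X l a = y i * ent c a l * y i * y i * cstar (ent c a l) * y i"
          by (simp add: cstar_simps sa mult.assoc)
      qed simp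
      then have "ent (Ef (adj X * X)) a a = (\<Sum>l<k. mom4 (ent c a l) (cstar (ent c a l)))"
        by (simp add: E_sum E_mom4[OF i ovr_ent[OF oc] cstar_B[OF ovr_ent[OF oc]]])
      also have "norm \<dots> \<le> (\<Sum>l<k. nu / real n * D\<^sup>2)"
      proof (rule sum_norm_le)
        fix l
        have "norm (ent c a l) \<le> D" using norm_ent_le[of c a l] nc(1) by simp
        then have "norm (ent c a l) * norm (ent c a l) \<le> D\<^sup>2"
          unfolding power2_eq_square by (intro mult_mono D_nonneg) auto
        then have "nu * (norm (ent c a l) * norm (ent c a l)) \<le> nu * D\<^sup>2"
          using nu_nonneg by (rule mult_left_mono)
        then have "real n * norm (mom4 (ent c a l) (cstar (ent c a l))) \<le> nu * D\<^sup>2"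
          using norm_mom4_le[OF ovr_ent[OF oc] cstar_B[OF ovr_ent[OF oc]], of a l a l] by (simp add: mult.assoc)
        then show "norm (mom4 (ent c a l) (cstar (ent c a l))) \<le> nu / real n * D\<^sup>2"
          using np by (simp add: field_simps)
      qed
      finally show "norm (ent (Ef (adj X * X)) a a) \<le> (\<Sum>l<k. nu / real n * D\<^sup>2)" .
    qed
    also have "\<dots> = (real k)\<^sup>2 * nu / real n * D\<^sup>2" by (simp add: power2_eq_square)
    finally show "norm (Ef (adj X * X)) \<le> (real k)\<^sup>2 * nu / real n * D\<^sup>2" .
  qed (use nu_nonneg in auto)
  also have "\<dots> = (rho0 / real n)\<^sup>2"
    using nu_nonneg by (simp add: rho0_def power_mult_distrib power_divide power2_eq_square[of "real n"] mult_ac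
      power2_eq_square[of "D\<^sup>2"])
  finally show ?thesis by (rule power2_le_imp_le) (simp add: rho0_nonneg)
qed

definition "U0 = norm (eta 1) * D + rho0"

text \<open>Second-order expansion of \<open>F = E[(w - y)\<^sup>-\<^sup>1]\<^sup>-\<^sup>1\<close>: with \<open>c = w\<^sup>-\<^sup>1\<close> one has
  \<open>F\<^sup>-\<^sup>1 = c + c u c\<close>, where \<open>u = E[y c y] + rho\<close>, hence \<open>F - w + u = F c u c u\<close>.\<close>

lemma fs_expansion:
  assumes w: "up w" and i: "i < n" and small: "U0 * D / real n \<le> 1 / 2"
  shows "norm (fs (y i) w - (w - (1 / real n) *\<^sub>R etaf (rs 0 w))) \<le> rho0 / real n + 2 * D * (U0 / real n)\<^sup>2"
proof -
  define c R y' F u where "c = rs 0 w" and "R = rs (y i) w" and "y' = dg k (y i)" and "F = fs (y i) w"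
    and "u = (1 / real n) *\<^sub>R etaf c + rho i w"
  have sa: "cstar (y i) = y i" "cstar (0::'a) = 0" using y_selfadj i by auto
  have np: "real n > 0" using n_pos by simp
  have oc: "ovr k B c" unfolding c_def using calg_B by (intro up_rs(3)[OF w sa(2) calg_B]) (auto intro: calgD)
  have cor: "corner k c" "corner k R" "corner k y'" "corner k w" "corner k F"
    using oc up_rs_corner[OF w sa(1)] up_corner[OF w] up_corner[OF fs_props(2)[OF w sa(1)]]
    by (auto simp: ovr_def R_def y'_def F_def)
  have nc: "norm c \<le> D" using up_rs(2)[OF w sa(2)] by (auto simp: c_def)
  have cw: "c * w = dg k 1" "w * c = dg k 1" using up_rs_eqs[OF w sa(2)] by (auto simp: c_def)
  have Re: "(w - y') * R = dg k 1" "R * (w - y') = dg k 1" using up_rs_eqs[OF w sa(1)] by (auto simp: R_def y'_def)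
  have R1: "R = c + c * y' * R"
  proof -
    have "c * ((w - y') * R) = (c * w) * R - c * y' * R" by (simp add: algebra_simps)
    then have "c = R - c * y' * R" by (simp add: Re cw dg_one_left[OF cor(2)] dg_one_right[OF cor(1)])
    then show ?thesis by (metis diff_add_cancel)
  qed
  have R2: "R = c + R * y' * c"
  proof -
    have "R * (w - y') * c = R * (w * c) - R * y' * c" by (simp add: algebra_simps)
    then have "c = R - R * y' * c" by (simp add: Re cw dg_one_right[OF cor(2)] dg_one_left[OF cor(1)])
    then show ?thesis by (metis diff_add_cancel)
  qed
  \<comment> \<open>Expanding twice from the left and once from the right makes every term begin and
    end with \<open>c\<close>, which \<open>E\<close> lets pass.\<close>
  have "R = c + c * y' * (c + c * y' * (c + R * y' * c))" by (metis R1 R2)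
  then have Rexp: "R = c + c * y' * c + c * (y' * c * y') * c + c * (y' * c * y' * R * y') * c"
    by (simp add: distrib_left mult.assoc add.assoc)
  have G: "gs (y i) w = c + c * u * c"
  proof -
    have bm: "Ef (c * X * c) = c * Ef X * c" for X by (simp add: Ef_left[OF oc] Ef_right[OF oc])
    have "gs (y i) w = Ef (c + c * y' * c + c * (y' * c * y') * c + c * (y' * c * y' * R * y') * c)"
      using Rexp by (simp add: gs_def R_def)
    also have "\<dots> = c + c * Ef y' * c + c * Ef (y' * c * y') * c + c * rho i w * c"
      unfolding Ef_plus bm Ef_id[OF oc] by (simp add: rho_def R_def c_def y'_def)
    also have "Ef y' = 0" by (simp add: y'_def Ef_dg E_y[OF i])
    also have "Ef (y' * c * y') = (1 / real n) *\<^sub>R etaf c" unfolding y'_def by (rule Ef_cov[OF oc i])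
    finally show ?thesis by (simp add: u_def distrib_left distrib_right)
  qed
  have FG: "F * (c + c * u * c) = dg k 1"
    using fs_props(1)[OF w sa(1)] by (simp add: inverses_def F_def G)
  have nu: "norm u \<le> U0 / real n"
  proof -
    have "norm (etaf c) \<le> norm (eta 1) * D"
    proof -
      have "norm ((1 / real n) *\<^sub>R etaf c) \<le> norm (eta 1) / real n * norm c"
        using norm_Ef_conj_y[OF cor(1) i] Ef_cov[OF oc i] by simp
      also have "\<dots> \<le> norm (eta 1) / real n * D" using nc by (intro mult_left_mono) auto
      finally show ?thesis using np by (simp add: field_simps)
    qed
    then have "norm ((1 / real n) *\<^sub>R etaf c) \<le> norm (eta 1) * D / real n" using np by (simp add: divide_right_mono)
    then show ?thesis using norm_rho_le[OF w i] norm_triangle_ineq[of "(1 / real n) *\<^sub>R etaf c" "rho i w"]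
      by (simp add: u_def U0_def add_divide_distrib)
  qed
  have nuc: "norm (u * c) \<le> U0 / real n * D"
    using norm_mult_ineq[of u c] mult_mono[OF nu nc] nu norm_ge_zero[of u] by (smt (verit) norm_ge_zero)
  then have nuc': "norm (u * c) \<le> 1 / 2" using small by (simp add: mult.commute)
  have Fc: "F * c + F * c * (u * c) = dg k 1" using FG by (simp add: distrib_left mult.assoc)
  \<comment> \<open>Solving \<open>F * c = 1 - F * c * (u * c)\<close> with \<open>u * c\<close> of
    norm at most \<open>1/2\<close> gives a bound free of \<open>w\<close>, whereas the one in
    \<open>fs_props\<close> grows with \<open>w\<close>.\<close>
  have nFc: "norm (F * c) \<le> 2"
  proof -
    have "F * c = dg k 1 - F * c * (u * c)" using Fc by (simp add: algebra_simps)
    then have "norm (F * c) \<le> norm (dg k (1::'a)) + norm (F * c * (u * c))" by (metis norm_triangle_ineq4)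
    also have "\<dots> \<le> 1 + norm (F * c) * (1 / 2)"
    proof (rule add_mono[OF norm_one_corner])
      have "norm (F * c * (u * c)) \<le> norm (F * c) * norm (u * c)" by (rule norm_mult_ineq)
      also have "\<dots> \<le> norm (F * c) * (1 / 2)" using nuc' by (intro mult_left_mono) auto
      finally show "norm (F * c * (u * c)) \<le> norm (F * c) * (1 / 2)" .
    qed
    finally show ?thesis by simp
  qed
  have uc: "corner k u"
    unfolding u_def etaf_def rho_def using cor
    by (intro corner_plus corner_scaleR corner_Ef corner_times) (auto simp: c_def R_def)
  have "F * c * w + F * c * u * (c * w) = w"
    using arg_cong[OF Fc, of "\<lambda>X. X * w"] dg_one_left[OF cor(4)] by (simp add: distrib_right mult.assoc)
  then have "F + F * c * u = w"
    using dg_one_right[OF cor(5)] dg_one_right[OF uc] by (simp add: mult.assoc cw)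
  then have "F - w + u = u - F * c * u" by (simp add: algebra_simps)
  also have "\<dots> = (dg k 1 - F * c) * u" by (simp add: left_diff_distrib dg_one_left[OF uc])
  also have "dg k 1 - F * c = F * c * (u * c)" using Fc by (simp add: algebra_simps)
  finally have eq: "F - (w - (1 / real n) *\<^sub>R etaf c) = F * c * (u * c) * u - rho i w"
    by (simp add: u_def algebra_simps)
  have "norm (F * c * (u * c) * u) \<le> 2 * D * (U0 / real n)\<^sup>2"
    using norm_mult3_mono[OF nFc nuc nu] by (simp add: power2_eq_square mult_ac)
  then show ?thesis using norm_rho_le[OF w i] norm_triangle_ineq4[of "F * c * (u * c) * u" "rho i w"] eq
    by (simp add: F_def c_def)
qed

end

section \<open>Moments of arcsine elements\<close>

lemma npairsF_simps [simp]: "npairsF [] = 0" "npairsF (Arc G # F) = Suc (npairsF G) + npairsF F"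
  by (simp_all add: npairsF_def)

lemma tauF_simps [simp]: "tauF [] = 1" "tauF (Arc G # F) = Suc (npairsF G) * tauF G * tauF F"
  by (simp_all add: tauF_def npairsF_def)

lemma npairs_Arc: "npairs (Arc G) = Suc (npairsF G)"
  by (simp add: npairsF_def)

lemma forest_cases:
  obtains "F = []" | G F' where "F = Arc G # F'"
  by (cases F) (auto, metis ncp.exhaust)

lemma NC2_0: "NC2 0 = {[]}"
proof -
  have "F = []" if "npairsF F = 0" for F using that by (cases F rule: forest_cases) auto
  then show ?thesis by (auto simp: NC2_def)
qed

lemma NC2_odd: "odd m \<Longrightarrow> NC2 m = {}"
  by (auto simp: NC2_def)

text \<open>The first tree has \<open>a\<close> points below its root and the other trees use
  \<open>d - a\<close>; the shift by two counts the end points of the root arc.\<close>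

lemma NC2_Suc_Suc:
  "NC2 (Suc (Suc d)) = (\<lambda>(a, G, F). Arc G # F) ` (SIGMA a:{..d}. NC2 a \<times> NC2 (d - a))"
proof
  show "NC2 (Suc (Suc d)) \<subseteq> (\<lambda>(a, G, F). Arc G # F) ` (SIGMA a:{..d}. NC2 a \<times> NC2 (d - a))"
  proof
    fix F assume F: "F \<in> NC2 (Suc (Suc d))"
    then obtain G F' where F': "F = Arc G # F'" by (cases F rule: forest_cases) (auto simp: NC2_def)
    then have "2 * npairsF G + 2 * npairsF F' = d" using F by (simp add: NC2_def)
    then have "(2 * npairsF G, G, F') \<in> (SIGMA a:{..d}. NC2 a \<times> NC2 (d - a))" by (auto simp: NC2_def)
    then show "F \<in> (\<lambda>(a, G, F). Arc G # F) ` (SIGMA a:{..d}. NC2 a \<times> NC2 (d - a))"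
      unfolding F' by (rule rev_image_eqI) simp
  qed
qed (auto simp: NC2_def)

lemma finite_NC2: "finite (NC2 m)"
proof (induction m rule: less_induct)
  case (less m)
  consider "m = 0" | "m = 1" | d where "m = Suc (Suc d)" by (metis One_nat_def not0_implies_Suc)
  then show ?case
  proof cases
    case 3
    then show ?thesis unfolding 3 NC2_Suc_Suc
      by (intro finite_imageI finite_SigmaI finite_cartesian_product less) (auto simp: 3)
  qed (auto simp: NC2_0 NC2_odd)
qed

lemma sum_NC2_Suc_Suc:
  "(\<Sum>F\<in>NC2 (Suc (Suc d)). f F) = (\<Sum>a\<le>d. \<Sum>G\<in>NC2 a. \<Sum>F\<in>NC2 (d - a). f (Arc G # F))"
proof -
  have "inj_on (\<lambda>(a, G, F). Arc G # F) (SIGMA a:{..d}. NC2 a \<times> NC2 (d - a))"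
    by (auto simp: inj_on_def NC2_def)
  then have "(\<Sum>F\<in>NC2 (Suc (Suc d)). f F) = (\<Sum>(a, G, F)\<in>(SIGMA a:{..d}. NC2 a \<times> NC2 (d - a)). f (Arc G # F))"
    unfolding NC2_Suc_Suc by (subst sum.reindex) (auto intro!: sum.cong)
  also have "\<dots> = (\<Sum>a\<le>d. \<Sum>(G, F)\<in>NC2 a \<times> NC2 (d - a). f (Arc G # F))"
    by (subst sum.Sigma) (auto simp: finite_NC2 split_beta)
  finally show ?thesis by (simp add: sum.cartesian_product)
qed

text \<open>Summation over index paths: entries of a matrix product expand in this way, with
  \<open>pword\<close> listing the matrix entries met along a path.\<close>

primrec pathsum :: "nat \<Rightarrow> nat \<Rightarrow> (nat list \<Rightarrow> 'b) \<Rightarrow> 'b::comm_monoid_add" where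
  "pathsum k 0 f = f []"
| "pathsum k (Suc n) f = (\<Sum>p<k. pathsum k n (\<lambda>ps. f (p # ps)))"

lemma pathsum_cong: "(\<And>ps. length ps = n \<Longrightarrow> f ps = g ps) \<Longrightarrow> pathsum k n f = pathsum k n g"
proof (induction n arbitrary: f g)
  case (Suc n)
  have "pathsum k n (\<lambda>ps. f (p # ps)) = pathsum k n (\<lambda>ps. g (p # ps))" for p
    by (rule Suc.IH, rule Suc.prems) simp
  then show ?case by simp
qed simp

lemma pathsum_additive:
  assumes "h 0 = 0" "\<And>x y. h (x + y) = h x + h y"
  shows "h (pathsum k n f) = pathsum k n (\<lambda>ps. h (f ps))"
proof -
  have s: "h (\<Sum>p<m. g p) = (\<Sum>p<m. h (g p))" for m :: nat and g by (induction m) (auto simp: assms)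
  show ?thesis by (induction n arbitrary: f) (auto simp: s)
qed

lemma pathsum_sum: "pathsum k n (\<lambda>ps. \<Sum>a\<in>A. f a ps) = (\<Sum>a\<in>A. pathsum k n (f a))"
  by (induction n arbitrary: f) (auto simp: sum.swap[of _ _ A])

lemma pathsum_append:
  "pathsum k (Suc (a + b)) f = pathsum k a (\<lambda>ps1. \<Sum>q<k. pathsum k b (\<lambda>ps2. f (ps1 @ q # ps2)))"
proof (induction a arbitrary: f)
  case (Suc a)
  have "pathsum k (Suc (Suc a + b)) f = (\<Sum>p<k. pathsum k (Suc (a + b)) (\<lambda>ps. f (p # ps)))" by simp
  also have "\<dots> = (\<Sum>p<k. pathsum k a (\<lambda>ps1. \<Sum>q<k. pathsum k b (\<lambda>ps2. f (p # ps1 @ q # ps2))))"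
    by (simp only: Suc.IH)
  finally show ?case by simp
qed simp

fun pword :: "'a::cstar_algebra fmat \<Rightarrow> nat \<Rightarrow> nat list \<Rightarrow> nat \<Rightarrow> 'a list" where
  "pword c i [] j = [ent c i j]"
| "pword c i (p # ps) j = ent c i p # pword c p ps j"

lemma length_pword [simp]: "length (pword c i ps j) = Suc (length ps)"
  by (induction ps arbitrary: i) auto

lemma pword_nonempty [simp]: "pword c i ps j \<noteq> []"
  by (cases ps) auto

lemma pword_append: "pword c i (ps1 @ q # ps2) j = pword c i ps1 q @ pword c q ps2 j"
  by (induction ps1 arbitrary: i) auto

text \<open>These are Taylor coefficients of a resolvent: with \<open>c\<close> the inverse of
  \<open>b - x a\<close>, the inverse of \<open>b - (x + h) a\<close> is the sum of
  \<open>h^n\<close> times \<open>rmom c a n\<close>.\<close>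

primrec rmom :: "'a::cstar_algebra fmat \<Rightarrow> 'a fmat \<Rightarrow> nat \<Rightarrow> 'a fmat" where
  "rmom c a 0 = c"
| "rmom c a (Suc n) = c * a * rmom c a n"

lemma corner_rmom: "corner k c \<Longrightarrow> corner k a \<Longrightarrow> corner k (rmom c a n)"
  by (induction n) (auto intro: corner_times)

lemma rmom_mult: "rmom c a i * a * rmom c a j = rmom c a (Suc (i + j))"
  by (induction i) (auto simp: mult.assoc)

lemma ent_rmom:
  assumes "corner k c" shows "ent (rmom c (dg k x) n) i j = pathsum k n (\<lambda>ps. word x (pword c i ps j))"
proof (induction n arbitrary: i)
  case (Suc n)
  have c: "corner k (c * dg k x)" by (intro corner_times assms corner_dg)
  have "ent (rmom c (dg k x) (Suc n)) i j = (\<Sum>p<k. ent c i p * x * pathsum k n (\<lambda>ps. word x (pword c p ps j)))"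
    using Suc.IH by (simp add: ent_times[OF c] ent_times_dg)
  also have "\<dots> = (\<Sum>p<k. pathsum k n (\<lambda>ps. ent c i p * x * word x (pword c p ps j)))"
    by (intro sum.cong refl pathsum_additive) (auto simp: distrib_left)
  finally show ?case by (simp add: word_Cons)
qed simp

text \<open>Nested evaluations must stay in \<open>B\<close>, because the variance map is known only
  there.\<close>

lemma evalW_in:
  assumes "calg B" "\<And>c. c \<in> B \<Longrightarrow> e c \<in> B"
  shows "length gs = Suc (2 * npairsF F) \<Longrightarrow> set gs \<subseteq> B \<Longrightarrow> evalW e F gs \<in> B"
  using assms(2)
proof (induction e F gs rule: evalW.induct)
  case (1 e gs) then show ?case by (cases gs) auto
next
  case (2 e G F gs)
  have ne: "gs \<noteq> []" using 2 by auto
  have l1: "length (take (2 * npairs (Arc G) - 1) (tl gs)) = Suc (2 * npairsF G)"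
    using 2(3) by (simp add: npairs_Arc del: npairs.simps)
  have l2: "length (drop (2 * npairs (Arc G)) gs) = Suc (2 * npairsF F)"
    using 2(3) by (simp add: npairs_Arc del: npairs.simps)
  have s: "set (take n (tl gs)) \<subseteq> B" "set (drop n gs) \<subseteq> B" for n
    using 2(4) by (auto dest!: in_set_takeD in_set_dropD list.set_sel(2)[OF ne])
  have "evalW e G (take (2 * npairs (Arc G) - 1) (tl gs)) \<in> B" by (rule 2(1)[OF l1 s(1) 2(5)])
  moreover have "evalW e F (drop (2 * npairs (Arc G)) gs) \<in> B" by (rule 2(2)[OF l2 s(2) 2(5)])
  moreover have "hd gs \<in> B" using ne 2(4) by (auto dest: hd_in_set)
  ultimately show ?case unfolding evalW.simps by (intro calgD(5)[OF assms(1)] 2(5))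
qed

locale arcsine_half_plane = half_plane +
  fixes et :: "'a \<Rightarrow> 'a" and A V :: 'a
  assumes arcsine_A: "arcsine B E et A" and et_V: "c \<in> B \<Longrightarrow> et c = E (V * c * V)"
begin

lemma A_selfadj: "cstar A = A" and E_A: "E A = 0"
  using arcsine_A by (auto simp: arcsine_def)

text \<open>Agrees with \<open>et\<close> on \<open>B\<close>, but is linear and bounded on the
  whole algebra. Later \<open>V\<close> is \<open>Y\<close>.\<close>

definition ev :: "'a \<Rightarrow> 'a" where "ev c = E (V * c * V)"

lemma ev_add: "ev (c + d) = ev c + ev d" by (simp add: ev_def E_add distrib_left distrib_right)
lemma ev_scaleR: "ev (r *\<^sub>R c) = r *\<^sub>R ev c" by (simp add: ev_def E_scaleR)
lemma ev_0: "ev 0 = 0" by (simp add: ev_def)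
lemma ev_sum: "ev (sum f X) = (\<Sum>x\<in>X. ev (f x))"
  by (induction X rule: infinite_finite_induct) (auto simp: ev_add ev_0)
definition forest_moment :: "'a list \<Rightarrow> 'a" where
  "forest_moment bs = (\<Sum>F\<in>NC2 (length bs - 1). (1 / real (tauF F)) *\<^sub>R evalW et F bs)"

text \<open>A uniform formula beyond the cases spelled out in \<open>arcsine\<close>: a single
  coefficient belongs to the empty forest, and words with an odd number of letters give empty
  sums.\<close>

lemma word_moment:
  assumes "set bs \<subseteq> B" "bs \<noteq> []" shows "E (word A bs) = forest_moment bs"
proof (cases "length bs \<ge> 2")
  case True
  then have "E (word A bs) = (if even (length bs - 1) then forest_moment bs else 0)"
    using arcsine_A assms(1) unfolding arcsine_def forest_moment_def by blast
  then show ?thesis by (auto simp: forest_moment_def NC2_odd)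
next
  case False
  then obtain b where "bs = [b]" using assms(2)
    by (metis One_nat_def Suc_1 length_Suc_conv length_greater_0_conv less_2_cases_iff not_le length_0_conv)
  then show ?thesis using assms(1) by (simp add: forest_moment_def NC2_0 E_id)
qed

lemma et_in: "c \<in> B \<Longrightarrow> et c \<in> B"
  by (simp add: et_V E_in)

text \<open>Splitting off the first tree of a forest: a tree with \<open>g\<close> pairs under its root contributes
  the factor \<open>1 / (g + 1) = 2 / (a + 2)\<close> with \<open>a = 2 g\<close>.\<close>

lemma forest_moment_first:
  assumes rest: "set rest \<subseteq> B" "length rest = Suc (Suc d)"
  shows "forest_moment (b0 # rest) = (\<Sum>a\<le>d. (2 / (real a + 2)) *\<^sub>R
    (b0 * ev (forest_moment (take (Suc a) rest)) * forest_moment (drop (Suc a) rest)))"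
proof -
  have "forest_moment (b0 # rest) = (\<Sum>a\<le>d. \<Sum>G\<in>NC2 a. \<Sum>F\<in>NC2 (d - a).
      (1 / real (tauF (Arc G # F))) *\<^sub>R evalW et (Arc G # F) (b0 # rest))"
    unfolding forest_moment_def using rest(2) by (simp only: list.size diff_Suc_1 add_Suc_right add_0_right sum_NC2_Suc_Suc)
  also have "\<dots> = (\<Sum>a\<le>d. (2 / (real a + 2)) *\<^sub>R
    (b0 * ev (forest_moment (take (Suc a) rest)) * forest_moment (drop (Suc a) rest)))"
  proof (rule sum.cong[OF refl])
    fix a assume "a \<in> {..d}"
    then have a: "a \<le> d" by simp
    let ?v = "take (Suc a) rest" and ?x = "drop (Suc a) rest"
    have l: "length ?v = Suc a" "length ?x = Suc (d - a)" using rest(2) a by auto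
    have sv: "set ?v \<subseteq> B" using rest(1) by (auto dest: in_set_takeD)
    have t: "(1 / real (tauF (Arc G # F))) *\<^sub>R evalW et (Arc G # F) (b0 # rest) =
       (2 / (real a + 2)) *\<^sub>R (b0 * ev ((1 / real (tauF G)) *\<^sub>R evalW et G ?v) * ((1 / real (tauF F)) *\<^sub>R evalW et F ?x))"
      if "G \<in> NC2 a" for G F
    proof -
      have g: "2 * npairsF G = a" using that by (simp add: NC2_def)
      have "evalW et G ?v \<in> B" by (rule evalW_in[OF calg_B et_in _ sv]) (simp_all add: l g del: length_take)
      then have "et (evalW et G ?v) = ev (evalW et G ?v)" by (simp add: et_V ev_def)
      moreover have "2 * npairs (Arc G) = Suc (Suc a)" using g by (simp add: npairs_Arc del: npairs.simps)
      ultimately have "evalW et (Arc G # F) (b0 # rest) = b0 * ev (evalW et G ?v) * evalW et F ?x"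
        by (simp del: npairs.simps)
      moreover have "1 / real (tauF (Arc G # F)) = (2 / (real a + 2)) * ((1 / real (tauF G)) * (1 / real (tauF F)))"
      proof -
        have "2 / (real a + 2) = 1 / real (Suc (npairsF G))" by (simp add: field_simps flip: g)
        then show ?thesis unfolding tauF_simps of_nat_mult by (simp del: of_nat_Suc)
      qed
      ultimately show ?thesis by (simp add: ev_scaleR mult.commute)
    qed
    have "(\<Sum>G\<in>NC2 a. \<Sum>F\<in>NC2 (d - a). (1 / real (tauF (Arc G # F))) *\<^sub>R evalW et (Arc G # F) (b0 # rest)) =
      (\<Sum>G\<in>NC2 a. \<Sum>F\<in>NC2 (d - a). (2 / (real a + 2)) *\<^sub>R
        (b0 * ev ((1 / real (tauF G)) *\<^sub>R evalW et G ?v) * ((1 / real (tauF F)) *\<^sub>R evalW et F ?x)))"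
      by (intro sum.cong refl t)
    also have "\<dots> = (2 / (real a + 2)) *\<^sub>R (b0 * ev (forest_moment ?v) * forest_moment ?x)"
      unfolding forest_moment_def l diff_Suc_1 ev_sum sum_distrib_left sum_distrib_right scaleR_sum_right
      by (rule sum.swap)
    finally show "(\<Sum>G\<in>NC2 a. \<Sum>F\<in>NC2 (d - a). (1 / real (tauF (Arc G # F))) *\<^sub>R evalW et (Arc G # F) (b0 # rest)) =
      (2 / (real a + 2)) *\<^sub>R (b0 * ev (forest_moment ?v) * forest_moment ?x)" .
  qed
  finally show ?thesis .
qed

definition evf :: "'a fmat \<Rightarrow> 'a fmat" where "evf X = Ef (dg k V * X * dg k V)"

lemma ent_evf: "corner k X \<Longrightarrow> ent (evf X) i j = ev (ent X i j)"
  by (auto simp: evf_def ent_dg_times ent_times_dg ev_def corner_ent)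

lemma corner_evf: "corner k X \<Longrightarrow> corner k (evf X)"
  unfolding evf_def by (intro corner_Ef corner_times corner_dg)

definition mo :: "'a fmat \<Rightarrow> nat \<Rightarrow> 'a fmat" where "mo c n = Ef (rmom c (dg k A) n)"

lemma corner_mo: "corner k c \<Longrightarrow> corner k (mo c n)"
  unfolding mo_def by (intro corner_Ef corner_rmom corner_dg)

lemma set_pword: "ovr k B c \<Longrightarrow> set (pword c i ps j) \<subseteq> B"
  by (induction ps arbitrary: i) (auto simp: ovr_def)

lemma ent_mo:
  assumes "ovr k B c" shows "ent (mo c n) i j = pathsum k n (\<lambda>ps. forest_moment (pword c i ps j))"
proof -
  have "ent (mo c n) i j = pathsum k n (\<lambda>ps. E (word A (pword c i ps j)))"
    unfolding mo_def ent_Ef ent_rmom[OF ovr_corner[OF assms]] by (rule pathsum_additive) (auto simp: E_add)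
  then show ?thesis by (simp add: word_moment set_pword[OF assms])
qed

lemma mo_0: "ovr k B c \<Longrightarrow> mo c 0 = c"
  by (simp add: mo_def Ef_id)

lemma mo_1: "ovr k B c \<Longrightarrow> mo c 1 = 0"
  by (rule fmat_eqI) (simp add: ent_mo forest_moment_def NC2_odd)

text \<open>An index path splits at the vertex where the first arc closes. Its first part yields an
  entry of \<open>mo c a\<close> inside the covariance, its second part an entry of
  \<open>mo c (d - a)\<close>.\<close>

lemma mo_step:
  assumes c: "ovr k B c"
  shows "mo c (Suc (Suc d)) = (\<Sum>a\<le>d. (2 / (real a + 2)) *\<^sub>R (c * evf (mo c a) * mo c (d - a)))"
proof (rule corner_eqI[of k])
  have cc: "corner k c" by (rule ovr_corner[OF c])
  show "corner k (\<Sum>a\<le>d. (2 / (real a + 2)) *\<^sub>R (c * evf (mo c a) * mo c (d - a)))"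
    by (intro corner_sum corner_scaleR corner_times corner_evf corner_mo cc)
  fix i j assume ij: "i < k" "j < k"
  let ?t = "\<lambda>p a q. (2 / (real a + 2)) *\<^sub>R (ent c i p * ev (ent (mo c a) p q) * ent (mo c (d - a)) q j)"
  let ?s = "\<lambda>p a ps. (2 / (real a + 2)) *\<^sub>R (ent c i p *
        ev (forest_moment (take (Suc a) (pword c p ps j))) * forest_moment (drop (Suc a) (pword c p ps j)))"
  let ?w = "\<lambda>i ps j. forest_moment (pword c i ps j)"
  have "ent (mo c (Suc (Suc d))) i j =
     (\<Sum>p<k. pathsum k (Suc d) (\<lambda>ps. forest_moment (ent c i p # pword c p ps j)))"
    by (simp add: ent_mo[OF c])
  also have "\<dots> = (\<Sum>p<k. \<Sum>a\<le>d. \<Sum>q<k. ?t p a q)"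
  proof (rule sum.cong[OF refl])
    fix p assume "p \<in> {..<k}"
    have "pathsum k (Suc d) (\<lambda>ps. forest_moment (ent c i p # pword c p ps j)) =
      pathsum k (Suc d) (\<lambda>ps. \<Sum>a\<le>d. ?s p a ps)"
      by (rule pathsum_cong) (rule forest_moment_first[OF set_pword[OF c]], simp)
    also have "\<dots> = (\<Sum>a\<le>d. pathsum k (Suc d) (\<lambda>ps. ?s p a ps))"
      by (rule pathsum_sum)
    also have "\<dots> = (\<Sum>a\<le>d. \<Sum>q<k. ?t p a q)"
    proof (rule sum.cong[OF refl])
      fix a assume "a \<in> {..d}"
      then have d: "Suc d = Suc (a + (d - a))" by simp
      let ?r = "2 / (real a + 2)"
      have "pathsum k (Suc d) (\<lambda>ps. ?s p a ps) =
        pathsum k a (\<lambda>ps1. \<Sum>q<k. pathsum k (d - a) (\<lambda>ps2. ?r *\<^sub>R (ent c i p * ev (?w p ps1 q) * ?w q ps2 j)))"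
        unfolding d pathsum_append by (rule pathsum_cong) (simp add: pword_append)
      also have "\<dots> = (\<Sum>q<k. pathsum k a (\<lambda>ps1. pathsum k (d - a) (\<lambda>ps2. ?r *\<^sub>R (ent c i p * ev (?w p ps1 q) * ?w q ps2 j))))"
        by (rule pathsum_sum)
      also have "\<dots> = (\<Sum>q<k. pathsum k a (\<lambda>ps1. ?r *\<^sub>R (ent c i p * ev (?w p ps1 q) * ent (mo c (d - a)) q j)))"
        unfolding ent_mo[OF c, of "d - a"]
        by (subst pathsum_additive[where h = "\<lambda>x. ?r *\<^sub>R (ent c i p * ev (?w p ps1 q) * x)" for ps1 q])
          (simp_all add: distrib_left scaleR_add_right)
      also have "\<dots> = (\<Sum>q<k. ?r *\<^sub>R (ent c i p * ev (ent (mo c a) p q) * ent (mo c (d - a)) q j))"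
        unfolding ent_mo[OF c, of a]
        by (subst pathsum_additive[where h = "\<lambda>x. ?r *\<^sub>R (ent c i p * ev x * ent (mo c (d - a)) q j)" for q])
          (simp_all add: ev_0 ev_add distrib_left distrib_right scaleR_add_right)
      finally show "pathsum k (Suc d) (\<lambda>ps. ?s p a ps) =
        (\<Sum>q<k. ?r *\<^sub>R (ent c i p * ev (ent (mo c a) p q) * ent (mo c (d - a)) q j))" .
    qed
    finally show "pathsum k (Suc d) (\<lambda>ps. forest_moment (ent c i p # pword c p ps j)) =
      (\<Sum>a\<le>d. \<Sum>q<k. ?t p a q)" .
  qed
  also have "\<dots> = ent (\<Sum>a\<le>d. (2 / (real a + 2)) *\<^sub>R (c * evf (mo c a) * mo c (d - a))) i j"
  proof -
    have "ent (c * evf (mo c a) * mo c (d - a)) i j =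
      (\<Sum>p<k. \<Sum>q<k. ent c i p * ev (ent (mo c a) p q) * ent (mo c (d - a)) q j)" for a
    proof -
      have "ent (c * evf (mo c a) * mo c (d - a)) i j = (\<Sum>q<k. \<Sum>p<k. ent c i p * ent (evf (mo c a)) p q * ent (mo c (d - a)) q j)"
        by (simp add: ent_times[OF corner_times[OF cc corner_evf[OF corner_mo[OF cc]]]] ent_times[OF cc] sum_distrib_right)
      also have "\<dots> = (\<Sum>q<k. \<Sum>p<k. ent c i p * ev (ent (mo c a) p q) * ent (mo c (d - a)) q j)"
        by (intro sum.cong refl) (simp add: ent_evf[OF corner_mo[OF cc]])
      finally show ?thesis by (subst sum.swap)
    qed
    then show ?thesis by (simp add: ent_sum scaleR_sum_right) (rule sum.swap)
  qed
  finally show "ent (mo c (Suc (Suc d))) i j =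
     ent (\<Sum>a\<le>d. (2 / (real a + 2)) *\<^sub>R (c * evf (mo c a) * mo c (d - a))) i j" .
qed (rule corner_mo[OF ovr_corner[OF c]])

text \<open>In generating functions the recursion reads \<open>H = c + c K H\<close>. The degree derivation turns it
  into \<open>H' = c K' H + c K H'\<close>, whose only solution is \<open>H K' H\<close>.\<close>

definition moser :: "'a fmat \<Rightarrow> 'a fmat fps" where "moser c = Abs_fps (mo c)"

definition covser :: "'a fmat \<Rightarrow> 'a fmat fps" where
  "covser c = Abs_fps (\<lambda>n. if n < 2 then 0 else 2 *\<^sub>R evf (mo c (n - 2)))"

definition fdeg :: "'a fmat fps \<Rightarrow> 'a fmat fps" where "fdeg f = Abs_fps (\<lambda>n. real n *\<^sub>R fps_nth f n)"

lemma fdeg_mult: "fdeg (f * g) = fdeg f * g + f * fdeg g"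
proof (rule fps_ext)
  fix n
  have "fps_nth (fdeg (f * g)) n = (\<Sum>i=0..n. real n *\<^sub>R (fps_nth f i * fps_nth g (n - i)))"
    by (simp add: fdeg_def fps_mult_nth scaleR_sum_right)
  also have "\<dots> = (\<Sum>i=0..n. (real i *\<^sub>R fps_nth f i) * fps_nth g (n - i) + fps_nth f i * (real (n - i) *\<^sub>R fps_nth g (n - i)))"
    by (intro sum.cong refl) (auto simp: scaleR_add_left[symmetric])
  finally show "fps_nth (fdeg (f * g)) n = fps_nth (fdeg f * g + f * fdeg g) n"
    by (simp add: fps_mult_nth fdeg_def sum.distrib)
qed

lemma fdeg_moser:
  assumes c: "ovr k B c" shows "fdeg (moser c) = moser c * covser c * moser c"
proof -
  \<comment> \<open>The weight \<open>2 / n\<close> is \<open>1 / (g + 1)\<close> for a tree with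
    \<open>g\<close> pairs below its root, as \<open>n = 2 g + 2\<close>; the degree derivation
    cancels the denominator and leaves \<open>covser\<close>.\<close>
  define K where "K = Abs_fps (\<lambda>n. if n < 2 then 0 else (2 / real n) *\<^sub>R evf (mo c (n - 2)))"
  let ?c = "fps_const c" and ?H = "moser c"
  have cK: "fps_nth (?c * K) n = c * fps_nth K n" for n by simp
  have H: "?H = ?c + ?c * K * ?H"
  proof (rule fps_ext)
    fix n
    consider "n = 0" | "n = 1" | d where "n = Suc (Suc d)" by (metis One_nat_def not0_implies_Suc)
    then show "fps_nth ?H n = fps_nth (?c + ?c * K * ?H) n"
    proof cases
      case 1 then show ?thesis by (simp add: moser_def mo_0[OF c] K_def fps_mult_nth[of "?c * K"])
    next
      case 2 then show ?thesis using mo_1[OF c] by (simp add: moser_def K_def fps_mult_nth[of "?c * K"])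
    next
      case 3
      have "fps_nth (?c * K * ?H) n = (\<Sum>i=0..Suc (Suc d). c * fps_nth K i * mo c (Suc (Suc d) - i))"
        unfolding fps_mult_nth[of "?c * K"] cK by (simp add: 3 moser_def)
      also have "\<dots> = (\<Sum>i=Suc (Suc 0)..Suc (Suc d). c * fps_nth K i * mo c (Suc (Suc d) - i))"
        by (rule sum.mono_neutral_right) (auto simp: K_def)
      also have "\<dots> = (\<Sum>a=0..d. c * fps_nth K (Suc (Suc a)) * mo c (d - a))"
        unfolding sum.shift_bounds_cl_Suc_ivl by simp
      also have "\<dots> = mo c (Suc (Suc d))"
        unfolding mo_step[OF c] atLeast0AtMost by (intro sum.cong refl) (simp add: K_def add.commute)
      finally show ?thesis by (simp add: 3 moser_def)
    qed
  qed
  have fK: "fdeg K = covser c" by (rule fps_ext) (auto simp: fdeg_def K_def covser_def)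
  have fc: "fdeg ?c = 0" by (rule fps_ext) (auto simp: fdeg_def fps_const_def)
  define X where "X = fdeg ?H - ?H * covser c * ?H"
  have fd_add: "fdeg (f + g) = fdeg f + fdeg g" for f g
    by (rule fps_ext) (simp add: fdeg_def scaleR_add_right)
  have e1: "fdeg ?H = ?c * covser c * ?H + ?c * K * fdeg ?H"
    by (subst H) (simp add: fd_add fdeg_mult fc fK)
  have e2: "?H * covser c * ?H = ?c * covser c * ?H + ?c * K * (?H * covser c * ?H)"
    by (subst H) (simp add: distrib_right mult.assoc)
  have X: "X = ?c * K * X"
    using arg_cong2[where f = minus, OF e1 e2]
    unfolding X_def right_diff_distrib add_diff_cancel_left .
  \<comment> \<open>\<open>K\<close> has no terms below degree 2, so each coefficient of
    \<open>X\<close> is determined by earlier ones.\<close>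
  have "fps_nth X n = 0" for n
  proof (induction n rule: less_induct)
    case (less n)
    have "fps_nth X n = (\<Sum>i=0..n. c * fps_nth K i * fps_nth X (n - i))"
      by (subst X) (simp only: fps_mult_nth[of "?c * K"] cK)
    also have "\<dots> = 0" using less by (intro sum.neutral) (auto simp: K_def)
    finally show ?case .
  qed
  then have "X = 0" by (intro fps_ext) simp
  then show ?thesis by (simp add: X_def)
qed

end

section \<open>Analytic germs and the evolution of the arcsine transform\<close>

text \<open>A Banach-valued germ with radius at least \<open>1 / q\<close> and an explicit
  coefficient bound, so that products and tails can be estimated directly.\<close>

definition psb :: "(real \<Rightarrow> 'a::{real_normed_algebra,banach}) \<Rightarrow> (nat \<Rightarrow> 'a) \<Rightarrow> real \<Rightarrow> real \<Rightarrow> real \<Rightarrow> bool" where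
  "psb f c x q C \<longleftrightarrow> 0 < q \<and> (\<forall>n. norm (c n) \<le> C * q ^ n) \<and>
     (\<forall>h. \<bar>h\<bar> * q < 1 \<longrightarrow> (\<lambda>n. h ^ n *\<^sub>R c n) sums f (x + h))"

definition ps_at :: "(real \<Rightarrow> 'a::{real_normed_algebra,banach}) \<Rightarrow> (nat \<Rightarrow> 'a) \<Rightarrow> real \<Rightarrow> bool" where
  "ps_at f c x \<longleftrightarrow> (\<exists>q C. psb f c x q C)"

lemma psb_C: "psb f c x q C \<Longrightarrow> 0 \<le> C"
  unfolding psb_def by (metis mult.right_neutral norm_ge_zero order_trans power_0)

lemma psb_mono:
  assumes "psb f c x q C" "q \<le> q'" shows "psb f c x q' C"
proof -
  have q: "0 < q" using assms by (simp add: psb_def)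
  have "norm (c n) \<le> C * q' ^ n" for n
  proof -
    have "C * q ^ n \<le> C * q' ^ n" using q assms psb_C by (intro mult_left_mono power_mono) auto
    then show ?thesis using assms(1) order_trans by (auto simp: psb_def) 
  qed
  moreover have "\<bar>h\<bar> * q < 1" if "\<bar>h\<bar> * q' < 1" for h
    using that mult_left_mono[OF assms(2), of "\<bar>h\<bar>"] by simp
  ultimately show ?thesis using assms q by (auto simp: psb_def)
qed

lemma psb_common:
  assumes "ps_at f c x" "ps_at g d x"
  obtains q C C' where "psb f c x q C" "psb g d x q C'"
proof -
  obtain q1 C1 q2 C2 where "psb f c x q1 C1" "psb g d x q2 C2" using assms by (auto simp: ps_at_def)
  then show ?thesis using that psb_mono by (metis max.cobounded1 max.cobounded2)
qed

lemma ps_at_plus: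
  assumes "ps_at f c x" "ps_at g d x" shows "ps_at (\<lambda>r. f r + g r) (\<lambda>n. c n + d n) x"
proof -
  obtain q C C' where p: "psb f c x q C" "psb g d x q C'" using assms by (rule psb_common)
  have "norm (c n + d n) \<le> (C + C') * q ^ n" for n
    using p norm_triangle_mono[of "c n" "C * q ^ n" "d n" "C' * q ^ n"] by (simp add: psb_def distrib_right)
  then have "psb (\<lambda>r. f r + g r) (\<lambda>n. c n + d n) x q (C + C')"
    using p by (auto simp: psb_def scaleR_add_right intro: sums_add)
  then show ?thesis by (auto simp: ps_at_def)
qed

lemma ps_at_bounded_linear:
  assumes T: "bounded_linear T" and p: "ps_at f c x" shows "ps_at (\<lambda>r. T (f r)) (\<lambda>n. T (c n)) x"
proof -
  obtain q C where p: "psb f c x q C" using p by (auto simp: ps_at_def)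
  obtain K where K: "\<And>z. norm (T z) \<le> norm z * K" "K > 0"
    using bounded_linear.pos_bounded[OF T] by blast
  have "norm (T (c n)) \<le> (C * K) * q ^ n" for n
    using order_trans[OF K(1)[of "c n"] mult_right_mono[of "norm (c n)" "C * q ^ n" K]] p K(2)
    by (simp add: psb_def mult_ac)
  moreover have "(\<lambda>n. h ^ n *\<^sub>R T (c n)) sums T (f (x + h))" if "\<bar>h\<bar> * q < 1" for h
    using bounded_linear.sums[OF T, of "\<lambda>n. h ^ n *\<^sub>R c n"] p that
    by (simp add: psb_def linear_scale[OF bounded_linear.linear[OF T]])
  ultimately have "psb (\<lambda>r. T (f r)) (\<lambda>n. T (c n)) x q (C * K)" using p by (auto simp: psb_def)
  then show ?thesis by (auto simp: ps_at_def)
qed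

lemma ps_at_finite:
  assumes "\<And>n. n \<ge> N \<Longrightarrow> c n = 0" "\<And>h. f (x + h) = (\<Sum>n<N. h ^ n *\<^sub>R c n)"
  shows "ps_at f c x"
proof -
  have "norm (c n) \<le> (\<Sum>i<N. norm (c i)) * 1 ^ n" for n
  proof (cases "n < N")
    case True then show ?thesis using member_le_sum[of n "{..<N}" "\<lambda>i. norm (c i)"] by auto
  next
    case False then show ?thesis using assms(1) by (simp add: sum_nonneg)
  qed
  moreover have "(\<lambda>n. h ^ n *\<^sub>R c n) sums f (x + h)" for h
    unfolding assms(2) by (rule sums_finite) (use assms(1) not_le in auto)
  ultimately have "psb f c x 1 (\<Sum>i<N. norm (c i))" by (auto simp: psb_def)
  then show ?thesis by (auto simp: ps_at_def)
qed

lemma ps_at_sum: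
  fixes f :: "nat \<Rightarrow> real \<Rightarrow> 'a::{real_normed_algebra,banach}"
  assumes "\<And>l. l < (k::nat) \<Longrightarrow> ps_at (f l) (c l) x"
  shows "ps_at (\<lambda>r. \<Sum>l<k. f l r) (\<lambda>n. \<Sum>l<k. c l n) x"
  using assms
proof (induction k)
  case 0 then show ?case by (intro ps_at_finite[of 0]) auto
next
  case (Suc k)
  then show ?case using ps_at_plus[of "\<lambda>r. \<Sum>l<k. f l r" "\<lambda>n. \<Sum>l<k. c l n" x "f k" "c k"] by simp
qed

lemma psb_summable:
  assumes "psb f c x q C" "\<bar>h\<bar> * q < 1" shows "summable (\<lambda>n. norm (h ^ n *\<^sub>R c n))"
proof (rule summable_comparison_test'[of "\<lambda>n. C * (\<bar>h\<bar> * q) ^ n" 0])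
  show "summable (\<lambda>n. C * (\<bar>h\<bar> * q) ^ n)"
    using assms by (intro summable_mult summable_geometric) (auto simp: psb_def)
  show "norm (norm (h ^ n *\<^sub>R c n)) \<le> C * (\<bar>h\<bar> * q) ^ n" for n
    using assms(1) mult_left_mono[of "norm (c n)" "C * q ^ n" "\<bar>h\<bar> ^ n"]
    by (simp add: psb_def power_abs power_mult_distrib mult_ac)
qed

text \<open>The \<open>n + 1\<close> terms of the Cauchy product are absorbed by
  \<open>2 ^ n\<close>, which halves the guaranteed radius.\<close>

lemma ps_at_mult:
  assumes "ps_at f c x" "ps_at g d x"
  shows "ps_at (\<lambda>r. f r * g r) (\<lambda>n. \<Sum>i=0..n. c i * d (n - i)) x"
proof -
  obtain q C C' where p: "psb f c x q C" "psb g d x q C'" using assms by (rule psb_common)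
  have q: "q > 0" using p by (simp add: psb_def)
  have "norm (\<Sum>i=0..n. c i * d (n - i)) \<le> (C * C') * (2 * q) ^ n" for n
  proof -
    have "norm (\<Sum>i=0..n. c i * d (n - i)) \<le> (\<Sum>i=0..n. C * C' * q ^ n)"
    proof (rule sum_norm_le)
      fix i assume "i \<in> {0..n}"
      then have "q ^ i * q ^ (n - i) = q ^ n" by (simp flip: power_add)
      moreover have "norm (c i * d (n - i)) \<le> (C * q ^ i) * (C' * q ^ (n - i))"
        using norm_mult_ineq[of "c i" "d (n - i)"] mult_mono[of "norm (c i)" "C * q ^ i" "norm (d (n - i))" "C' * q ^ (n - i)"]
          p psb_C[OF p(1)] q by (simp add: psb_def)
      ultimately show "norm (c i * d (n - i)) \<le> C * C' * q ^ n" by (simp add: mult_ac)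
    qed
    also have "\<dots> = real (Suc n) * (C * C' * q ^ n)" by simp
    also have "\<dots> \<le> 2 ^ n * (C * C' * q ^ n)"
    proof (rule mult_right_mono)
      have "Suc n \<le> 2 ^ n" using less_exp[of n] by (rule Suc_leI)
      then show "real (Suc n) \<le> 2 ^ n" by (metis of_nat_le_iff of_nat_numeral of_nat_power)
    qed (use q psb_C[OF p(1)] psb_C[OF p(2)] in simp)
    finally show ?thesis by (simp add: power_mult_distrib mult_ac)
  qed
  moreover have "(\<lambda>n. h ^ n *\<^sub>R (\<Sum>i=0..n. c i * d (n - i))) sums (f (x + h) * g (x + h))"
    if "\<bar>h\<bar> * (2 * q) < 1" for h
  proof -
    have h: "\<bar>h\<bar> * q < 1" using that q mult_nonneg_nonneg[of "\<bar>h\<bar>" q] by linarith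
    have "(\<lambda>n. \<Sum>i\<le>n. (h ^ i *\<^sub>R c i) * (h ^ (n - i) *\<^sub>R d (n - i))) sums ((\<Sum>n. h ^ n *\<^sub>R c n) * (\<Sum>n. h ^ n *\<^sub>R d n))"
      by (intro Cauchy_product_sums psb_summable[OF p(1) h] psb_summable[OF p(2) h])
    moreover have "(\<Sum>n. h ^ n *\<^sub>R c n) = f (x + h)" "(\<Sum>n. h ^ n *\<^sub>R d n) = g (x + h)"
      using p h by (auto simp: psb_def sums_iff)
    moreover have "(\<Sum>i\<le>n. (h ^ i *\<^sub>R c i) * (h ^ (n - i) *\<^sub>R d (n - i))) = h ^ n *\<^sub>R (\<Sum>i=0..n. c i * d (n - i))" for n
      unfolding scaleR_sum_right atLeast0AtMost by (intro sum.cong refl) (simp flip: power_add)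
    ultimately show ?thesis by simp
  qed
  ultimately have "psb (\<lambda>r. f r * g r) (\<lambda>n. \<Sum>i=0..n. c i * d (n - i)) x (2 * q) (C * C')"
    using q by (auto simp: psb_def)
  then show ?thesis by (auto simp: ps_at_def)
qed

lemma psb_tail:
  assumes p: "psb f c x q C" and h: "\<bar>h\<bar> * q \<le> 1 / 2"
  shows "norm (f (x + h) - (\<Sum>n<N. h ^ n *\<^sub>R c n)) \<le> 2 * C * (\<bar>h\<bar> * q) ^ N"
proof -
  let ?t = "\<bar>h\<bar> * q"
  have t: "0 \<le> ?t" "?t < 1" using h p by (auto simp: psb_def)
  have s: "(\<lambda>n. h ^ (n + N) *\<^sub>R c (n + N)) sums (f (x + h) - (\<Sum>n<N. h ^ n *\<^sub>R c n))"
    using p t sums_split_initial_segment[of "\<lambda>n. h ^ n *\<^sub>R c n" "f (x + h)" N] by (auto simp: psb_def)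
  have g: "(\<lambda>n. C * ?t ^ N * ?t ^ n) sums (C * ?t ^ N * (1 / (1 - ?t)))"
    using t by (intro sums_mult geometric_sums) simp
  have "norm (\<Sum>n. h ^ (n + N) *\<^sub>R c (n + N)) \<le> (\<Sum>n. C * ?t ^ N * ?t ^ n)"
  proof (rule norm_suminf_le)
    show "norm (h ^ (n + N) *\<^sub>R c (n + N)) \<le> C * ?t ^ N * ?t ^ n" for n
    proof -
      have "norm (c (n + N)) \<le> C * q ^ (n + N)" using p by (simp add: psb_def)
      then have "\<bar>h\<bar> ^ (n + N) * norm (c (n + N)) \<le> \<bar>h\<bar> ^ (n + N) * (C * q ^ (n + N))"
        by (rule mult_left_mono) simp
      then show ?thesis by (simp add: power_abs power_mult_distrib power_add abs_mult mult_ac)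
    qed
  qed (use g in \<open>auto simp: sums_iff\<close>)
  then have "norm (f (x + h) - (\<Sum>n<N. h ^ n *\<^sub>R c n)) \<le> C * ?t ^ N * (1 / (1 - ?t))"
    using s g by (simp add: sums_iff)
  also have "\<dots> \<le> C * ?t ^ N * 2"
  proof (rule mult_left_mono)
    show "1 / (1 - ?t) \<le> 2" using h t by (simp add: pos_divide_le_eq)
    show "0 \<le> C * ?t ^ N" using psb_C[OF p] t by simp
  qed
  finally show ?thesis by simp
qed

text \<open>If the earlier coefficients vanish, a zero at distance \<open>h\<close> bounds the norm
  of \<open>c N\<close> by a multiple of the absolute value of \<open>h\<close>; zeros accumulate at
  \<open>x\<close>.\<close>

lemma ps_at_zero_coeffs:
  assumes p: "ps_at f c x" and z: "\<And>e. e > 0 \<Longrightarrow> \<exists>h. h \<noteq> 0 \<and> \<bar>h\<bar> < e \<and> f (x + h) = 0"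
  shows "c n = 0"
proof -
  obtain q C where p: "psb f c x q C" using p by (auto simp: ps_at_def)
  have q: "q > 0" and C: "C \<ge> 0" using p psb_C[OF p] by (auto simp: psb_def)
  show ?thesis
  proof (induction n rule: less_induct)
    case (less N)
    have "norm (c N) \<le> 0 + e" if "e > 0" for e
    proof -
      define e' where "e' = min (1 / (2 * q)) (e / (2 * C * q ^ Suc N + 1))"
      have K: "2 * C * q ^ Suc N + 1 > 0" using C q by (simp add: add_nonneg_pos)
      have "e' > 0" using q K that by (simp add: e'_def)
      then obtain h where h: "h \<noteq> 0" "\<bar>h\<bar> < e'" "f (x + h) = 0" using z by blast
      have hq: "\<bar>h\<bar> * q \<le> 1 / 2" using h(2) q by (simp add: e'_def field_simps)
      have he: "\<bar>h\<bar> * (2 * C * q ^ Suc N + 1) < e" using h(2) K by (simp add: e'_def pos_less_divide_eq)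
      have "(\<Sum>n<Suc N. h ^ n *\<^sub>R c n) = h ^ N *\<^sub>R c N" using less by simp
      then have "\<bar>h\<bar> ^ N * norm (c N) \<le> 2 * C * (\<bar>h\<bar> * q) ^ Suc N"
        using psb_tail[OF p hq, of "Suc N"] h(3) by (simp add: power_abs)
      then have "\<bar>h\<bar> ^ N * norm (c N) \<le> \<bar>h\<bar> ^ N * (\<bar>h\<bar> * (2 * C * q ^ Suc N))"
        by (simp add: power_mult_distrib mult_ac)
      then have "norm (c N) \<le> \<bar>h\<bar> * (2 * C * q ^ Suc N)" using h(1) by (simp add: mult_le_cancel_left)
      then show ?thesis using he h(1) by (simp add: distrib_left)
    qed
    then have "norm (c N) \<le> 0" by (rule field_le_epsilon)
    then show ?case by simp
  qed
qed

lemma ps_at_zero: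
  assumes "ps_at f c x" "\<And>n. c n = 0" obtains q where "q > 0" "\<And>h. \<bar>h\<bar> < q \<Longrightarrow> f (x + h) = 0"
proof -
  obtain q C where p: "psb f c x q C" using assms by (auto simp: ps_at_def)
  have "f (x + h) = 0" if "\<bar>h\<bar> < 1 / q" for h
  proof -
    have "\<bar>h\<bar> * q < 1" using that p by (simp add: psb_def field_simps)
    then have "(\<lambda>n. h ^ n *\<^sub>R c n) sums f (x + h)" using p by (simp add: psb_def)
    then show ?thesis using assms(2) by (simp add: sums_iff)
  qed
  moreover have "1 / q > 0" using p by (simp add: psb_def)
  ultimately show ?thesis using that by blast
qed

text \<open>The points near which \<open>f\<close> vanishes form an open and closed subset of the
  line.\<close>

lemma analytic_identity:
  assumes an: "\<And>x. \<exists>c. ps_at f c x" and z: "ps_at f c 0" "\<And>n. c n = 0"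
  shows "f r = 0"
proof -
  define S where "S = {x. \<exists>q>0. \<forall>h. \<bar>h\<bar> < q \<longrightarrow> f (x + h) = 0}"
  have "open S" unfolding open_dist
  proof
    fix x assume "x \<in> S"
    then obtain q where q: "q > 0" "\<And>h. \<bar>h\<bar> < q \<Longrightarrow> f (x + h) = 0" by (auto simp: S_def)
    have "y \<in> S" if "dist y x < q / 2" for y
    proof -
      have "f (y + h) = 0" if "\<bar>h\<bar> < q / 2" for h
      proof -
        have "\<bar>y - x + h\<bar> < q"
          using that \<open>dist y x < q / 2\<close> abs_triangle_ineq[of "y - x" h] unfolding dist_real_def by linarith
        from q(2)[OF this] show ?thesis by simp
      qed
      then show ?thesis using q(1) by (auto simp: S_def intro!: exI[of _ "q / 2"])
    qed
    then show "\<exists>e>0. \<forall>y. dist y x < e \<longrightarrow> y \<in> S" using q(1) by (intro exI[of _ "q / 2"]) auto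
  qed
  moreover have "closed S" unfolding closed_sequential_limits
  proof (intro allI impI, elim conjE)
    fix X x assume X: "\<forall>n. X n \<in> S" "X \<longlonglongrightarrow> x"
    obtain c where c: "ps_at f c x" using an by blast
    have "c n = 0" for n
    proof (rule ps_at_zero_coeffs[OF c])
      fix e :: real assume e: "e > 0"
      then obtain N where "\<bar>X N - x\<bar> < e / 2" using X(2) unfolding LIMSEQ_def dist_real_def
        by (meson half_gt_zero order_refl)
      obtain q where q: "q > 0" "\<And>h. \<bar>h\<bar> < q \<Longrightarrow> f (X N + h) = 0" using X(1) by (auto simp: S_def)
      define d where "d = min q e / 4"
      have d: "d > 0" "d < q" "d < e / 2" using q e by (auto simp: d_def min_def)
      \<comment> \<open>When \<open>X N\<close> equals \<open>x\<close>, the neighbouring zero at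
        distance \<open>d\<close> is used, because a zero different from \<open>x\<close> is
        required.\<close>
      define h where "h = (if X N - x = 0 then d else X N - x)"
      have "f (x + h) = 0" using q(2)[of 0] q(2)[of d] q(1) d by (auto simp: h_def)
      moreover have "h \<noteq> 0" "\<bar>h\<bar> < e" using d \<open>\<bar>X N - x\<bar> < e / 2\<close> e by (auto simp: h_def)
      ultimately show "\<exists>h. h \<noteq> 0 \<and> \<bar>h\<bar> < e \<and> f (x + h) = 0" by blast
    qed
    then obtain q where "q > 0" "\<And>h. \<bar>h\<bar> < q \<Longrightarrow> f (x + h) = 0" using ps_at_zero[OF c] by metis
    then show "x \<in> S" by (auto simp: S_def)
  qed
  moreover have "0 \<in> S" using ps_at_zero[OF z] unfolding S_def by auto
  ultimately have "S = UNIV" using clopen[of S] by auto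
  then have "r \<in> S" by simp
  then obtain q where "q > 0" "\<And>h. \<bar>h\<bar> < q \<Longrightarrow> f (r + h) = 0" by (auto simp: S_def)
  from this(2)[of 0] this(1) show ?thesis by simp
qed

lemma ps_at_derivative:
  assumes "ps_at f c x" shows "(f has_vector_derivative c 1) (at x)"
proof -
  obtain q C where p: "psb f c x q C" using assms by (auto simp: ps_at_def)
  have q: "q > 0" and C: "C \<ge> 0" using p psb_C[OF p] by (auto simp: psb_def)
  have f0: "f x = c 0" using psb_tail[OF p, of 0 1] by simp
  have b: "norm (f (x + h) - f x - h *\<^sub>R c 1) / norm h \<le> 2 * C * q\<^sup>2 * norm h" if "norm h < 1 / (2 * q)" for h
  proof (cases "h = 0")
    case False
    have "\<bar>h\<bar> * q \<le> 1 / 2" using that q by (simp add: field_simps)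
    from psb_tail[OF p this, of 2] have "norm (f (x + h) - f x - h *\<^sub>R c 1) \<le> 2 * C * (\<bar>h\<bar> * q)\<^sup>2"
      by (simp add: f0 numeral_2_eq_2 diff_diff_eq)
    also have "\<dots> = 2 * C * q\<^sup>2 * norm h * norm h" by (simp only: power2_eq_square mult_ac real_norm_def)
    finally have "norm (f (x + h) - f x - h *\<^sub>R c 1) \<le> 2 * C * q\<^sup>2 * norm h * norm h" .
    then show ?thesis using False by (simp add: pos_divide_le_eq)
  qed simp
  have "(\<lambda>h. norm (f (x + h) - f x - h *\<^sub>R c 1) / norm h) \<midarrow>0\<rightarrow> 0"
  proof (rule tendsto_sandwich[where f = "\<lambda>_. 0" and h = "\<lambda>h. 2 * C * q\<^sup>2 * norm h"])
    show "\<forall>\<^sub>F h in at 0. norm (f (x + h) - f x - h *\<^sub>R c 1) / norm h \<le> 2 * C * q\<^sup>2 * norm h"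
      unfolding eventually_at using b q by (intro exI[of _ "1 / (2 * q)"]) (auto simp: dist_real_def)
    have "(\<lambda>h::real. 2 * C * q\<^sup>2 * norm h) \<midarrow>0\<rightarrow> 2 * C * q\<^sup>2 * norm (0::real)" by (intro tendsto_intros)
    then show "(\<lambda>h::real. 2 * C * q\<^sup>2 * norm h) \<midarrow>0\<rightarrow> 0" by simp
  qed auto
  then show ?thesis unfolding has_vector_derivative_def has_derivative_at
    by (simp add: bounded_linear_scaleR_left)
qed

text \<open>Convergence is demanded entrywise, as \<open>fmat\<close> is not complete. The
  coefficients still form a power series over \<open>fmat\<close>, so products of functions
  correspond to products of series.\<close>

definition mps :: "nat \<Rightarrow> (real \<Rightarrow> 'a::cstar_algebra fmat) \<Rightarrow> 'a fmat fps \<Rightarrow> real \<Rightarrow> bool" where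
  "mps k f c x \<longleftrightarrow> (\<forall>r. corner k (f r)) \<and> (\<forall>n. corner k (fps_nth c n)) \<and>
     (\<forall>i j. ps_at (\<lambda>r. ent (f r) i j) (\<lambda>n. ent (fps_nth c n) i j) x)"

lemma mps_mult: "mps k f c x \<Longrightarrow> mps k g d x \<Longrightarrow> mps k (\<lambda>r. f r * g r) (c * d) x"
proof -
  assume p: "mps k f c x" "mps k g d x"
  have co: "corner k (f r)" "corner k (g r)" "corner k (fps_nth c n)" "corner k (fps_nth d n)" for r n
    using p by (auto simp: mps_def)
  have "ps_at (\<lambda>r. ent (f r * g r) i j) (\<lambda>n. ent (fps_nth (c * d) n) i j) x" for i j
  proof -
    have "ps_at (\<lambda>r. \<Sum>l<k. ent (f r) i l * ent (g r) l j)
      (\<lambda>n. \<Sum>l<k. \<Sum>q=0..n. ent (fps_nth c q) i l * ent (fps_nth d (n - q)) l j) x"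
      using p by (intro ps_at_sum ps_at_mult) (auto simp: mps_def)
    moreover have "(\<Sum>l<k. \<Sum>q=0..n. ent (fps_nth c q) i l * ent (fps_nth d (n - q)) l j) = ent (fps_nth (c * d) n) i j" for n
      by (simp add: fps_mult_nth ent_sum ent_times[OF co(3)]) (rule sum.swap)
    ultimately show ?thesis by (simp add: ent_times[OF co(1)])
  qed
  moreover have "corner k (fps_nth (c * d) n)" for n
    unfolding fps_mult_nth by (intro corner_sum corner_times co)
  ultimately show ?thesis using co by (auto simp: mps_def intro: corner_times)
qed

lemma mps_map:
  assumes T: "bounded_linear t" "\<And>X i j. corner k X \<Longrightarrow> ent (T X) i j = t (ent X i j)" and p: "mps k f c x"
  shows "mps k (\<lambda>r. T (f r)) (Abs_fps (\<lambda>n. T (fps_nth c n))) x"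
proof -
  have "corner k (T X)" if "corner k X" for X
    using that T(2)[OF that] linear_0[OF bounded_linear.linear[OF T(1)]] by (simp add: corner_def)
  then show ?thesis using p T(2) ps_at_bounded_linear[OF T(1)] by (auto simp: mps_def)
qed

lemma mps_const: "corner k X \<Longrightarrow> mps k (\<lambda>_. X) (fps_const X) x"
proof -
  assume X: "corner k X"
  have "ps_at (\<lambda>r. ent X i j) (\<lambda>n. ent (fps_nth (fps_const X) n) i j) x" for i j
    by (rule ps_at_finite[of 1]) auto
  then show ?thesis using X by (auto simp: mps_def)
qed

definition idser :: "nat \<Rightarrow> real \<Rightarrow> 'a::cstar_algebra fmat fps" where
  "idser k x = Abs_fps (\<lambda>n. if n = 0 then x *\<^sub>R dg k 1 else if n = 1 then dg k 1 else 0)"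

lemma mps_id: "mps k (\<lambda>r. r *\<^sub>R dg k 1) (idser k x) x"
proof -
  have "ps_at (\<lambda>r. ent (r *\<^sub>R dg k 1) i j) (\<lambda>n. ent (fps_nth (idser k x) n) i j) x" for i j
    by (rule ps_at_finite[of 2]) (auto simp: idser_def numeral_2_eq_2 scaleR_add_left)
  then show ?thesis by (auto simp: mps_def idser_def corner_scaleR)
qed

lemma idser_times: "fps_nth (idser k 0 * g) n = (if n = 0 then 0 else dg k 1 * fps_nth g (n - 1))"
proof (cases n)
  case (Suc m)
  have "fps_nth (idser k 0 * g) n = (\<Sum>i=0..n. if i = 1 then dg k 1 * fps_nth g (n - 1) else 0)"
    unfolding fps_mult_nth by (intro sum.cong refl) (auto simp: idser_def)
  then show ?thesis using Suc by simp
qed (simp add: fps_mult_nth idser_def)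

section \<open>The differential equation of the arcsine flow\<close>

context arcsine_half_plane
begin

lemma sA: "cstar (r *\<^sub>R A) = r *\<^sub>R A"
  by (simp add: cstar_simps A_selfadj)

text \<open>The resolvent is bounded by \<open>D\<close> for every real \<open>r\<close>, so
  \<open>q\<close>, and with it the guaranteed radius, is the same at every
  \<open>x\<close>.\<close>

lemma mps_rs:
  assumes b: "up b"
  shows "mps k (\<lambda>r. rs (r *\<^sub>R A) b) (Abs_fps (rmom (rs (x *\<^sub>R A) b) (dg k A))) x"
proof -
  define R0 a where "R0 = rs (x *\<^sub>R A) b" and "a = dg k A"
  have cR: "corner k (rs (r *\<^sub>R A) b)" for r by (rule up_rs_corner[OF b sA])
  have cR0: "corner k R0" and nR0: "norm R0 \<le> D" unfolding R0_def using up_rs(2)[OF b sA] cR by auto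
  have co: "corner k (rmom R0 a n)" for n unfolding a_def by (intro corner_rmom cR0 corner_dg)
  have na: "norm a \<le> norm A" by (simp add: a_def norm_dg_le)
  define q where "q = D * norm A + 1"
  have q: "q > 0" "D * norm A \<le> q" using D_nonneg by (auto simp: q_def add_nonneg_pos)
  have n1: "norm (R0 * a) \<le> D * norm A"
    using norm_mult_ineq[of R0 a] mult_mono[OF nR0 na D_nonneg] by simp
  define lp where "lp X = rec_nat X (\<lambda>_ Z. R0 * a * Z)" for X
  have lp: "lp X 0 = X" "lp X (Suc n) = R0 * a * lp X n" for X n by (simp_all add: lp_def)
  have nlp: "norm (lp X n) \<le> norm X * q ^ n" for X n
  proof (induction n)
    case (Suc n)
    have "norm (lp X (Suc n)) \<le> norm (R0 * a) * norm (lp X n)" unfolding lp by (rule norm_mult_ineq)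
    also have "\<dots> \<le> q * (norm X * q ^ n)"
      using n1 q Suc by (intro mult_mono) auto
    finally show ?case by (simp add: mult_ac)
  qed (simp add: lp)
  have rl: "rmom R0 a n = lp R0 n" for n by (induction n) (auto simp: lp)
  have "psb (\<lambda>r. ent (rs (r *\<^sub>R A) b) i j) (\<lambda>n. ent (rmom R0 a n) i j) x q D" for i j
    unfolding psb_def
  proof (intro conjI allI impI)
    show "norm (ent (rmom R0 a n) i j) \<le> D * q ^ n" for n
      using norm_ent_le[of "rmom R0 a n" i j] nlp[of R0 n] mult_right_mono[OF nR0, of "q ^ n"]
        zero_le_power[of q n] q(1) unfolding rl by linarith
    fix h assume h: "\<bar>h\<bar> * q < 1"
    define R' where "R' = rs ((x + h) *\<^sub>R A) b"
    have R': "R' = R0 + h *\<^sub>R (R0 * a * R')"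
    proof -
      have e: "(b - dg k ((x + h) *\<^sub>R A)) * R' = dg k 1" "R0 * (b - dg k (x *\<^sub>R A)) = dg k 1"
        unfolding R'_def R0_def by (rule up_rs_eqs[OF b sA])+
      have d: "b - dg k ((x + h) *\<^sub>R A) = (b - dg k (x *\<^sub>R A)) - h *\<^sub>R a"
        by (simp add: a_def dg_plus dg_scaleR scaleR_add_left)
      have "R0 * ((b - dg k ((x + h) *\<^sub>R A)) * R') = (R0 * (b - dg k (x *\<^sub>R A))) * R' - h *\<^sub>R (R0 * a * R')"
        unfolding d by (simp add: left_diff_distrib right_diff_distrib mult.assoc)
      then have "R0 = R' - h *\<^sub>R (R0 * a * R')"
        using e dg_one_right[OF cR0] dg_one_left[OF cR[of "x + h"]] by (simp add: R'_def)
      then show ?thesis by (metis diff_add_cancel)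
    qed
    have step: "lp R' N = lp R0 N + h *\<^sub>R lp R' (Suc N)" for N
    proof (induction N)
      case 0 then show ?case using R' by (simp add: lp)
    next
      case (Suc N)
      have "R0 * a * lp R' N = R0 * a * (lp R0 N + h *\<^sub>R lp R' (Suc N))"
        by (rule arg_cong[OF Suc.IH])
      then show ?case by (simp only: distrib_left mult_scaleR_right lp(2)[symmetric])
    qed
    \<comment> \<open>A finite expansion with explicit remainder; the limit is then taken in the
      entries.\<close>
    have part: "R' = (\<Sum>n<N. h ^ n *\<^sub>R lp R0 n) + h ^ N *\<^sub>R lp R' N" for N
    proof (induction N)
      case (Suc N)
      have "h ^ N *\<^sub>R lp R' N = h ^ N *\<^sub>R lp R0 N + h ^ Suc N *\<^sub>R lp R' (Suc N)"
        by (subst step) (simp add: scaleR_add_right mult.commute)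
      then show ?case using Suc by (simp add: add.assoc)
    qed (simp add: lp)
    have "(\<lambda>N. ent R' i j - h ^ N *\<^sub>R ent (lp R' N) i j) \<longlonglongrightarrow> ent R' i j - 0"
    proof (intro tendsto_intros)
      show "(\<lambda>N. h ^ N *\<^sub>R ent (lp R' N) i j) \<longlonglongrightarrow> 0"
      proof (rule Lim_null_comparison)
        have "norm (h ^ N *\<^sub>R ent (lp R' N) i j) \<le> norm R' * (\<bar>h\<bar> * q) ^ N" for N
        proof -
          have "\<bar>h\<bar> ^ N * norm (ent (lp R' N) i j) \<le> \<bar>h\<bar> ^ N * (norm R' * q ^ N)"
            using norm_ent_le[of "lp R' N" i j] nlp[of R' N] by (intro mult_left_mono) auto
          then show ?thesis by (simp add: power_abs power_mult_distrib mult_ac)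
        qed
        then show "\<forall>\<^sub>F N in sequentially. norm (h ^ N *\<^sub>R ent (lp R' N) i j) \<le> norm R' * (\<bar>h\<bar> * q) ^ N"
          by (intro always_eventually) blast
        show "(\<lambda>N. norm R' * (\<bar>h\<bar> * q) ^ N) \<longlonglongrightarrow> 0"
          using h q by (intro tendsto_mult_right_zero LIMSEQ_realpow_zero) auto
      qed
    qed
    moreover have "(\<Sum>n<N. h ^ n *\<^sub>R ent (rmom R0 a n) i j) = ent R' i j - h ^ N *\<^sub>R ent (lp R' N) i j" for N
      using arg_cong[OF part[of N], of "\<lambda>X. ent X i j"] by (simp add: ent_sum rl)
    ultimately show "(\<lambda>n. h ^ n *\<^sub>R ent (rmom R0 a n) i j) sums ent (rs ((x + h) *\<^sub>R A) b) i j"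
      by (simp add: sums_def R'_def)
  qed (rule q)
  then show ?thesis using cR co by (auto simp: mps_def ps_at_def R0_def a_def)
qed

text \<open>The parameter \<open>r\<close> is the square root of time. By \<open>Ht_ode\<close>, the
  quantity \<open>Wt\<close> is the derivative of \<open>Ht\<close> with respect to
  \<open>r^2\<close> away from zero.\<close>

definition Ht :: "'a fmat \<Rightarrow> real \<Rightarrow> 'a fmat" where "Ht b r = gs (r *\<^sub>R A) b"
definition Wt :: "'a fmat \<Rightarrow> real \<Rightarrow> 'a fmat" where "Wt b r = Ht b r * evf (Ht b r) * Ht b r"

lemma corner_Ht: "up b \<Longrightarrow> corner k (Ht b r)"
  unfolding Ht_def by (rule gs_corner[OF _ sA])

lemma bounded_linear_ev: "bounded_linear ev"
proof (rule bounded_linear_intro[of _ "norm V * norm V"])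
  show "norm (ev x) \<le> norm x * (norm V * norm V)" for x
  proof -
    have "norm (V * x * V) \<le> norm V * norm x * norm V"
      by (rule norm_mult3_le)
    then show ?thesis using norm_E_le[of "V * x * V"] by (simp add: ev_def mult_ac)
  qed
qed (auto simp: ev_add ev_scaleR)

lemma mps_Ht: "up b \<Longrightarrow> mps k (Ht b) (Abs_fps (\<lambda>n. Ef (rmom (rs (x *\<^sub>R A) b) (dg k A) n))) x"
  using mps_map[OF bounded_linear_E _ mps_rs[of b x], of Ef] by (simp add: Ht_def[abs_def] gs_def)

text \<open>The left side is the \<open>r\<close>-derivative of \<open>Ht b\<close>. Multiplied by
  \<open>r\<close>, it becomes the degree derivation at the level of power series at zero, where
  \<open>fdeg_moser\<close> identifies both sides; \<open>analytic_identity\<close> carries the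
  equation to all \<open>r\<close>, and \<open>r\<close> is cancelled at the end.\<close>

lemma Ht_ode:
  assumes b: "up b" and r: "r \<noteq> 0"
  shows "Ef (rs (r *\<^sub>R A) b * dg k A * rs (r *\<^sub>R A) b) = (2 * r) *\<^sub>R Wt b r"
proof -
  let ?R = "\<lambda>r. rs (r *\<^sub>R A) b" and ?I = "\<lambda>r. r *\<^sub>R dg k (1::'a)"
  define f1 f2 where "f1 r = ?I r * Ef (?R r * dg k A * ?R r)"
    and "f2 r = Ht b r * (?I r * (?I r * (2 *\<^sub>R evf (Ht b r)))) * Ht b r" for r
  define Rs Hs where "Rs x = Abs_fps (rmom (?R x) (dg k A))"
    and "Hs x = Abs_fps (\<lambda>n. Ef (rmom (?R x) (dg k A) n))" for x
  have bl2: "bounded_linear (\<lambda>x. 2 *\<^sub>R ev x)"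
    by (intro bounded_linear_compose[OF bounded_linear_scaleR_right bounded_linear_ev])
  define c1 c2 where "c1 x = idser k x * Abs_fps (\<lambda>n. Ef (fps_nth (Rs x * fps_const (dg k A) * Rs x) n))"
    and "c2 x = Hs x * (idser k x * (idser k x * Abs_fps (\<lambda>n. 2 *\<^sub>R evf (fps_nth (Hs x) n)))) * Hs x" for x
  have m1: "mps k f1 (c1 x) x" for x
    unfolding f1_def[abs_def] c1_def Rs_def
    by (intro mps_mult mps_id mps_map[OF bounded_linear_E] mps_rs[OF b] mps_const) simp_all
  have m2: "mps k f2 (c2 x) x" for x
    unfolding f2_def[abs_def] c2_def Hs_def
    by (intro mps_mult mps_id mps_map[OF bl2] mps_Ht[OF b]) (simp add: ent_evf)
  have c12: "c1 0 = c2 0"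
  proof -
    define c where "c = rs 0 b"
    have oc: "ovr k B c" unfolding c_def using calg_B by (intro up_rs(3)[OF b _ calg_B]) (auto intro: calgD)
    have cc: "corner k c" by (rule ovr_corner[OF oc])
    have H0: "Hs 0 = moser c" by (simp add: Hs_def moser_def mo_def[abs_def] c_def)
    have cf: "corner k (evf (mo c n))" for n by (intro corner_evf corner_mo cc)
    have "idser k 0 * (idser k 0 * Abs_fps (\<lambda>n. 2 *\<^sub>R evf (fps_nth (Hs 0) n))) = covser c"
    proof (rule fps_ext)
      fix n
      consider "n = 0" | "n = 1" | d where "n = Suc (Suc d)" by (metis One_nat_def not0_implies_Suc)
      then show "fps_nth (idser k 0 * (idser k 0 * Abs_fps (\<lambda>n. 2 *\<^sub>R evf (fps_nth (Hs 0) n)))) n = fps_nth (covser c) n"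
        unfolding idser_times by cases (auto simp: covser_def H0 moser_def dg_one_left[OF cf])
    qed
    then have 2: "c2 0 = moser c * covser c * moser c" by (simp add: c2_def H0)
    have "c1 0 = fdeg (moser c)"
    proof (rule fps_ext)
      fix n
      show "fps_nth (c1 0) n = fps_nth (fdeg (moser c)) n"
      proof (cases n)
        case (Suc m)
        have "fps_nth (Rs 0 * fps_const (dg k A) * Rs 0) m = (\<Sum>i=0..m. rmom c (dg k A) i * dg k A * rmom c (dg k A) (m - i))"
          unfolding fps_mult_nth[of "Rs 0 * fps_const (dg k A)"] by (simp add: Rs_def c_def)
        also have "\<dots> = (\<Sum>i=0..m. rmom c (dg k A) (Suc m))"
          by (intro sum.cong refl) (simp add: rmom_mult del: rmom.simps)
        also have "\<dots> = real (Suc m) *\<^sub>R rmom c (dg k A) (Suc m)" by (simp add: sum_constant_scaleR del: sum_constant rmom.simps)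
        finally have "Ef (fps_nth (Rs 0 * fps_const (dg k A) * Rs 0) m) = real (Suc m) *\<^sub>R mo c (Suc m)"
          by (simp add: mo_def Ef_scaleR del: rmom.simps)
        then show ?thesis using Suc dg_one_left[OF corner_mo[OF cc, of "Suc m"]]
          by (simp add: c1_def idser_times fdeg_def moser_def)
      qed (simp add: c1_def idser_def fdeg_def)
    qed
    then show ?thesis using 2 fdeg_moser[OF oc] by simp
  qed
  have "ent (f1 r) i j - ent (f2 r) i j = 0" for i j
  proof (rule analytic_identity[where c = "\<lambda>n. ent (fps_nth (c1 0) n) i j + (- 1) *\<^sub>R ent (fps_nth (c2 0) n) i j"])
    have "ps_at (\<lambda>r. ent (f1 r) i j + (- 1) *\<^sub>R ent (f2 r) i j) (\<lambda>n. ent (fps_nth (c1 x) n) i j + (- 1) *\<^sub>R ent (fps_nth (c2 x) n) i j) x" for x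
      using m1 m2 by (intro ps_at_plus ps_at_bounded_linear[OF bounded_linear_scaleR_right]) (auto simp: mps_def)
    then have p: "ps_at (\<lambda>r. ent (f1 r) i j - ent (f2 r) i j) (\<lambda>n. ent (fps_nth (c1 x) n) i j + (- 1) *\<^sub>R ent (fps_nth (c2 x) n) i j) x" for x
      by simp
    show "ps_at (\<lambda>r. ent (f1 r) i j - ent (f2 r) i j) (\<lambda>n. ent (fps_nth (c1 0) n) i j + (- 1) *\<^sub>R ent (fps_nth (c2 0) n) i j) 0" by (rule p)
    show "\<exists>c. ps_at (\<lambda>r. ent (f1 r) i j - ent (f2 r) i j) c x" for x using p by blast
    show "ent (fps_nth (c1 0) n) i j + (- 1) *\<^sub>R ent (fps_nth (c2 0) n) i j = 0" for n by (simp add: c12)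
  qed
  then have "f1 r = f2 r" by (intro fmat_eqI) simp
  moreover have cR: "corner k (?R r)" by (rule up_rs_corner[OF b sA])
  have "f1 r = r *\<^sub>R Ef (?R r * dg k A * ?R r)"
    unfolding f1_def using dg_one_left[OF corner_Ef[OF corner_times[OF corner_times[OF cR corner_dg] cR]]] by simp
  moreover have "f2 r = (r * (r * 2)) *\<^sub>R Wt b r"
    unfolding f2_def Wt_def using dg_one_left[OF corner_evf[OF corner_Ht[OF b]]] by simp
  ultimately have "r *\<^sub>R Ef (?R r * dg k A * ?R r) = r *\<^sub>R ((2 * r) *\<^sub>R Wt b r)" by (simp add: mult_ac)
  then show ?thesis using r by (metis scaleR_cancel_left)
qed

lemma norm_evf_le: "corner k X \<Longrightarrow> norm (evf X) \<le> (norm V)\<^sup>2 * norm X"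
proof -
  assume X: "corner k X"
  have "norm (evf X) \<le> norm (dg k V * X * dg k V)" unfolding evf_def
    by (intro norm_Ef_le[of k] corner_times corner_dg X)
  also have "\<dots> \<le> norm V * norm X * norm V" by (intro norm_mult3_mono norm_dg_le) simp
  finally show ?thesis by (simp add: power2_eq_square mult_ac)
qed

lemma evf_minus: "evf (X - X') = evf X - evf X'"
  by (simp add: evf_def left_diff_distrib right_diff_distrib Ef_minus)

definition "lipH = D\<^sup>2 * norm A"
definition "lipW = 3 * ((norm V)\<^sup>2 * D\<^sup>2) * lipH"

lemma lipH_nonneg: "0 \<le> lipH" and lipW_nonneg: "0 \<le> lipW"
  by (auto simp: lipH_def lipW_def)

lemma norm_Ht_le: "up b \<Longrightarrow> norm (Ht b r) \<le> D"
  unfolding Ht_def by (rule norm_gs_le[OF _ sA])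

lemma norm_evf_Ht_le: "up b \<Longrightarrow> norm (evf (Ht b r)) \<le> (norm V)\<^sup>2 * D"
  by (rule order_trans[OF norm_evf_le[OF corner_Ht] mult_left_mono[OF norm_Ht_le]]) auto

lemma Ht_diff_le:
  assumes b: "up b" shows "norm (Ht b r - Ht b s) \<le> lipH * \<bar>r - s\<bar>"
proof -
  let ?R = "\<lambda>r. rs (r *\<^sub>R A) b"
  have c: "corner k (?R r)" for r by (rule up_rs_corner[OF b sA])
  have "?R r * ((r - s) *\<^sub>R dg k A) * ?R s = ?R r * ((b - dg k (s *\<^sub>R A)) - (b - dg k (r *\<^sub>R A))) * ?R s"
    by (simp add: dg_scaleR scaleR_diff_left)
  also have "\<dots> = ?R r * ((b - dg k (s *\<^sub>R A)) * ?R s) - (?R r * (b - dg k (r *\<^sub>R A))) * ?R s"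
    by (simp only: left_diff_distrib right_diff_distrib mult.assoc)
  also have "\<dots> = ?R r - ?R s"
    by (simp only: up_rs_eqs[OF b sA] dg_one_left[OF c] dg_one_right[OF c])
  finally have "Ht b r - Ht b s = Ef (?R r * ((r - s) *\<^sub>R dg k A) * ?R s)" by (simp add: Ht_def gs_def Ef_minus)
  also have "norm \<dots> \<le> norm (?R r * ((r - s) *\<^sub>R dg k A) * ?R s)"
    by (intro norm_Ef_le[of k] corner_times corner_scaleR corner_dg c)
  also have "\<dots> \<le> D * (\<bar>r - s\<bar> * norm A) * D"
    by (intro norm_mult3_mono up_rs(2)[OF b sA]) (auto intro: mult_left_mono norm_dg_le)
  finally show ?thesis by (simp add: lipH_def power2_eq_square mult_ac)
qed

lemma Wt_diff_le:
  assumes b: "up b" shows "norm (Wt b r - Wt b s) \<le> lipW * \<bar>r - s\<bar>"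
proof -
  let ?v = "(norm V)\<^sup>2" and ?l = "lipH * \<bar>r - s\<bar>"
  define X X' Z Z' where "X = Ht b r" and "X' = Ht b s" and "Z = evf X" and "Z' = evf X'"
  have n: "norm X \<le> D" "norm X' \<le> D" "norm Z \<le> ?v * D" "norm Z' \<le> ?v * D" "norm (X - X') \<le> ?l"
    using norm_Ht_le norm_evf_Ht_le Ht_diff_le b by (auto simp: X_def X'_def Z_def Z'_def)
  have nZ: "norm (Z - Z') \<le> ?v * ?l"
  proof -
    have "norm (Z - Z') \<le> ?v * norm (X - X')" unfolding Z_def Z'_def evf_minus[symmetric]
      using b by (intro norm_evf_le corner_minus) (auto simp: X_def X'_def corner_Ht)
    then show ?thesis using n(5) mult_left_mono[of "norm (X - X')" ?l ?v] by simp
  qed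
  have "Wt b r - Wt b s = (X - X') * Z * X + X' * (Z - Z') * X + X' * Z' * (X - X')"
    by (simp add: Wt_def X_def X'_def Z_def Z'_def algebra_simps)
  then have "norm (Wt b r - Wt b s) \<le> norm ((X - X') * Z * X) + norm (X' * (Z - Z') * X) + norm (X' * Z' * (X - X'))"
    by (metis norm_triangle_ineq norm_triangle_mono order_refl)
  also have "\<dots> \<le> ?l * (?v * D) * D + D * (?v * ?l) * D + D * (?v * D) * ?l"
    by (intro add_mono norm_mult3_mono n nZ)
  also have "\<dots> = lipW * \<bar>r - s\<bar>" by (simp add: lipW_def power2_eq_square algebra_simps)
  finally show ?thesis .
qed

lemma Ht_step:
  assumes b: "up b" and r: "0 \<le> r" "r < s"
  shows "norm (Ht b s - Ht b r - (s\<^sup>2 - r\<^sup>2) *\<^sub>R Wt b r) \<le> (real k)\<^sup>2 * (lipW * (s - r) * (s\<^sup>2 - r\<^sup>2))"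
proof -
  let ?L = "lipW * (s - r)"
  have c: "corner k (Wt b t)" for t unfolding Wt_def by (intro corner_times corner_evf corner_Ht b)
  have e: "norm (ent (Ht b s - Ht b r - (s\<^sup>2 - r\<^sup>2) *\<^sub>R Wt b r) i j) \<le> ?L * (s\<^sup>2 - r\<^sup>2)" for i j
  proof -
    define \<phi> where "\<phi> t = ent (Ht b t) i j - t\<^sup>2 *\<^sub>R ent (Wt b r) i j" for t
    define \<phi>' where "\<phi>' t = ent (Ef (rs (t *\<^sub>R A) b * dg k A * rs (t *\<^sub>R A) b)) i j - (2 * t) *\<^sub>R ent (Wt b r) i j" for t
    have d: "(\<phi> has_vector_derivative \<phi>' t) (at t)" for t
    proof -
      have "ps_at (\<lambda>r. ent (Ht b r) i j) (\<lambda>n. ent (Ef (rmom (rs (t *\<^sub>R A) b) (dg k A) n)) i j) t"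
        using mps_Ht[OF b, of t] by (auto simp: mps_def)
      from ps_at_derivative[OF this]
      have 1: "((\<lambda>r. ent (Ht b r) i j) has_vector_derivative ent (Ef (rs (t *\<^sub>R A) b * dg k A * rs (t *\<^sub>R A) b)) i j) (at t)"
        by simp
      have "((\<lambda>t. t\<^sup>2) has_real_derivative 2 * t) (at t)" by (auto intro!: derivative_eq_intros)
      then have "((\<lambda>t. t\<^sup>2) has_vector_derivative 2 * t) (at t)"
        by (simp add: has_real_derivative_iff_has_vector_derivative)
      then have 2: "((\<lambda>t. t\<^sup>2 *\<^sub>R ent (Wt b r) i j) has_vector_derivative (2 * t) *\<^sub>R ent (Wt b r) i j) (at t)"
        by (rule bounded_linear.has_vector_derivative[OF bounded_linear_scaleR_left])
      show ?thesis unfolding \<phi>_def \<phi>'_def by (rule has_vector_derivative_diff[OF 1 2])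
    qed
    have "norm (\<phi> s - \<phi> r) \<le> ?L * s\<^sup>2 - ?L * r\<^sup>2"
    proof (rule differentiable_bound_general[OF r(2), where f' = \<phi>'
          and \<phi> = "\<lambda>t. ?L * t\<^sup>2" and \<phi>' = "\<lambda>t. ?L * (2 * t)"])
      show "continuous_on {r..s} \<phi>"
        by (rule continuous_at_imp_continuous_on) (use d has_vector_derivative_continuous in blast)
      show "continuous_on {r..s} (\<lambda>t. ?L * t\<^sup>2)" by (intro continuous_intros)
      fix t assume t: "r < t" "t < s"
      show "(\<phi> has_vector_derivative \<phi>' t) (at t)" by (rule d)
      have "((\<lambda>t. ?L * t\<^sup>2) has_real_derivative ?L * (2 * t)) (at t)" by (auto intro!: derivative_eq_intros)
      then show "((\<lambda>t. ?L * t\<^sup>2) has_vector_derivative ?L * (2 * t)) (at t)"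
        by (simp add: has_real_derivative_iff_has_vector_derivative)
      have "t \<noteq> 0" using t r by simp
      from Ht_ode[OF b this]
      have eq: "\<phi>' t = (2 * t) *\<^sub>R ent (Wt b t - Wt b r) i j"
        by (simp add: \<phi>'_def scaleR_right_diff_distrib)
      have "norm (ent (Wt b t - Wt b r) i j) \<le> lipW * \<bar>t - r\<bar>"
        using norm_ent_le[of "Wt b t - Wt b r" i j] Wt_diff_le[OF b, of t r] by simp
      also have "\<dots> \<le> ?L" using t lipW_nonneg by (intro mult_left_mono) auto
      finally have "2 * t * norm (ent (Wt b t - Wt b r) i j) \<le> 2 * t * ?L"
        using t r by (intro mult_left_mono) auto
      then show "norm (\<phi>' t) \<le> ?L * (2 * t)"
        unfolding eq using t r by (simp add: mult_ac)
    qed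
    moreover have "\<phi> s - \<phi> r = ent (Ht b s - Ht b r - (s\<^sup>2 - r\<^sup>2) *\<^sub>R Wt b r) i j"
      by (simp add: \<phi>_def scaleR_diff_left)
    ultimately show ?thesis by (simp add: right_diff_distrib)
  qed
  have "norm (Ht b s - Ht b r - (s\<^sup>2 - r\<^sup>2) *\<^sub>R Wt b r) \<le> (\<Sum>i<k. \<Sum>j<k. norm (ent (Ht b s - Ht b r - (s\<^sup>2 - r\<^sup>2) *\<^sub>R Wt b r) i j))"
    by (intro norm_le_sum_ent corner_minus corner_scaleR corner_Ht b c)
  also have "\<dots> \<le> (\<Sum>i<k. \<Sum>j<k. ?L * (s\<^sup>2 - r\<^sup>2))" by (intro sum_mono e)
  finally show ?thesis by (simp add: power2_eq_square)
qed

definition "bdF b = (norm b + norm A)\<^sup>2 * D"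
definition "cF b = bdF b * lipH * ((norm V)\<^sup>2 * D) + bdF b * bdF b * ((real k)\<^sup>2 * lipW)"

text \<open>For inverses \<open>F' - F = - F' * (H' - H) * F\<close>. Inserting the first-order step
  of \<open>H\<close> gives \<open>- t * h\<close> up to replacing \<open>F' * H\<close> by the
  unit. The condition \<open>s <= 1\<close> provides the uniform bound \<open>bdF\<close>.\<close>

lemma fs_step:
  assumes b: "up b" and r: "0 \<le> r" "r < s" "s \<le> 1"
  shows "norm (fs (s *\<^sub>R A) b - fs (r *\<^sub>R A) b + (s\<^sup>2 - r\<^sup>2) *\<^sub>R evf (Ht b r)) \<le> cF b * ((s - r) * (s\<^sup>2 - r\<^sup>2))"
proof -
  define F F' H H' t h where "F = fs (r *\<^sub>R A) b" and "F' = fs (s *\<^sub>R A) b" and "H = Ht b r" and "H' = Ht b s"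
    and "t = s\<^sup>2 - r\<^sup>2" and "h = evf H"
  define e where "e = H' - H - t *\<^sub>R (H * h * H)"
  have t: "0 \<le> t" using r by (simp add: t_def power_mono)
  have i: "inverses k H F" "inverses k H' F'"
    using fs_props(1)[OF b sA] by (auto simp: H_def H'_def F_def F'_def Ht_def)
  have ie: "H * F = dg k 1" "H' * F' = dg k 1" "F' * H' = dg k 1" "corner k F" "corner k F'" "corner k H" "corner k H'"
    using i by (auto simp: inverses_def)
  have ch: "corner k h" unfolding h_def by (intro corner_evf ie)
  have nF: "norm (fs (q *\<^sub>R A) b) \<le> bdF b" if "\<bar>q\<bar> \<le> 1" for q
  proof -
    have "norm (b - dg k (q *\<^sub>R A)) \<le> norm b + norm (dg k (q *\<^sub>R A))" by (rule norm_triangle_ineq4)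
    also have "\<dots> \<le> norm b + norm A"
      using norm_dg_le[of k "q *\<^sub>R A"] that mult_right_mono[of "\<bar>q\<bar>" 1 "norm A"] by simp
    finally have "(norm (b - dg k (q *\<^sub>R A)))\<^sup>2 \<le> (norm b + norm A)\<^sup>2" by (intro power_mono) auto
    then have "(norm (b - dg k (q *\<^sub>R A)))\<^sup>2 * D \<le> bdF b" unfolding bdF_def using D_nonneg by (rule mult_right_mono)
    then show ?thesis using fs_props(3)[OF b sA] order_trans by blast
  qed
  have nFF: "norm F \<le> bdF b" "norm F' \<le> bdF b" unfolding F_def F'_def using r by (auto intro: nF)
  have e: "norm e \<le> (real k)\<^sup>2 * (lipW * (s - r) * t)"
    using Ht_step[OF b r(1,2)] by (simp add: e_def H_def H'_def t_def h_def Wt_def)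
  have "F' * (H' - H) * F = F' * H' * F - F' * (H * F)" by (simp only: left_diff_distrib right_diff_distrib mult.assoc)
  then have 1: "F' * (H' - H) * F = F - F'" by (simp add: ie dg_one_left dg_one_right)
  have "F' * (H' - H) * F = F' * (t *\<^sub>R (H * h * H) + e) * F" by (simp add: e_def)
  also have "\<dots> = t *\<^sub>R (F' * H * h * (H * F)) + F' * e * F" by (simp add: distrib_left distrib_right mult.assoc)
  also have "F' * H * h * (H * F) = F' * H * h" using dg_one_right[OF ch] by (simp add: ie mult.assoc)
  also have "F' * H * h = h - F' * (H' - H) * h"
    by (simp add: left_diff_distrib right_diff_distrib ie dg_one_left[OF ch])
  finally have "F' - F + t *\<^sub>R h = t *\<^sub>R (F' * (H' - H) * h) - F' * e * F"
    unfolding 1 by (simp add: scaleR_right_diff_distrib algebra_simps)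
  also have "norm \<dots> \<le> t * norm (F' * (H' - H) * h) + norm (F' * e * F)"
    using norm_triangle_ineq4[of "t *\<^sub>R (F' * (H' - H) * h)" "F' * e * F"] t by simp
  also have "\<dots> \<le> t * (bdF b * (lipH * (s - r)) * ((norm V)\<^sup>2 * D)) + bdF b * ((real k)\<^sup>2 * (lipW * (s - r) * t)) * bdF b"
  proof (intro add_mono mult_left_mono t)
    have "norm (H' - H) \<le> lipH * (s - r)" "norm h \<le> (norm V)\<^sup>2 * D"
      using Ht_diff_le[OF b, of s r] r norm_evf_Ht_le[OF b, of r] by (auto simp: H_def H'_def h_def)
    then show "norm (F' * (H' - H) * h) \<le> bdF b * (lipH * (s - r)) * ((norm V)\<^sup>2 * D)"
      by (intro norm_mult3_mono nFF)
    show "norm (F' * e * F) \<le> bdF b * ((real k)\<^sup>2 * (lipW * (s - r) * t)) * bdF b"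
      by (intro norm_mult3_mono nFF e)
  qed
  also have "\<dots> = cF b * ((s - r) * t)" by (simp add: cF_def algebra_simps)
  finally show ?thesis by (simp add: F_def F'_def t_def h_def H_def)
qed

end

section \<open>The Lindeberg exchange\<close>

lemma (in half_plane) zero_shift:
  assumes w: "up w" shows "inverses k w (rs 0 w)" "gs 0 w = rs 0 w" "fs 0 w = w"
proof -
  show i: "inverses k w (rs 0 w)" using up_rs(1)[OF w, of 0] by simp
  have "ovr k B (rs 0 w)" using calg_B by (intro up_rs(3)[OF w _ calg_B]) (auto intro: calgD)
  then show g: "gs 0 w = rs 0 w" by (simp add: gs_def Ef_id)
  show "fs 0 w = w" using res_eq[OF inverses_sym[OF i]] by (simp add: fs_def g)
qed

lemma (in half_plane) rs_fs: "up w \<Longrightarrow> cstar x = x \<Longrightarrow> rs 0 (fs x w) = gs x w"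
  using inverses_unique[OF zero_shift(1)[OF fs_props(2)] inverses_sym[OF fs_props(1)]] by blast

locale exchange = iid_family B E k Z Pi n y + arcsine_half_plane B E k Z Pi et A V
  for B :: "'a::cstar_algebra set" and E k Z Pi n y et A V +
  assumes V_Y: "V = Y"
begin

text \<open>A bound for \<open>U0\<close> free of \<open>n\<close>, with \<open>nu\<close> replaced
  by its value at \<open>n = 1\<close>.\<close>

definition "U1 = norm (eta 1) * D + real k * D\<^sup>2 * sqrt (S4 + 2 * norm Y ^ 4) * sqrt (norm (eta 1))"

lemma U0_bounds: "0 \<le> U0" "U0 \<le> U1"
proof -
  have "nu \<le> S4 + 2 * norm Y ^ 4"
    using n_pos divide_left_mono[of 1 "real n" "2 * norm Y ^ 4"] by (simp add: nu_def)
  then show "U0 \<le> U1" unfolding U0_def U1_def rho0_def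
    by (intro add_mono mult_right_mono mult_left_mono) auto
  show "0 \<le> U0" unfolding U0_def using rho0_nonneg D_nonneg by simp
qed

lemma evf_etaf: "evf X = etaf X"
  unfolding evf_def etaf_def by (simp only: V_Y)

text \<open>The summands \<open>y\<^sub>i\<close> are exchanged one at a time, from the innermost outwards, against
  the increment of \<open>sqrt t A\<close> over a time step of length \<open>1 / n\<close>.\<close>

lemma lindeberg:
  assumes b: "up b" and large: "2 * U1 * D \<le> real n"
  shows "norm (gs Y b - gs A b) \<le> D\<^sup>2 * (rho0 + 2 * D * U1\<^sup>2 / real n + cF b / sqrt (real n))"
proof -
  have np: "real n > 0" using n_pos by simp
  \<comment> \<open>Equal steps of time: the squares of consecutive \<open>r j\<close> differ by
    \<open>1 / n\<close>.\<close>
  define r where "r j = sqrt (real j / real n)" for j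
  define w where "w j = fs (r j *\<^sub>R A) b" for j
  \<comment> \<open>Hybrids: the first \<open>i\<close> summands of \<open>Y\<close> followed by the
    arcsine flow up to time \<open>(n - i) / n\<close>. They run from the transform of
    \<open>A\<close> at \<open>i = 0\<close> to that of \<open>Y\<close> at
    \<open>i = n\<close>.\<close>
  define f where "f i = gs (ps i) (w (n - i))" for i
  define \<epsilon> where "\<epsilon> = rho0 / real n + 2 * D * (U1 / real n)\<^sup>2 + cF b / (real n * sqrt (real n))"
  have upw: "up (w j)" for j unfolding w_def by (rule fs_props(2)[OF b sA])
  have rw: "rs 0 (w j) = Ht b (r j)" for j unfolding w_def Ht_def by (rule rs_fs[OF b sA])
  have small: "U0 * D / real n \<le> 1 / 2"
    using U0_bounds large np mult_right_mono[OF U0_bounds(2) D_nonneg] by (simp add: field_simps)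
  have step: "norm (f (Suc i) - f i) \<le> D\<^sup>2 * \<epsilon>" if i: "i < n" for i
  proof -
    define j where "j = n - Suc i"
    have j: "n - i = Suc j" "j < n" using i by (auto simp: j_def)
    have f: "f (Suc i) = gs (ps i) (fs (y i) (w j))" "f i = gs (ps i) (w (Suc j))"
      unfolding f_def j(1) j_def[symmetric] using gs_compose[OF upw i] by auto
    have "norm (f (Suc i) - f i) \<le> D\<^sup>2 * norm (fs (y i) (w j) - w (Suc j))"
      unfolding f using i by (intro gs_diff_le fs_props(2) upw y_selfadj ps_selfadj) auto
    also have "norm (fs (y i) (w j) - w (Suc j)) \<le> \<epsilon>"
    proof -
      have sq: "(r (Suc j))\<^sup>2 - (r j)\<^sup>2 = 1 / real n" by (simp add: r_def diff_divide_distrib[symmetric])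
      have rr: "0 \<le> r j" "r j < r (Suc j)" "r (Suc j) \<le> 1"
        using j np by (auto simp: r_def divide_strict_right_mono)
      \<comment> \<open>This bound holds even at \<open>j = 0\<close>, where the square root is
        steepest; it makes the flow error per step of order \<open>n^(-3/2)\<close>.\<close>
      have d: "r (Suc j) - r j \<le> 1 / sqrt (real n)"
      proof -
        have "sqrt (real j / real n + 1 / real n) \<le> sqrt (real j / real n) + sqrt (1 / real n)"
          by (rule sqrt_add_le_add_sqrt) auto
        moreover have "real (Suc j) / real n = real j / real n + 1 / real n" by (simp add: add_divide_distrib)
        ultimately show ?thesis unfolding r_def by (simp add: real_sqrt_divide)
      qed
      have "norm (w (Suc j) - w j + (1 / real n) *\<^sub>R etaf (rs 0 (w j))) \<le> cF b * ((r (Suc j) - r j) * (1 / real n))"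
        using fs_step[OF b rr, folded w_def] by (simp add: sq rw evf_etaf)
      also have "\<dots> \<le> cF b * ((1 / sqrt (real n)) * (1 / real n))"
      proof (intro mult_left_mono mult_right_mono d)
        show "0 \<le> cF b" using D_nonneg lipH_nonneg lipW_nonneg by (simp add: cF_def bdF_def)
      qed (use np in simp)
      finally have 1: "norm (w (Suc j) - w j + (1 / real n) *\<^sub>R etaf (rs 0 (w j))) \<le> cF b / (real n * sqrt (real n))"
        by (simp add: mult.commute)
      have 2: "norm (fs (y i) (w j) - (w j - (1 / real n) *\<^sub>R etaf (rs 0 (w j)))) \<le> rho0 / real n + 2 * D * (U0 / real n)\<^sup>2"
        by (rule fs_expansion[OF upw i small])
      have 3: "2 * D * (U0 / real n)\<^sup>2 \<le> 2 * D * (U1 / real n)\<^sup>2"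
        using U0_bounds np D_nonneg by (intro mult_left_mono power_mono divide_right_mono) auto
      have "fs (y i) (w j) - w (Suc j) = (fs (y i) (w j) - (w j - (1 / real n) *\<^sub>R etaf (rs 0 (w j))))
         - (w (Suc j) - w j + (1 / real n) *\<^sub>R etaf (rs 0 (w j)))" by simp
      then have "norm (fs (y i) (w j) - w (Suc j)) \<le> norm (fs (y i) (w j) - (w j - (1 / real n) *\<^sub>R etaf (rs 0 (w j))))
         + norm (w (Suc j) - w j + (1 / real n) *\<^sub>R etaf (rs 0 (w j)))" by (metis norm_triangle_ineq4)
      then show ?thesis using 1 2 3 by (simp add: \<epsilon>_def)
    qed
    finally show ?thesis by (simp add: mult_left_mono)
  qed
  have "gs A b = f 0"
    using zero_shift(2)[OF upw[of n]] rw[of n] np by (simp add: f_def ps_def r_def Ht_def)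
  moreover have "gs Y b = f n"
    using zero_shift(3)[OF b] by (simp add: f_def Y_def w_def r_def)
  moreover have "f n - f 0 = (\<Sum>i<n. f (Suc i) - f i)" by (rule sum_lessThan_telescope[symmetric])
  ultimately have "norm (gs Y b - gs A b) \<le> (\<Sum>i<n. D\<^sup>2 * \<epsilon>)"
    using step by (simp only:) (rule sum_norm_le, simp)
  also have "\<dots> = D\<^sup>2 * (rho0 + 2 * D * U1\<^sup>2 / real n + cF b / sqrt (real n))"
    using np by (simp add: \<epsilon>_def field_simps power2_eq_square)
  finally show ?thesis .
qed

end

section \<open>Translation to the matrices of the statement\<close>

lemma mnorm_tofm:
  assumes "M \<in> carrier_mat k k" shows "mnorm k M = norm (tofm k M)"
proof -
  have "form k z (tofm k M) x = (\<Sum>i<k. \<Sum>j<k. cstar (z i) * M $$ (i, j) * x j)" for z x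
    by (simp add: form_def tofm_def ent_mk)
  then show ?thesis unfolding norm_eq_Sup[OF corner_tofm] mnorm_def vn_le_1 vip_def by simp
qed

lemma tofm_one: "tofm k (1\<^sub>m k) = dg k 1"
  by (rule corner_eqI[of k]) (auto simp: tofm_def ent_mk ent_dg corner_mk)

lemma tofm_minus: "M \<in> carrier_mat k k \<Longrightarrow> N \<in> carrier_mat k k \<Longrightarrow> tofm k (M - N) = tofm k M - tofm k N"
  by (rule corner_eqI[of k]) (auto simp: tofm_def ent_mk corner_minus corner_mk)

lemma tofm_smult_one: "tofm k (x \<cdot>\<^sub>m 1\<^sub>m k) = dg k x"
  by (rule corner_eqI[of k]) (auto simp: tofm_def ent_mk ent_dg corner_mk)

lemma tofm_mIm:
  assumes "M \<in> carrier_mat k k" shows "tofm k (mIm M) = imp k (tofm k M)"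
proof (rule corner_eqI[of k])
  fix i j assume "i < k" "j < k"
  then show "ent (tofm k (mIm M)) i j = ent (imp k (tofm k M)) i j"
    using assms by (simp add: imp_def ent_dg_times mIm_def tofm_def ent_mk madj_def)
qed (auto intro: corner_imp)

lemma inverses_tofm:
  assumes "M \<in> carrier_mat k k" "N \<in> carrier_mat k k"
  shows "inverses k (tofm k M) (tofm k N) \<longleftrightarrow> M * N = 1\<^sub>m k \<and> N * M = 1\<^sub>m k"
proof -
  have "P = 1\<^sub>m k \<longleftrightarrow> tofm k P = dg k 1" if "P \<in> carrier_mat k k" for P :: "'a mat"
    using ofm_tofm[OF that] ofm_tofm[of "1\<^sub>m k" k] tofm_one[of k, where ?'a = 'a] by (metis one_carrier_mat)
  from this[of "M * N"] this[of "N * M"] show ?thesis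
    using assms by (auto simp: inverses_def tofm_times[symmetric])
qed

lemma minv_eq:
  assumes M: "M \<in> carrier_mat k k" and R: "inverses k (tofm k M) R"
  shows "minv k M = ofm k R"
  unfolding minv_def
proof (rule the_equality)
  have cR: "corner k R" using R by (simp add: inverses_def)
  have "inverses k (tofm k M) (tofm k (ofm k R))" using R tofm_ofm[OF cR] by simp
  then show "ofm k R \<in> carrier_mat k k \<and> M * ofm k R = 1\<^sub>m k \<and> ofm k R * M = 1\<^sub>m k"
    using inverses_tofm[OF M ofm_carrier] by simp
  fix N assume N: "N \<in> carrier_mat k k \<and> M * N = 1\<^sub>m k \<and> N * M = 1\<^sub>m k"
  then have "tofm k N = R" using inverses_tofm[OF M, of N] inverses_unique[OF _ R] by blast
  then show "N = ofm k R" using N ofm_tofm by metis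
qed

lemma (in half_plane) tofm_cauchy:
  assumes b: "b \<in> carrier_mat k k" "up (tofm k b)" and x: "cstar x = x"
  shows "cauchy k E x b \<in> carrier_mat k k" "tofm k (cauchy k E x b) = gs x (tofm k b)"
proof -
  have M: "b - x \<cdot>\<^sub>m 1\<^sub>m k \<in> carrier_mat k k" using b by auto
  have "tofm k (b - x \<cdot>\<^sub>m 1\<^sub>m k) = tofm k b - dg k x" using b by (simp add: tofm_minus tofm_smult_one)
  then have "minv k (b - x \<cdot>\<^sub>m 1\<^sub>m k) = ofm k (rs x (tofm k b))"
    using minv_eq[OF M] up_rs(1)[OF b(2) x] by simp
  then have c: "cauchy k E x b = map_mat E (ofm k (rs x (tofm k b)))" by (simp add: cauchy_def)
  show "cauchy k E x b \<in> carrier_mat k k" by (simp add: c)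
  show "tofm k (cauchy k E x b) = gs x (tofm k b)"
    unfolding c by (simp add: tofm_E tofm_ofm up_rs_corner[OF b(2) x] gs_def)
qed

theorem theorem4p6:
  fixes B :: "'a::cstar_algebra set" and E :: "'a \<Rightarrow> 'a"
    and Y A :: 'a and eta :: "'a \<Rightarrow> 'a" and k :: nat and b :: "'a mat"
  assumes "opval_cstar_prob_space B E"
    and "cstar Y = Y" and "monotone_inf_div B E Y" and "E Y = 0"
    and "\<forall>c\<in>B. E (Y * c * Y) = eta c"
    and "arcsine B E eta A"
    and "k \<ge> 1" and "b \<in> upper_half B k"
  shows "mnorm k (cauchy k E Y b - cauchy k E A b)
    \<le> real k * (mnorm k (minv k (mIm b))) ^ 4 * sqrt (norm (eta 1))
      * sqrt (Sup {norm (h4 E Y c c') | c c'. c \<in> B \<and> c' \<in> B \<and> norm c = 1 \<and> norm c' = 1})"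
proof -
  define S where "S = Sup {norm (h4 E Y c c') | c c'. c \<in> B \<and> c' \<in> B \<and> norm c = 1 \<and> norm c' = 1}"
  define X where "X = tofm k b"
  have b: "b \<in> carrier_mat k k" "\<And>i j. i < k \<Longrightarrow> j < k \<Longrightarrow> b $$ (i, j) \<in> B" "mpos k (mIm b)" "minvertible k (mIm b)"
    using assms(8) by (auto simp: upper_half_def)
  have cIm: "mIm b \<in> carrier_mat k k" using b(3) by (simp add: mpos_def)
  obtain Zm where Zm: "Zm \<in> carrier_mat k k" "mIm b = madj Zm * Zm" using b(3) by (auto simp: mpos_def)
  obtain Pm where Pm: "Pm \<in> carrier_mat k k" "mIm b * Pm = 1\<^sub>m k" "Pm * mIm b = 1\<^sub>m k"
    using b(4) by (auto simp: minvertible_def)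
  define Z Pi where "Z = tofm k Zm" and "Pi = tofm k Pm"
  have imX: "imp k X = adj Z * Z"
    unfolding X_def tofm_mIm[OF b(1), symmetric] Zm(2) using Zm(1) by (simp add: tofm_times madj_carrier tofm_madj Z_def)
  have inv: "inverses k (adj Z * Z) Pi"
    using inverses_tofm[OF cIm Pm(1)] Pm tofm_mIm[OF b(1)] imX by (simp add: X_def Pi_def)
  interpret opval_space B E by unfold_locales (rule assms(1))
  interpret half_plane B E k Z Pi
    by unfold_locales (use inv in \<open>auto simp: inverses_def Z_def Pi_def\<close>)
  have "ovr k B X" unfolding ovr_def using b(2) calg_B by (auto simp: X_def tofm_def corner_mk ent_mk calgD)
  then have up: "up X" by (simp add: up_def imX)
  have sA: "cstar A = A" using assms(6) by (simp add: arcsine_def)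
  have DM: "mnorm k (minv k (mIm b)) = D"
  proof -
    have "minv k (mIm b) = ofm k Pi"
      using minv_eq[OF cIm] inv imX tofm_mIm[OF b(1)] by (simp add: X_def)
    then show ?thesis by (simp add: mnorm_tofm tofm_ofm corner_Pi D_def)
  qed
  have LHS: "mnorm k (cauchy k E Y b - cauchy k E A b) = norm (gs Y X - gs A X)"
    using tofm_cauchy[OF b(1) up[unfolded X_def] assms(2)] tofm_cauchy[OF b(1) up[unfolded X_def] sA]
    by (simp add: mnorm_tofm tofm_minus X_def minus_carrier_mat)
  \<comment> \<open>These constants are fixed before \<open>n\<close>: the decomposition of
    \<open>Y\<close> changes with \<open>n\<close>, but \<open>N\<close>, \<open>U\<close> and
    \<open>c\<close> do not, so the limit can be taken.\<close>
  define N where "N = norm Y ^ 4"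
  define U where "U = norm (eta 1) * D + real k * D\<^sup>2 * sqrt (S + 2 * N) * sqrt (norm (eta 1))"
  define c where "c = arcsine_half_plane.cF k Pi A Y X"
  have bound: "norm (gs Y X - gs A X) \<le> D\<^sup>2 * (real k * D\<^sup>2 * sqrt (S + 2 * N / real n) * sqrt (norm (eta 1))
      + 2 * D * U\<^sup>2 / real n + c / sqrt (real n))" if n: "n \<ge> 1" "2 * U * D \<le> real n" for n
  proof -
    from assms(3)[unfolded monotone_inf_div_def, rule_format, OF n(1)]
    obtain y where y: "\<forall>i<n. cstar (y i) = y i"
      "\<forall>i<n. \<forall>bs. set bs \<subseteq> B \<longrightarrow> E (word (y i) bs) = E (word (y 0) bs)"
      "Y = (\<Sum>i<n. y i)" "mono_indep B E n y" by (elim exE conjE)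
    interpret mono_family B E n y by unfold_locales (rule y(4))
    have Y: "Y = ps n" by (simp add: ps_def y(3))
    interpret ex: iid_family B E k Z Pi n y
    proof unfold_locales
      show "cstar (y i) = y i" if "i < n" for i using that y(1) by blast
      show "1 \<le> n" by (rule n)
      show "E (ps n) = 0" using assms(4) by (simp only: Y)
      show "E (word (y i) bs) = E (word (y 0) bs)" if "i < n" "set bs \<subseteq> B" for i bs
        using that y(2) by blast
    qed
    interpret ex: exchange B E k Z Pi n y eta A Y
      by unfold_locales (use assms(5,6) Y ex.Y_def in auto)
    have eq: "ex.eta 1 = eta 1" 
      using assms(5)[rule_format, OF ex.one_B] by (simp add: ex.eta_def ex.Y_def Y[symmetric])
    have S: "ex.S4 = S" by (simp add: ex.S4_def S_def ex.Y_def Y[symmetric])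
    have "ex.U1 = U" by (simp add: ex.U1_def U_def eq S N_def ex.Y_def Y[symmetric])
    then show ?thesis
      using ex.lindeberg[OF up] n(2)
      by (simp add: ex.rho0_def ex.nu_def eq S N_def ex.Y_def Y[symmetric] c_def)
  qed
  \<comment> \<open>Only the contribution of \<open>rho0\<close> survives, and the two factors
    \<open>D^2\<close> combine to the fourth power.\<close>
  have "(\<lambda>n. D\<^sup>2 * (real k * D\<^sup>2 * sqrt (S + 2 * N / real n) * sqrt (norm (eta 1)) + 2 * D * U\<^sup>2 / real n + c / sqrt (real n)))
    \<longlonglongrightarrow> D\<^sup>2 * (real k * D\<^sup>2 * sqrt (S + 0) * sqrt (norm (eta 1)) + 0 + 0)"
  proof (intro tendsto_intros lim_const_over_n)
    show "(\<lambda>n. c / sqrt (real n)) \<longlonglongrightarrow> 0"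
      by (intro tendsto_divide_0[OF tendsto_const] filterlim_at_top_imp_at_infinity
          filterlim_compose[OF sqrt_at_top filterlim_real_sequentially])
  qed
  moreover have "\<exists>M. \<forall>n\<ge>M. norm (gs Y X - gs A X) \<le> D\<^sup>2 * (real k * D\<^sup>2 * sqrt (S + 2 * N / real n) * sqrt (norm (eta 1))
      + 2 * D * U\<^sup>2 / real n + c / sqrt (real n))"
  proof -
    obtain M :: nat where "2 * U * D \<le> real M" using real_arch_simple by blast
    then have "2 * U * D \<le> real n" "1 \<le> n" if "n \<ge> Suc M" for n using that by auto
    then show ?thesis using bound by blast
  qed
  ultimately have "norm (gs Y X - gs A X) \<le> D\<^sup>2 * (real k * D\<^sup>2 * sqrt (S + 0) * sqrt (norm (eta 1)) + 0 + 0)"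
    by (rule LIMSEQ_le_const)
  also have "\<dots> = real k * D ^ 4 * sqrt (norm (eta 1)) * sqrt S"
    by (simp add: power2_eq_square power4_eq_xxxx)
  finally show ?thesis unfolding LHS DM S_def .
qed

end
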